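(* Let $V_{\ell;t}=(\hat a_{\ell,-\ell}(t),\dots,\hat a_{\ell,\ell}(t))$ and let $Z_{2\ell+1}$ be a centred Gaussian vector of dimension $2\ell+1$ with covariance matrix $\frac{4\pi}{2\ell+1}I_{2\ell+1}$. Then, as $\ell\to\infty$ and $\nu_t\to\infty$ jointly, $$d_3(V_{\ell;t},Z_{2\ell+1})\le\sup_{g\in\mathcal I}B_3(g;\ell)\,\sqrt{8\sqrt{4\pi}\,\frac{1.539\,\log\ell}{\ell\,\nu_t}+O\left(\frac{1}{\ell\,\nu_t}\right)},$$ where $$B_3(g;\ell):=\frac{\sqrt{2(2\ell+1)}}{4}M_2(g)+\frac29\sqrt{(2\ell+1)4\pi}\,M_3(g).$$
   Context: Let $\mu$ be the Lebesgue (surface) measure on the unit sphere $\mathbb S^2\subset\mathbb R^3$, so $\mu(\mathbb S^2)=4\pi$. For $t>0$ let $\nu_t>0$ be the rate (with $\nu_t\to\infty$ as $t\to\infty$) and let $N_t$ be a Poisson random measure on $\mathbb S^2$ with intensity measure $\nu_t\,\mu$ and charged points $\xi_k$, $k=1,\dots,N_t(\mathbb S^2)$. Let $\{Y_{\ell m}\}_{m=-\ell,\dots,\ell}$ be the real fully normalized spherical harmonics, an $L^2(\mathbb S^2,\mu)$-orthonormal basis of the eigenspace of the spherical Laplacian with eigenvalue $-\ell(\ell+1)$: in spherical coordinates, $Y_{\ell m}(\theta,\phi)=\sqrt{\frac{2\ell+1}{2\pi}\frac{(\ell-m)!}{(\ell+m)!}}P_\ell^m(\cos\theta)\cos(m\phi)$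 for $m\ge1$, $Y_{\ell0}=\sqrt{\frac{2\ell+1}{4\pi}}P_\ell(\cos\theta)$, and $Y_{\ell m}(\theta,\phi)=\sqrt{\frac{2\ell+1}{2\pi}\frac{(\ell+m)!}{(\ell-m)!}}P_\ell^{-m}(\cos\theta)\sin(-m\phi)$ for $m\le-1$, where $P_\ell$ is the Legendre polynomial and $P_\ell^m(u)=(1-u^2)^{m/2}\frac{d^m}{du^m}P_\ell(u)$. The random spherical harmonic coefficients are $$\hat a_{\ell,m}(t):=\sqrt{\frac{4\pi}{(2\ell+1)\nu_t}}\sum_{k=1}^{N_t(\mathbb S^2)}Y_{\ell m}(\xi_k),\qquad m=-\ell,\dots,\ell.$$ For $g\in C^{k-1}(\mathbb R^d)$, $k\ge1$, put $M_k(g):=\sup_{x\ne y}\frac{\|D^{k-1}g(x)-D^{k-1}g(y)\|_{op}}{\|x-y\|_{\mathbb R^d}}$, where $D^{k-1}g(x)$ is viewed as a multilinear form and $\|\psi\|_{op}=\sup\{|\psi(u_1,\dots,u_j)|:\|u_i\|_2=1\}$. Let $\mathcal I$ be the class of all $h\in C^3(\mathbb R^d)$ with $\|h''\|_\infty\le1$ and $\|h'''\|_\infty\le1$, where $\|h^{(j)}\|_\infty=\sup_x\|D^jh(x)\|_{op}$; here $d=2\ell+1$. For random vectors $X,Y$ in $\mathbb R^d$ with finite second moments, $d_3(X,Y)=\sup_{h\in\mathcal I}|\mathbb E[h(X)]-\mathbb E[h(Y)]|$. *)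

theory Defs
  imports "HOL-Probability.Probability" "HOL-Computational_Algebra.Polynomial"
    "HOL-Library.Landau_Symbols"
begin

section \<open>The sphere and real spherical harmonics\<close>

abbreviation S2 :: "(real ^ 3) set" where
  "S2 \<equiv> sphere 0 1"

definition sph_point :: "real \<times> real \<Rightarrow> real ^ 3" where
  "sph_point = (\<lambda>(\<theta>, \<phi>). vector [sin \<theta> * cos \<phi>, sin \<theta> * sin \<phi>, cos \<theta>])"

text \<open>Surface measure \<open>sin \<theta> d\<theta> d\<phi>\<close>, as a Borel measure whose underlying space is the sphere.\<close>

definition S2_measure :: "(real ^ 3) measure" where
  "S2_measure =
     distr (density (restrict_space lborel ({0..pi} \<times> {0..2 * pi})) (\<lambda>(\<theta>, \<phi>). ennreal (sin \<theta>)))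
       (restrict_space borel S2) sph_point"

lemma sph_point_measurable: "sph_point \<in> borel_measurable borel"
proof -
  have "sph_point = (\<lambda>p. \<chi> i. if i = 1 then sin (fst p) * cos (snd p) else if i = 2 then sin (fst p) * sin (snd p) else cos (fst p))"
    by (auto simp: sph_point_def vec_eq_iff forall_3)
  moreover have "continuous_on UNIV (\<lambda>p::real\<times>real. (\<chi> i::3. if i = 1 then sin (fst p) * cos (snd p) else if i = 2 then sin (fst p) * sin (snd p) else cos (fst p)))"
  proof (intro continuous_on_vec_lambda)
    fix i :: 3
    show "continuous_on UNIV (\<lambda>p::real\<times>real. if i = 1 then sin (fst p) * cos (snd p) else if i = 2 then sin (fst p) * sin (snd p) else cos (fst p))"
      by (cases "i = 1"; cases "i = 2") (simp_all add: continuous_intros)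
  qed
  ultimately have "continuous_on UNIV sph_point" by (simp only:)
  then show ?thesis by (rule borel_measurable_continuous_onI)
qed

lemma sph_point_S2: "sph_point p \<in> S2"
proof (cases p)
  case (Pair a b)
  have "(sin a * cos b)\<^sup>2 + (sin a * sin b)\<^sup>2 + (cos a)\<^sup>2 = (sin a)\<^sup>2 * ((sin b)\<^sup>2 + (cos b)\<^sup>2) + (cos a)\<^sup>2"
    by (simp add: power_mult_distrib algebra_simps del: sin_cos_squared_add sin_cos_squared_add2)
  then have "(sin a * cos b)\<^sup>2 + (sin a * sin b)\<^sup>2 + (cos a)\<^sup>2 = 1" by simp
  then show ?thesis using Pair
    by (simp add: sph_point_def norm_vec_def L2_set_def sum_3)
qed

lemma S2_measure_total: "emeasure S2_measure S2 = ennreal (4 * pi)"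
proof -
  let ?R = "{0..pi} \<times> {0..2 * pi} :: (real \<times> real) set"
  have mp: "sph_point \<in> density (restrict_space lborel ?R) (\<lambda>(\<theta>, \<phi>). ennreal (sin \<theta>)) \<rightarrow>\<^sub>M restrict_space borel S2"
    using sph_point_measurable sph_point_S2
    by (auto intro!: measurable_restrict_space1 measurable_restrict_space2 simp: measurable_lborel2)
  have sR: "?R \<in> sets borel" by (simp add: borel_closed closed_Times)
  have msin [measurable]: "(\<lambda>p::real\<times>real. ennreal (sin (fst p))) \<in> borel_measurable borel"
    by (intro measurable_compose[OF _ measurable_ennreal] borel_measurable_continuous_onI continuous_intros)
  have mm: "(\<lambda>p::real\<times>real. ennreal (sin (fst p)) * indicator ?R p) \<in> borel_measurable borel"
    using msin sR by (intro borel_measurable_times_ennreal borel_measurable_indicator)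
  have "emeasure S2_measure S2 = emeasure (density (restrict_space lborel ?R) (\<lambda>(\<theta>, \<phi>). ennreal (sin \<theta>))) ?R"
    unfolding S2_measure_def
    by (subst emeasure_distr[OF mp])
       (auto simp: sets_restrict_space space_restrict_space sph_point_S2[simplified] image_iff intro!: arg_cong2[where f = emeasure] bexI[of _ UNIV])
  also have "\<dots> = (\<integral>\<^sup>+p. ennreal (sin (fst p)) * indicator ?R p \<partial>restrict_space lborel ?R)"
    using sR by (subst emeasure_density)
       (auto simp: case_prod_unfold sets_restrict_space image_iff measurable_lborel1 intro!: measurable_restrict_space1 bexI[of _ UNIV])
  also have "\<dots> = (\<integral>\<^sup>+p. ennreal (sin (fst p)) * indicator ?R p \<partial>(lborel::(real\<times>real) measure))"
    using sR by (subst nn_integral_restrict_space) (auto intro!: nn_integral_cong split: split_indicator)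
  also have "\<dots> = (\<integral>\<^sup>+x. \<integral>\<^sup>+y. (ennreal (sin x) * indicator {0..pi} x) * indicator {0..2*pi} y \<partial>lborel \<partial>lborel)"
    apply (subst lborel_prod[symmetric])
    apply (subst lborel.nn_integral_fst[symmetric])
     apply (use mm in \<open>simp add: lborel_prod\<close>)
    apply (auto intro!: nn_integral_cong split: split_indicator)
    done
  also have "\<dots> = (\<integral>\<^sup>+x. ennreal (sin x) * indicator {0..pi} x \<partial>lborel) * ennreal (2 * pi)"
    by (simp add: nn_integral_cmult nn_integral_multc)
  also have "(\<integral>\<^sup>+x. ennreal (sin x) * indicator {0..pi} x \<partial>lborel) = ennreal (- cos pi - (- cos 0))"
    by (rule nn_integral_FTC_Icc) (auto intro!: derivative_eq_intros sin_ge_zero)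
  also have "ennreal (- cos pi - (- cos 0)) * ennreal (2 * pi) = ennreal ((- cos pi - (- cos 0)) * (2 * pi))"
    by (rule ennreal_mult[symmetric]) auto
  finally show ?thesis by simp
qed

text \<open>Rodrigues' formula.\<close>

definition legendre :: "nat \<Rightarrow> real poly" where
  "legendre l = smult (1 / (2 ^ l * fact l)) ((pderiv ^^ l) ([:- 1, 0, 1:] ^ l))"

text \<open>\<open>sqrt (1 - u\<^sup>2) ^ m\<close> is \<open>(1 - u\<^sup>2)\<close> to the power \<open>m / 2\<close>; no Condon-Shortley sign.\<close>

definition assoc_legendre :: "nat \<Rightarrow> nat \<Rightarrow> real \<Rightarrow> real" where
  "assoc_legendre l m u = sqrt (1 - u\<^sup>2) ^ m * poly ((pderiv ^^ m) (legendre l)) u"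

definition sph_harmonic_angles :: "nat \<Rightarrow> int \<Rightarrow> real \<Rightarrow> real \<Rightarrow> real" where
  "sph_harmonic_angles l m \<theta> \<phi> =
     (if m \<ge> 1 then
        sqrt ((2 * real l + 1) / (2 * pi) * (fact (nat (int l - m)) / fact (nat (int l + m))))
          * assoc_legendre l (nat m) (cos \<theta>) * cos (of_int m * \<phi>)
      else if m = 0 then
        sqrt ((2 * real l + 1) / (4 * pi)) * poly (legendre l) (cos \<theta>)
      else
        sqrt ((2 * real l + 1) / (2 * pi) * (fact (nat (int l + m)) / fact (nat (int l - m))))
          * assoc_legendre l (nat (- m)) (cos \<theta>) * sin (- of_int m * \<phi>))"

text \<open>The longitude is undetermined at the poles and only determined modulo \<open>2 \<pi>\<close> elsewhere. This is
  harmless: for \<open>m \<noteq> 0\<close> the associated Legendre factor vanishes at the poles.\<close>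

definition sph_harmonic :: "nat \<Rightarrow> int \<Rightarrow> real ^ 3 \<Rightarrow> real" where
  "sph_harmonic l m x = sph_harmonic_angles l m (arccos (x $ 3)) (Arg (Complex (x $ 1) (x $ 2)))"


section \<open>Poisson random measures\<close>

definition poisson_random_measure ::
    "'w measure \<Rightarrow> 'a measure \<Rightarrow> ('w \<Rightarrow> 'a measure) \<Rightarrow> bool" where
  "poisson_random_measure P \<Lambda> N \<longleftrightarrow>
     (\<forall>\<omega>\<in>space P. sets (N \<omega>) = sets \<Lambda>) \<and>
     (\<forall>A\<in>sets \<Lambda>. (\<lambda>\<omega>. emeasure (N \<omega>) A) \<in> borel_measurable P) \<and>
     (\<forall>A\<in>sets \<Lambda>. emeasure \<Lambda> A < \<infinity> \<longrightarrow>
        (\<forall>n::nat. measure P {\<omega>\<in>space P. emeasure (N \<omega>) A = of_nat n} =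
           measure \<Lambda> A ^ n / fact n * exp (- measure \<Lambda> A))) \<and>
     (\<forall>A\<in>sets \<Lambda>. emeasure \<Lambda> A = \<infinity> \<longrightarrow> (AE \<omega> in P. emeasure (N \<omega>) A = \<infinity>)) \<and>
     (\<forall>(n::nat) A. (\<forall>i<n. A i \<in> sets \<Lambda>) \<longrightarrow> disjoint_family_on A {..<n} \<longrightarrow>
        prob_space.indep_vars P (\<lambda>_. borel) (\<lambda>i \<omega>. emeasure (N \<omega>) (A i)) {..<n})"

text \<open>\<open>N \<omega>\<close> is the sum of the Dirac masses at \<open>\<xi> 1 \<omega>, \<dots>, \<xi> (K \<omega>) \<omega>\<close>, points of \<open>S\<close>. Taking \<open>A = S\<close>
  shows that \<open>K \<omega>\<close> is the total mass of \<open>N \<omega>\<close>. The numbering of the points is arbitrary.\<close>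

definition charged_points ::
    "'w measure \<Rightarrow> 'a set \<Rightarrow> ('w \<Rightarrow> 'a measure) \<Rightarrow> ('w \<Rightarrow> nat) \<Rightarrow> (nat \<Rightarrow> 'w \<Rightarrow> 'a) \<Rightarrow> bool" where
  "charged_points P S N K \<xi> \<longleftrightarrow>
     (\<forall>\<omega>\<in>space P. (\<forall>k\<in>{1..K \<omega>}. \<xi> k \<omega> \<in> S) \<and>
        (\<forall>A\<in>sets (N \<omega>). emeasure (N \<omega>) A = of_nat (card {k\<in>{1..K \<omega>}. \<xi> k \<omega> \<in> A})))"

definition harmonic_coeff ::
    "real \<Rightarrow> ('w \<Rightarrow> nat) \<Rightarrow> (nat \<Rightarrow> 'w \<Rightarrow> real ^ 3) \<Rightarrow> nat \<Rightarrow> int \<Rightarrow> 'w \<Rightarrow> real" where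
  "harmonic_coeff \<nu> K \<xi> l m \<omega> =
     sqrt (4 * pi / ((2 * real l + 1) * \<nu>)) * (\<Sum>k = 1..K \<omega>. sph_harmonic l m (\<xi> k \<omega>))"

abbreviation orders :: "nat \<Rightarrow> int set" where
  "orders l \<equiv> {- int l..int l}"

definition coeff_vector ::
    "real \<Rightarrow> ('w \<Rightarrow> nat) \<Rightarrow> (nat \<Rightarrow> 'w \<Rightarrow> real ^ 3) \<Rightarrow> nat \<Rightarrow> 'w \<Rightarrow> int \<Rightarrow> real" where
  "coeff_vector \<nu> K \<xi> l \<omega> = (\<lambda>m\<in>orders l. harmonic_coeff \<nu> K \<xi> l m \<omega>)"


section \<open>Differential calculus on finite-dimensional spaces of varying dimension\<close>

text \<open>Since the dimension varies inside the theorem, \<open>\<real>\<^sup>d\<close> is the set of (extensional) real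
  functions on a finite index set \<open>I\<close> with \<open>d\<close> elements, the space underlying \<open>Pi\<^sub>M I (\<lambda>_. borel)\<close>.
  Its subspace topology in the function type is the Euclidean one.\<close>

abbreviation vecs :: "'i set \<Rightarrow> ('i \<Rightarrow> real) set" where
  "vecs I \<equiv> I \<rightarrow>\<^sub>E UNIV"

text \<open>\<open>partials [i\<^sub>1, \<dots>, i\<^sub>j] h\<close> differentiates first in direction \<open>i\<^sub>j\<close> and last in direction \<open>i\<^sub>1\<close>.\<close>

fun partials :: "'i list \<Rightarrow> (('i \<Rightarrow> real) \<Rightarrow> real) \<Rightarrow> ('i \<Rightarrow> real) \<Rightarrow> real" where
  "partials [] h x = h x"
| "partials (i # is) h x = deriv (\<lambda>s. partials is h (x(i := s))) (x i)"

definition C_class :: "nat \<Rightarrow> 'i set \<Rightarrow> (('i \<Rightarrow> real) \<Rightarrow> real) set" where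
  "C_class k I = {h.
     (\<forall>is. set is \<subseteq> I \<and> length is \<le> k \<longrightarrow> continuous_on (vecs I) (partials is h)) \<and>
     (\<forall>is. set is \<subseteq> I \<and> length is < k \<longrightarrow>
        (\<forall>i\<in>I. \<forall>x\<in>vecs I. (\<lambda>s. partials is h (x(i := s))) field_differentiable at (x i)))}"

text \<open>\<open>D\<^sup>j h(x)\<close> as a \<open>j\<close>-linear form in the vectors \<open>u 0, \<dots>, u (j - 1)\<close>.\<close>

definition D_form ::
    "'i set \<Rightarrow> nat \<Rightarrow> (('i \<Rightarrow> real) \<Rightarrow> real) \<Rightarrow> ('i \<Rightarrow> real) \<Rightarrow> (nat \<Rightarrow> 'i \<Rightarrow> real) \<Rightarrow> real" where
  "D_form I j h x u =
     (\<Sum>is\<in>{is. set is \<subseteq> I \<and> length is = j}. partials is h x * (\<Prod>k<j. u k (is ! k)))"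

definition op_norm :: "'i set \<Rightarrow> nat \<Rightarrow> ((nat \<Rightarrow> 'i \<Rightarrow> real) \<Rightarrow> real) \<Rightarrow> ennreal" where
  "op_norm I j \<psi> = (SUP u\<in>{u. \<forall>k<j. u k \<in> vecs I \<and> L2_set (u k) I = 1}. ennreal \<bar>\<psi> u\<bar>)"

definition D_sup_norm :: "'i set \<Rightarrow> nat \<Rightarrow> (('i \<Rightarrow> real) \<Rightarrow> real) \<Rightarrow> ennreal" where
  "D_sup_norm I j h = (SUP x\<in>vecs I. op_norm I j (D_form I j h x))"

definition M_const :: "'i set \<Rightarrow> nat \<Rightarrow> (('i \<Rightarrow> real) \<Rightarrow> real) \<Rightarrow> ennreal" where
  "M_const I k g =
     (SUP (x, y)\<in>{(x, y). x \<in> vecs I \<and> y \<in> vecs I \<and> x \<noteq> y}.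
        op_norm I (k - 1) (\<lambda>u. D_form I (k - 1) g x u - D_form I (k - 1) g y u)
          / ennreal (L2_set (\<lambda>i. x i - y i) I))"

definition test_class :: "'i set \<Rightarrow> (('i \<Rightarrow> real) \<Rightarrow> real) set" where
  "test_class I = {h \<in> C_class 3 I. D_sup_norm I 2 h \<le> 1 \<and> D_sup_norm I 3 h \<le> 1}"


section \<open>Probability metric and Gaussian vectors\<close>

text \<open>Meaningful for random vectors with finite second moments: a test function has bounded second
  derivative, hence at most quadratic growth, so both expectations exist.\<close>

definition d3 :: "'i set \<Rightarrow> 'w measure \<Rightarrow> ('w \<Rightarrow> 'i \<Rightarrow> real) \<Rightarrow>
    'z measure \<Rightarrow> ('z \<Rightarrow> 'i \<Rightarrow> real) \<Rightarrow> ennreal" where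
  "d3 I P X Q Y =
     (SUP h\<in>test_class I. ennreal \<bar>(\<integral>\<omega>. h (X \<omega>) \<partial>P) - (\<integral>\<omega>. h (Y \<omega>) \<partial>Q)\<bar>)"

text \<open>Centred normal law on the line with variance \<open>v\<close>, a point mass if \<open>v = 0\<close>.\<close>

definition centred_normal :: "real \<Rightarrow> real measure" where
  "centred_normal v =
     (if v = 0 then return borel 0 else density lborel (\<lambda>x. ennreal (normal_density 0 (sqrt v) x)))"

text \<open>Every linear combination of the coordinates is centred normal, with the variance prescribed by
  the covariance matrix.\<close>

definition centred_gaussian_vector ::
    "'z measure \<Rightarrow> 'i set \<Rightarrow> ('i \<Rightarrow> 'i \<Rightarrow> real) \<Rightarrow> ('z \<Rightarrow> 'i \<Rightarrow> real) \<Rightarrow> bool" where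
  "centred_gaussian_vector Q I \<Sigma> Z \<longleftrightarrow>
     Z \<in> Q \<rightarrow>\<^sub>M Pi\<^sub>M I (\<lambda>_. borel) \<and>
     (\<forall>u::'i \<Rightarrow> real. distr Q borel (\<lambda>\<omega>. \<Sum>i\<in>I. u i * Z \<omega> i) =
        centred_normal (\<Sum>i\<in>I. \<Sum>j\<in>I. u i * \<Sigma> i j * u j))"

definition B3 :: "nat \<Rightarrow> ((int \<Rightarrow> real) \<Rightarrow> real) \<Rightarrow> ennreal" where
  "B3 l g =
     ennreal (sqrt (2 * (2 * real l + 1)) / 4) * M_const (orders l) 2 g +
     ennreal (2 / 9 * sqrt ((2 * real l + 1) * (4 * pi))) * M_const (orders l) 3 g"

text \<open>\<open>(\<ell>, t)\<close> ranging over \<open>\<ell> \<rightarrow> \<infinity>\<close> and, jointly, times \<open>t > 0\<close> with \<open>\<nu>\<^sub>t \<rightarrow> \<infinity>\<close>.\<close>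

definition joint_limit :: "(real \<Rightarrow> real) \<Rightarrow> (nat \<times> real) filter" where
  "joint_limit \<nu> = at_top \<times>\<^sub>F inf (filtercomap \<nu> at_top) (principal {0<..})"

lemma eventually_joint_limit:
  "eventually Pr (joint_limit \<nu>) \<longleftrightarrow>
     (\<exists>l0 \<nu>0. \<forall>l\<ge>l0. \<forall>t>0. \<nu> t \<ge> \<nu>0 \<longrightarrow> Pr (l, t))"
proof
  assume "eventually Pr (joint_limit \<nu>)"
  then obtain Pa Pb where a: "eventually Pa at_top"
    and b: "eventually Pb (inf (filtercomap \<nu> at_top) (principal {0<..}))"
    and ab: "\<And>x y. Pa x \<Longrightarrow> Pb y \<Longrightarrow> Pr (x, y)"
    unfolding joint_limit_def eventually_prod_filter by blast
  obtain l0 where l0: "\<And>l. l \<ge> l0 \<Longrightarrow> Pa l"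
    using a unfolding eventually_at_top_linorder by blast
  obtain R where "eventually R at_top" "\<And>t. R (\<nu> t) \<Longrightarrow> t > 0 \<Longrightarrow> Pb t"
    using b unfolding eventually_inf_principal eventually_filtercomap by auto
  then obtain \<nu>0 where "\<And>t. \<nu> t \<ge> \<nu>0 \<Longrightarrow> t > 0 \<Longrightarrow> Pb t"
    unfolding eventually_at_top_linorder by blast
  with l0 ab show "\<exists>l0 \<nu>0. \<forall>l\<ge>l0. \<forall>t>0. \<nu> t \<ge> \<nu>0 \<longrightarrow> Pr (l, t)" by blast
next
  assume "\<exists>l0 \<nu>0. \<forall>l\<ge>l0. \<forall>t>0. \<nu> t \<ge> \<nu>0 \<longrightarrow> Pr (l, t)"
  then obtain l0 \<nu>0 where *: "\<And>l t. l \<ge> l0 \<Longrightarrow> t > 0 \<Longrightarrow> \<nu> t \<ge> \<nu>0 \<Longrightarrow> Pr (l, t)" by blast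
  have "eventually (\<lambda>t. \<nu> t \<ge> \<nu>0 \<and> t > 0) (inf (filtercomap \<nu> at_top) (principal {0<..}))"
    unfolding eventually_inf_principal eventually_filtercomap
    by (rule exI[of _ "\<lambda>x. x \<ge> \<nu>0"]) (auto simp: eventually_ge_at_top)
  then show "eventually Pr (joint_limit \<nu>)"
    unfolding joint_limit_def eventually_prod_filter using * eventually_ge_at_top[of l0] by blast
qed

end

theory Submission
  imports Defs
begin

text \<open>
  The error term may be taken to be zero, because the logarithm leaves room: the claimed bound is of
  order \<open>sqrt (ln l / \<nu>)\<close>, whereas \<open>d3\<close> is at most \<open>(2 \<pi> + sqrt \<pi>) / sqrt \<nu>\<close>, uniformly in \<open>l\<close>.
  The dimension disappears since, by the addition theorem for spherical harmonics, every charged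
  point contributes to the coefficient vector a jump of the same Euclidean length \<open>1 / sqrt \<nu>\<close>.

  Conditionally on the number \<open>K\<close> of charged points, which is Poisson with mean \<open>\<Lambda> = 4 \<pi> \<nu>\<close>, the
  coefficient vector is a sum of \<open>K\<close> independent centred jumps with isotropic covariance.
  Lindeberg's exchange of the jumps for Gaussian vectors costs at most \<open>\<nu> powr (-3 / 2) / 2\<close> for
  each jump, and replacing the random total variance of the Gaussian sum by its mean costs at most
  the mean of \<open>\<bar>K - \<Lambda>\<bar> / (2 \<nu>)\<close>. Laws on \<open>\<real>\<^sup>d\<close> are identified by their characteristic functions.
\<close>

section \<open>Characteristic functions of laws on finite-dimensional spaces\<close>

text \<open>The numbering of the charged points is arbitrary and \<open>\<xi> k\<close> need not be
  measurable; only the counts \<open>emeasure (N \<omega>) A\<close> have a known joint law. Instead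
  the exponential formula for Poisson sums is derived from the counts and matched with that of a
  compound Poisson vector on an auxiliary product space, where the exchange argument runs.

  The room left by the logarithm arises as follows. \<open>half_square\<close> shows that the
  supremum of \<open>B3\<close> is at least of order sqrt l, which cancels the 1 / sqrt l from the
  root. What remains is sqrt (ln l / \<nu>) against C / sqrt \<nu>, so ln l \<ge>
  \<open>C\<^sup>2\<close> suffices. Here C = 2 \<pi> + sqrt \<pi> is
  \<open>(\<Lambda> * r ^ 3 + sqrt \<Lambda> * r\<^sup>2) / 2\<close> times sqrt \<nu>, with r = 1 /
  sqrt \<nu>. The 1 / 2 of the first term is 1 / 6 + 2 / 6, from the third-order Taylor remainders
  of a jump and of the Gaussian in its place; the lower terms cancel since mean and covariance
  agree.\<close>

definition char_vec :: "'i set \<Rightarrow> ('i \<Rightarrow> real) measure \<Rightarrow> ('i \<Rightarrow> real) \<Rightarrow> complex" where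
  "char_vec I M u = (CLINT x|M. iexp (\<Sum>i\<in>I. u i * x i))"

text \<open>Normalising reduces this to Levy uniqueness for probability laws; the mass to divide by
  is \<open>char M 0\<close>, and mass 0 is treated apart. Finite measures are wanted for the
  weighted image measures in \<open>restricted_char_eq\<close>.\<close>

lemma finite_measure_char_eqI:
  fixes M1 M2 :: "real measure"
  assumes fin: "finite_measure M1" "finite_measure M2"
    and sets: "sets M1 = sets borel" "sets M2 = sets borel"
    and char: "\<And>t. char M1 t = char M2 t"
  shows "M1 = M2"
proof -
  interpret M1: finite_measure M1 by fact
  interpret M2: finite_measure M2 by fact
  have [measurable_cong, simp]: "sets M1 = sets borel" "sets M2 = sets borel" by fact+
  have [simp]: "space M1 = UNIV" "space M2 = UNIV"
    using sets_eq_imp_space_eq[OF sets(1)] sets_eq_imp_space_eq[OF sets(2)] by simp_all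
  have "complex_of_real (measure M1 UNIV) = complex_of_real (measure M2 UNIV)"
    using char[of 0] by (simp add: char_def)
  then have mass: "measure M1 UNIV = measure M2 UNIV" by simp
  define c where "c = measure M1 UNIV"
  show ?thesis
  proof (cases "c = 0")
    case True
    have "emeasure M1 A = emeasure M2 A" for A
    proof -
      have "measure M1 A \<le> c" "measure M2 A \<le> c"
        using M1.bounded_measure[of A] M2.bounded_measure[of A] mass by (auto simp: c_def)
      then show ?thesis using True
        by (simp add: M1.emeasure_eq_measure M2.emeasure_eq_measure) (metis antisym measure_nonneg)
    qed
    then show ?thesis by (intro measure_eqI) auto
  next
    case False
    then have c: "c > 0" by (simp add: c_def less_le)
    define N where "N M = density M (\<lambda>_. ennreal (1 / c))" for M :: "real measure"
    have ps: "prob_space (N M)" if "finite_measure M" "sets M = sets borel" "measure M UNIV = c" for M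
    proof
      interpret finite_measure M by fact
      have sp: "space M = UNIV" using sets_eq_imp_space_eq[OF that(2)] by simp
      show "emeasure (N M) (space (N M)) = 1"
        using c that(3) unfolding N_def
        by (simp add: sp emeasure_density emeasure_eq_measure that(2) flip: ennreal_mult' )
    qed
    have ch: "char (N M) t = char M t / c" if "sets M = sets borel" for M t
      unfolding N_def char_def using c that
      by (subst integral_density) (auto simp: measurable_cong_sets[OF that refl] scaleR_conv_of_real)
    have "char (N M1) = char (N M2)" using char by (simp add: ch fun_eq_iff)
    then have "N M1 = N M2"
      using ps[of M1] ps[of M2] mass fin
      by (intro Levy_uniqueness)
         (auto simp: real_distribution_def real_distribution_axioms_def c_def N_def)
    then have eq: "emeasure (N M1) A = emeasure (N M2) A" for A by simp
    have "ennreal (1/c) * emeasure M1 A = ennreal (1/c) * emeasure M2 A" if "A \<in> sets borel" for A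
      using eq[of A] that by (simp add: N_def emeasure_density nn_integral_cmult_indicator)
    then have "emeasure M1 A = emeasure M2 A" if "A \<in> sets borel" for A
      using that c by (simp add: ennreal_mult_cancel_left)
    then show ?thesis by (intro measure_eqI) auto
  qed
qed

text \<open>The weights \<open>W (1 + cos (\<theta> + \<delta>))\<close> are nonnegative and their transforms in the coordinate \<open>X\<close> only
  involve the given integrals, so uniqueness on the line applies to them.\<close>

lemma restricted_char_eq:
  fixes M1 M2 :: "'a measure" and W X \<theta> :: "'a \<Rightarrow> real"
  assumes fin: "finite_measure M1" "finite_measure M2" and sets: "sets M2 = sets M1"
    and [measurable]: "W \<in> borel_measurable M1" "X \<in> borel_measurable M1" "\<theta> \<in> borel_measurable M1"
      "A \<in> sets borel"
    and W: "\<And>x. 0 \<le> W x" "\<And>x. W x \<le> 1"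
    and eq: "\<And>s t. (CLINT x|M1. W x * iexp (t * X x + s * \<theta> x)) = (CLINT x|M2. W x * iexp (t * X x + s * \<theta> x))"
  shows "(CLINT x|M1. W x * indicator A (X x) * iexp (\<theta> x)) = (CLINT x|M2. W x * indicator A (X x) * iexp (\<theta> x))"
proof -
  have [measurable_cong]: "sets M2 = sets M1" by fact
  define g where "g \<delta> x = W x * (1 + cos (\<theta> x + \<delta>))" for \<delta> x
  have [measurable]: "g \<delta> \<in> borel_measurable M1" for \<delta> unfolding g_def by measurable
  have g0: "0 \<le> g \<delta> x" and g2: "g \<delta> x \<le> 2" for \<delta> x
  proof -
    have c: "0 \<le> 1 + cos (\<theta> x + \<delta>)" "1 + cos (\<theta> x + \<delta>) \<le> 2"
      using cos_ge_minus_one[of "\<theta> x + \<delta>"] cos_le_one[of "\<theta> x + \<delta>"] by linarith+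
    show "0 \<le> g \<delta> x" using W c by (simp add: g_def)
    show "g \<delta> x \<le> 2" using mult_mono[OF W(2) c(2)] W c by (simp add: g_def)
  qed
  define D where "D M \<delta> = distr (density M (\<lambda>x. ennreal (g \<delta> x))) borel X" for M :: "'a measure" and \<delta>
  have bint: "integrable M F" if "finite_measure M" "sets M = sets M1" "F \<in> borel_measurable M1" "\<And>x. norm (F x) \<le> 4"
    for M and F :: "'a \<Rightarrow> complex"
    using that by (intro finite_measure.integrable_const_bound[where B=4]) (auto simp: measurable_cong_sets[OF that(2) refl])
  have bintr: "integrable M F" if "finite_measure M" "sets M = sets M1" "F \<in> borel_measurable M1" "\<And>x. norm (F x) \<le> 4"
    for M and F :: "'a \<Rightarrow> real"
    using that by (intro finite_measure.integrable_const_bound[where B=4]) (auto simp: measurable_cong_sets[OF that(2) refl])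
  have iD: "integral\<^sup>L (D M \<delta>) f = (\<integral>x. g \<delta> x *\<^sub>R f (X x) \<partial>M)"
    if s: "sets M = sets M1" and f[measurable]: "f \<in> borel_measurable borel" for M \<delta> and f :: "real \<Rightarrow> 'b::{banach,second_countable_topology}"
  proof -
    note [measurable_cong] = s
    show ?thesis unfolding D_def using g0 by (subst integral_distr) (auto simp: integral_density)
  qed
  have finD: "finite_measure (D M \<delta>)" if s: "sets M = sets M1" and f: "finite_measure M" for M \<delta>
  proof -
    note [measurable_cong] = s
    interpret finite_measure M by fact
    have "(\<integral>\<^sup>+x. ennreal (g \<delta> x) \<partial>M) \<le> (\<integral>\<^sup>+x. ennreal 2 \<partial>M)" using g2 by (intro nn_integral_mono ennreal_leI)
    also have "\<dots> = ennreal (2 * measure M (space M))"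
      by (simp add: emeasure_eq_measure ennreal_mult)
    finally have "(\<integral>\<^sup>+x. ennreal (g \<delta> x) \<partial>M) \<noteq> \<infinity>" by (auto simp: top_unique)
    then have "finite_measure (density M (\<lambda>x. ennreal (g \<delta> x)))"
      by (intro finite_measureI) (simp add: emeasure_density cong: nn_integral_cong)
    then show ?thesis unfolding D_def by (intro finite_measure.finite_measure_distr) auto
  qed
  \<comment> \<open>By Euler's formula the weight contains only the frequencies 0, 1 and -1 in
    \<open>\<theta>\<close>, so this transform is a combination of the integrals in
    \<open>eq\<close> at \<open>s = 0\<close>, \<open>s = 1\<close> and
    \<open>s = -1\<close>.\<close>
  have chD: "char (D M \<delta>) t = (CLINT x|M. W x * iexp (t * X x + 0 * \<theta> x))
      + iexp \<delta> / 2 * (CLINT x|M. W x * iexp (t * X x + 1 * \<theta> x))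
      + iexp (-\<delta>) / 2 * (CLINT x|M. W x * iexp (t * X x + (-1) * \<theta> x))"
    if s: "sets M = sets M1" and f: "finite_measure M" for M \<delta> t
  proof -
    note [measurable_cong] = s
    have "char (D M \<delta>) t = (CLINT x|M. g \<delta> x *\<^sub>R iexp (t * X x))"
      unfolding char_def by (rule iD[OF s]) simp
    also have "\<dots> = (CLINT x|M. W x * iexp (t * X x + 0 * \<theta> x) + (iexp \<delta> / 2 * (W x * iexp (t * X x + 1 * \<theta> x))
       + iexp (-\<delta>) / 2 * (W x * iexp (t * X x + (-1) * \<theta> x))))"
    proof (rule Bochner_Integration.integral_cong[OF refl])
      fix x
      have e: "complex_of_real (cos (\<theta> x + \<delta>)) = (iexp (\<theta> x) * iexp \<delta> + iexp (- \<theta> x) * iexp (-\<delta>)) / 2"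
        unfolding cos_of_real[symmetric] cos_exp_eq by (simp add: algebra_simps flip: exp_add)
      have "iexp (t * X x + 1 * \<theta> x) = iexp (t * X x) * iexp (\<theta> x)"
           "iexp (t * X x + (-1) * \<theta> x) = iexp (t * X x) * iexp (- \<theta> x)"
        by (simp_all add: exp_add[symmetric] algebra_simps)
      then show "g \<delta> x *\<^sub>R iexp (t * X x) = W x * iexp (t * X x + 0 * \<theta> x) + (iexp \<delta> / 2 * (W x * iexp (t * X x + 1 * \<theta> x))
       + iexp (-\<delta>) / 2 * (W x * iexp (t * X x + (-1) * \<theta> x)))"
        unfolding g_def scaleR_conv_of_real of_real_mult of_real_add e by (simp add: field_simps)
    qed
    also have "\<dots> = (CLINT x|M. W x * iexp (t * X x + 0 * \<theta> x))
      + ((CLINT x|M. iexp \<delta> / 2 * (W x * iexp (t * X x + 1 * \<theta> x)))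
      + (CLINT x|M. iexp (-\<delta>) / 2 * (W x * iexp (t * X x + (-1) * \<theta> x))))"
    proof -
      have n: "norm (complex_of_real (W x) * iexp y) \<le> 4" for x y
        using W[of x] by (simp add: norm_mult)
      have "integrable M (\<lambda>x. W x * iexp (t * X x + s * \<theta> x))" for s
        by (rule bint[OF f s]) (measurable, rule n)
      then show ?thesis
        by (simp only: Bochner_Integration.integral_add Bochner_Integration.integrable_add integrable_mult_right)
    qed
    finally show ?thesis by simp
  qed
  have "D M1 \<delta> = D M2 \<delta>" for \<delta>
  proof (rule finite_measure_char_eqI)
    show "char (D M1 \<delta>) t = char (D M2 \<delta>) t" for t
      unfolding chD[OF sets fin(2)] chD[OF refl fin(1)] eq ..
  qed (use finD fin sets in \<open>auto simp: D_def\<close>)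
  then have R: "(\<integral>x. g \<delta> x * indicator A (X x) \<partial>M1) = (\<integral>x. g \<delta> x * indicator A (X x) \<partial>M2)" for \<delta>
    using iD[OF refl, of "indicator A :: real \<Rightarrow> real" \<delta>] iD[OF sets, of "indicator A :: real \<Rightarrow> real" \<delta>] by simp
  define wA where "wA x = W x * indicator A (X x)" for x
  have [measurable]: "wA \<in> borel_measurable M1" unfolding wA_def by measurable
  have wA: "0 \<le> wA x" "wA x \<le> 1" for x using W by (auto simp: wA_def indicator_def)
  have wcs: "\<bar>wA x * c\<bar> \<le> 4" if "\<bar>c\<bar> \<le> 1" for x c
    using mult_mono[of "wA x" 1 "\<bar>c\<bar>" 1] wA[of x] that by (simp add: abs_mult)
  have split: "(\<integral>x. g \<delta> x * indicator A (X x) \<partial>M) = (\<integral>x. wA x \<partial>M) + (\<integral>x. wA x * cos (\<theta> x + \<delta>) \<partial>M)"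
    if s: "sets M = sets M1" and f: "finite_measure M" for M \<delta>
  proof -
    have "integrable M wA" by (rule bintr[OF f s]) (use wcs[of 1] in auto)
    moreover have "integrable M (\<lambda>x. wA x * cos (\<theta> x + \<delta>))" by (rule bintr[OF f s]) (use wcs in auto)
    moreover have "(\<integral>x. g \<delta> x * indicator A (X x) \<partial>M) = (\<integral>x. wA x + wA x * cos (\<theta> x + \<delta>) \<partial>M)"
      by (intro Bochner_Integration.integral_cong) (auto simp: g_def wA_def algebra_simps)
    ultimately show ?thesis by simp
  qed
  have T: "(\<integral>x. wA x \<partial>M1) + (\<integral>x. wA x * cos (\<theta> x + \<delta>) \<partial>M1) = (\<integral>x. wA x \<partial>M2) + (\<integral>x. wA x * cos (\<theta> x + \<delta>) \<partial>M2)" for \<delta>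
    using R[of \<delta>] split[OF refl fin(1)] split[OF sets fin(2)] by simp
  \<comment> \<open>Shifting by \<open>pi\<close> flips the sign of the cosine, so adding the two
    instances isolates the integral of \<open>wA\<close>. The shift by \<open>-(pi/2)\<close> below
    turns the cosine into a sine.\<close>
  have T0: "(\<integral>x. wA x \<partial>M1) = (\<integral>x. wA x \<partial>M2)" using T[of 0] T[of pi] by simp
  have Tc: "(\<integral>x. wA x * cos (\<theta> x) \<partial>M1) = (\<integral>x. wA x * cos (\<theta> x) \<partial>M2)" using T[of 0] T0 by simp
  have Ts: "(\<integral>x. wA x * sin (\<theta> x) \<partial>M1) = (\<integral>x. wA x * sin (\<theta> x) \<partial>M2)" using T[of "-(pi/2)"] T0
    by (simp add: cos_diff)
  have fin': "(CLINT x|M. W x * indicator A (X x) * iexp (\<theta> x))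
     = Complex (\<integral>x. wA x * cos (\<theta> x) \<partial>M) (\<integral>x. wA x * sin (\<theta> x) \<partial>M)"
    if s: "sets M = sets M1" and f: "finite_measure M" for M
  proof -
    have *: "integrable M (\<lambda>x. complex_of_real (wA x) * iexp (\<theta> x))"
    proof (rule bint[OF f s])
      show "norm (complex_of_real (wA x) * iexp (\<theta> x)) \<le> 4" for x
        using wA[of x] by (simp add: norm_mult)
    qed measurable
    have r: "Re (complex_of_real (wA x) * iexp (\<theta> x)) = wA x * cos (\<theta> x)"
      "Im (complex_of_real (wA x) * iexp (\<theta> x)) = wA x * sin (\<theta> x)" for x
      by (simp_all add: Re_exp Im_exp)
    show ?thesis
      using integral_Re[OF *] integral_Im[OF *] unfolding wA_def[symmetric]
      by (intro complex_eqI) (simp_all only: r complex.sel)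
  qed
  show ?thesis by (simp only: fin'[OF refl fin(1)] fin'[OF sets fin(2)] Tc Ts)
qed

text \<open>The exponential is traded for indicators one coordinate at a time:
  \<open>restricted_char_eq\<close> localises coordinate \<open>j\<close> to \<open>A j\<close> and
  keeps the exponential in the remaining ones. When no coordinate remains, boxes have equal measure,
  and boxes generate the product sigma-algebra.\<close>

theorem char_vec_unique:
  assumes I: "finite I" and prob: "prob_space M1" "prob_space M2"
    and sets: "sets M1 = sets (Pi\<^sub>M I (\<lambda>_. borel))" "sets M2 = sets (Pi\<^sub>M I (\<lambda>_. borel))"
    and eq: "\<And>u. char_vec I M1 u = char_vec I M2 u"
  shows "M1 = M2"
proof -
  interpret M1: prob_space M1 by fact
  interpret M2: prob_space M2 by fact
  have [measurable_cong]: "sets M1 = sets (Pi\<^sub>M I (\<lambda>_. borel))" "sets M2 = sets (Pi\<^sub>M I (\<lambda>_. borel))" by fact+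
  have sp: "space M1 = vecs I" "space M2 = vecs I"
    using sets_eq_imp_space_eq[OF sets(1)] sets_eq_imp_space_eq[OF sets(2)] by (simp_all add: space_PiM)
  define W where "W J A x = (\<Prod>j\<in>J. indicator (A j) (x j :: real) :: real)" for J and A :: "'a \<Rightarrow> real set" and x
  have W01: "0 \<le> W J A x" "W J A x \<le> 1" for J A x
    unfolding W_def by (auto intro!: prod_nonneg prod_le_1)
  have key: "(CLINT x|M1. W J A x * iexp (\<Sum>i\<in>I - J. u i * x i)) = (CLINT x|M2. W J A x * iexp (\<Sum>i\<in>I - J. u i * x i))"
    if "finite J" "J \<subseteq> I" "\<And>j. j \<in> J \<Longrightarrow> A j \<in> sets borel" for J A u
    using that
  proof (induction J arbitrary: u rule: finite_induct)
    case empty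
    then show ?case using eq[of u] by (simp add: W_def char_vec_def)
  next
    case (insert j J)
    have jI: "j \<in> I" "J \<subseteq> I" using insert.prems by auto
    have comp: "(\<lambda>x. x i) \<in> borel_measurable M1" if "i \<in> I" for i
      unfolding measurable_cong_sets[OF sets(1) refl] by (rule measurable_component_singleton[OF that])
    have Wm: "W J A \<in> borel_measurable M1" unfolding W_def
    proof (rule borel_measurable_prod)
      fix i assume "i \<in> J"
      with insert.prems have "i \<in> I" and [measurable]: "A i \<in> sets borel" by auto
      from comp[OF this(1)] show "(\<lambda>x. indicator (A i) (x i) :: real) \<in> borel_measurable M1" by measurable
    qed
    have Xm: "(\<lambda>x. x j) \<in> borel_measurable M1" using jI by (intro comp)
    have Tm: "(\<lambda>x. \<Sum>i\<in>I - insert j J. u i * x i) \<in> borel_measurable M1"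
      by (intro borel_measurable_sum borel_measurable_times comp) auto
    \<comment> \<open>Frequency \<open>t\<close> in coordinate \<open>j\<close> and
      \<open>s * u i\<close> in the others: the induction hypothesis for all frequencies contains
      the two-parameter family that \<open>restricted_char_eq\<close> asks for.\<close>
    have e: "(\<Sum>i\<in>I - J. (if i = j then t else s * u i) * x i) = t * x j + s * (\<Sum>i\<in>I - insert j J. u i * x i)"
      for s t and x :: "'a \<Rightarrow> real"
    proof -
      have "I - J = insert j (I - insert j J)" using jI insert.hyps by auto
      then have "(\<Sum>i\<in>I - J. (if i = j then t else s * u i) * x i)
          = (\<Sum>i\<in>insert j (I - insert j J). (if i = j then t else s * u i) * x i)" by (rule arg_cong)
      also have "\<dots> = t * x j + (\<Sum>i\<in>I - insert j J. (if i = j then t else s * u i) * x i)"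
        using I by (subst sum.insert) auto
      also have "(\<Sum>i\<in>I - insert j J. (if i = j then t else s * u i) * x i) = s * (\<Sum>i\<in>I - insert j J. u i * x i)"
        by (subst sum_distrib_left, rule sum.cong) (auto simp: algebra_simps)
      finally show ?thesis .
    qed
    have "(CLINT x|M1. W J A x * iexp (t * x j + s * (\<Sum>i\<in>I - insert j J. u i * x i)))
        = (CLINT x|M2. W J A x * iexp (t * x j + s * (\<Sum>i\<in>I - insert j J. u i * x i)))" for s t
    proof -
      have "J \<subseteq> I" "\<And>j. j \<in> J \<Longrightarrow> A j \<in> sets borel" using insert.prems by auto
      from insert.IH[OF this, of "\<lambda>i. if i = j then t else s * u i"] show ?thesis by (simp only: e)
    qed
    from restricted_char_eq[OF M1.finite_measure_axioms M2.finite_measure_axioms _ Wm Xm Tm _ W01 this, of "A j"]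
    have "(CLINT x|M1. W J A x * indicator (A j) (x j) * iexp (\<Sum>i\<in>I - insert j J. u i * x i))
        = (CLINT x|M2. W J A x * indicator (A j) (x j) * iexp (\<Sum>i\<in>I - insert j J. u i * x i))"
      using insert.prems sets by simp
    have "W J A x * indicator (A j) (x j) = W (insert j J) A x" for x
      using insert.hyps unfolding W_def by simp
    then have "(\<lambda>x. W J A x * indicator (A j) (x j)) = W (insert j J) A" by auto
    from fun_cong[OF this] have r: "W J A x * indicator (A j) (x j) = W (insert j J) A x" for x .
    show ?case using \<open>(CLINT x|M1. W J A x * indicator (A j) (x j) * iexp (\<Sum>i\<in>I - insert j J. u i * x i))
        = (CLINT x|M2. W J A x * indicator (A j) (x j) * iexp (\<Sum>i\<in>I - insert j J. u i * x i))\<close> unfolding r .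
  qed
  have val: "(CLINT x|M. W I A x * iexp (\<Sum>i\<in>I - I. 0 * x i)) = measure M (Pi\<^sub>E I A)"
    if s: "sets M = sets (Pi\<^sub>M I (\<lambda>_. borel))" "prob_space M" and A: "\<And>i. i \<in> I \<Longrightarrow> A i \<in> sets borel" for M A
  proof -
    interpret prob_space M by fact
    have "(CLINT x|M. W I A x * iexp (\<Sum>i\<in>I - I. 0 * x i)) = (CLINT x|M. complex_of_real (indicator (Pi\<^sub>E I A) x))"
    proof (rule Bochner_Integration.integral_cong[OF refl])
      fix x assume "x \<in> space M"
      then have x: "x \<in> vecs I" using sets_eq_imp_space_eq[OF s(1)] by (simp add: space_PiM)
      have "W I A x = indicator (Pi\<^sub>E I A) x"
      proof (cases "x \<in> Pi\<^sub>E I A")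
        case True
        then have "\<And>i. i \<in> I \<Longrightarrow> x i \<in> A i" by (simp add: PiE_iff)
        then have "W I A x = 1" unfolding W_def by (intro prod.neutral) simp
        then show ?thesis using True by simp
      next
        case False
        then obtain i where "i \<in> I" "x i \<notin> A i" using x by (auto simp: PiE_iff)
        then have "W I A x = 0" unfolding W_def using I by (intro prod_zero bexI[of _ i]) auto
        then show ?thesis using False by simp
      qed
      then show "W I A x * iexp (\<Sum>i\<in>I - I. 0 * x i) = complex_of_real (indicator (Pi\<^sub>E I A) x)" by simp
    qed
    also have "\<dots> = measure M (Pi\<^sub>E I A)"
    proof -
      have "Pi\<^sub>E I A \<in> sets M" unfolding s(1) using A I by (intro sets_PiM_I_finite) auto
      then show ?thesis by (simp del: of_real_indicator)
    qed
    finally show ?thesis .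
  qed
  have 1: "emeasure M1 (Pi\<^sub>E I A) = emeasure M2 (Pi\<^sub>E I A)" if A: "\<And>i. i \<in> I \<Longrightarrow> A i \<in> sets borel" for A
  proof -
    have "measure M1 (Pi\<^sub>E I A) = measure M2 (Pi\<^sub>E I A)"
      using val[OF sets(1) prob(1) A] val[OF sets(2) prob(2) A] key[of I A "\<lambda>_. 0"] A I by simp
    then show ?thesis by (simp add: M1.emeasure_eq_measure M2.emeasure_eq_measure)
  qed
  have 2: "range (\<lambda>_::nat. vecs I) \<subseteq> prod_algebra I (\<lambda>_. borel)"
    using prod_algebraI_finite[OF I, of "\<lambda>_. UNIV" "\<lambda>_. borel"] by simp
  have 3: "(\<Union>i::nat. vecs I) = space (Pi\<^sub>M I (\<lambda>_. borel))" by (simp add: space_PiM)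
  show ?thesis
    by (rule measure_eqI_PiM_finite[OF I sets 1 2 3]) (simp_all add: M1.emeasure_eq_measure)
qed

section \<open>Sums over the points of a Poisson random measure\<close>

definition poisson_weight :: "real \<Rightarrow> nat \<Rightarrow> real" where
  "poisson_weight \<Lambda> n = \<Lambda> ^ n / fact n * exp (- \<Lambda>)"

definition poisson_dist :: "real \<Rightarrow> nat measure" where
  "poisson_dist \<Lambda> = density (count_space UNIV) (\<lambda>n. ennreal (poisson_weight \<Lambda> n))"

lemma poisson_weight_nonneg: "0 \<le> \<Lambda> \<Longrightarrow> 0 \<le> poisson_weight \<Lambda> n" by (simp add: poisson_weight_def)

lemma
  fixes f :: "nat \<Rightarrow> 'a::{banach, second_countable_topology}"
  assumes \<Lambda>: "0 \<le> \<Lambda>" and f: "summable (\<lambda>n. poisson_weight \<Lambda> n * norm (f n))"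
  shows integrable_poisson: "integrable (poisson_dist \<Lambda>) f"
    and integral_poisson: "integral\<^sup>L (poisson_dist \<Lambda>) f = (\<Sum>n. poisson_weight \<Lambda> n *\<^sub>R f n)"
proof -
  have i: "integrable (count_space UNIV) (\<lambda>n. poisson_weight \<Lambda> n *\<^sub>R f n)"
    using f poisson_weight_nonneg[OF \<Lambda>] by (simp add: integrable_count_space_nat_iff)
  then show "integrable (poisson_dist \<Lambda>) f" unfolding poisson_dist_def
    using poisson_weight_nonneg[OF \<Lambda>] by (subst integrable_density) auto
  show "integral\<^sup>L (poisson_dist \<Lambda>) f = (\<Sum>n. poisson_weight \<Lambda> n *\<^sub>R f n)" unfolding poisson_dist_def
    using poisson_weight_nonneg[OF \<Lambda>] by (subst integral_density) (auto simp: integral_count_space_nat[OF i])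
qed

text \<open>The probability generating function, in a general field so that one series serves for
  the total mass (z = 1), for summability (z a norm) and for the characteristic function (z
  complex).\<close>

lemma poisson_weight_sums_power:
  fixes z :: "'a::{real_normed_field, banach}"
  shows "(\<lambda>n. of_real (poisson_weight \<Lambda> n) * z ^ n) sums exp (of_real \<Lambda> * (z - 1))"
proof -
  have "(\<lambda>n. of_real (exp (- \<Lambda>)) * ((of_real \<Lambda> * z) ^ n /\<^sub>R fact n)) sums (of_real (exp (- \<Lambda>)) * exp (of_real \<Lambda> * z))"
    by (intro sums_mult exp_converges)
  moreover have "of_real (exp (- \<Lambda>)) * exp (of_real \<Lambda> * z) = exp (of_real \<Lambda> * (z - 1))"
    by (simp only: exp_of_real[symmetric] mult_exp_exp) (simp add: algebra_simps)
  moreover have "of_real (exp (- \<Lambda>)) * ((of_real \<Lambda> * z) ^ n /\<^sub>R fact n) = of_real (poisson_weight \<Lambda> n) * z ^ n" for n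
    by (simp add: poisson_weight_def scaleR_conv_of_real power_mult_distrib field_simps)
  ultimately show ?thesis by simp
qed

lemma integral_poisson_power:
  fixes z :: complex
  assumes "0 \<le> \<Lambda>"
  shows "integrable (poisson_dist \<Lambda>) (\<lambda>n. z ^ n)" "(\<integral>n. z ^ n \<partial>poisson_dist \<Lambda>) = exp (of_real \<Lambda> * (z - 1))"
proof -
  have "summable (\<lambda>n. of_real (poisson_weight \<Lambda> n) * norm z ^ n)"
    using poisson_weight_sums_power[of \<Lambda> "norm z"] by (simp add: sums_iff)
  then have s: "summable (\<lambda>n. poisson_weight \<Lambda> n * norm (z ^ n))" by (simp add: norm_power)
  show "integrable (poisson_dist \<Lambda>) (\<lambda>n. z ^ n)" by (rule integrable_poisson[OF assms s])
  show "(\<integral>n. z ^ n \<partial>poisson_dist \<Lambda>) = exp (of_real \<Lambda> * (z - 1))"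
    using poisson_weight_sums_power[of \<Lambda> z] by (simp add: integral_poisson[OF assms s] sums_iff scaleR_conv_of_real)
qed

lemma prob_space_poisson: "0 \<le> \<Lambda> \<Longrightarrow> prob_space (poisson_dist \<Lambda>)"
proof
  assume \<Lambda>: "0 \<le> \<Lambda>"
  have "poisson_weight \<Lambda> sums 1" using poisson_weight_sums_power[of \<Lambda> "1::real"] by simp
  then have "(\<Sum>n. ennreal (poisson_weight \<Lambda> n)) = 1"
    using poisson_weight_nonneg[OF \<Lambda>] by (simp add: suminf_ennreal2 sums_iff)
  then show "emeasure (poisson_dist \<Lambda>) (space (poisson_dist \<Lambda>)) = 1"
    by (simp add: poisson_dist_def emeasure_density nn_integral_count_space_nat)
qed

lemma poisson_moments:
  assumes \<Lambda>: "0 \<le> \<Lambda>"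
  shows "integrable (poisson_dist \<Lambda>) real" "(\<integral>n. real n \<partial>poisson_dist \<Lambda>) = \<Lambda>"
    "integrable (poisson_dist \<Lambda>) (\<lambda>n. (real n)\<^sup>2)" "(\<integral>n. (real n - \<Lambda>)\<^sup>2 \<partial>poisson_dist \<Lambda>) = \<Lambda>"
proof -
  interpret prob_space "poisson_dist \<Lambda>" by (rule prob_space_poisson[OF \<Lambda>])
  have 0: "poisson_weight \<Lambda> sums 1" using poisson_weight_sums_power[of \<Lambda> "1::real"] by simp
  \<comment> \<open>Size biasing: weighting by the value shifts the index by one, so each moment
    reduces to lower ones. The term for 0 vanishes, so the shifted series has the same sum.\<close>
  have S: "poisson_weight \<Lambda> (Suc n) * real (Suc n) = \<Lambda> * poisson_weight \<Lambda> n" for n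
    by (simp add: poisson_weight_def divide_simps)
  have 1: "(\<lambda>n. poisson_weight \<Lambda> n * real n) sums \<Lambda>"
  proof -
    have "(\<lambda>n. poisson_weight \<Lambda> (Suc n) * real (Suc n)) sums \<Lambda>"
      using sums_mult[OF 0, of \<Lambda>] by (simp only: S mult_1_right)
    then show ?thesis using sums_Suc_iff[of "\<lambda>n. poisson_weight \<Lambda> n * real n" \<Lambda>] by simp
  qed
  have 2: "(\<lambda>n. poisson_weight \<Lambda> n * (real n)\<^sup>2) sums (\<Lambda>\<^sup>2 + \<Lambda>)"
  proof -
    have "(\<lambda>n. \<Lambda> * (poisson_weight \<Lambda> n * real n) + \<Lambda> * poisson_weight \<Lambda> n) sums (\<Lambda> * \<Lambda> + \<Lambda> * 1)"
      by (intro sums_add sums_mult 0 1)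
    moreover have "\<Lambda> * (poisson_weight \<Lambda> n * real n) + \<Lambda> * poisson_weight \<Lambda> n = poisson_weight \<Lambda> (Suc n) * (real (Suc n))\<^sup>2" for n
      using arg_cong[OF S[of n], of "\<lambda>x. x * real (Suc n)"] by (simp add: power2_eq_square algebra_simps)
    ultimately have "(\<lambda>n. poisson_weight \<Lambda> (Suc n) * (real (Suc n))\<^sup>2) sums (\<Lambda>\<^sup>2 + \<Lambda>)"
      by (simp add: power2_eq_square)
    then show ?thesis using sums_Suc_iff[of "\<lambda>n. poisson_weight \<Lambda> n * (real n)\<^sup>2" "\<Lambda>\<^sup>2 + \<Lambda>"] by simp
  qed
  show i1: "integrable (poisson_dist \<Lambda>) real"
    using 1 by (intro integrable_poisson[OF \<Lambda>]) (simp add: sums_iff)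
  show e1: "(\<integral>n. real n \<partial>poisson_dist \<Lambda>) = \<Lambda>"
    using 1 by (subst integral_poisson[OF \<Lambda>]) (simp_all add: sums_iff)
  show i2: "integrable (poisson_dist \<Lambda>) (\<lambda>n. (real n)\<^sup>2)"
    using 2 by (intro integrable_poisson[OF \<Lambda>]) (simp add: sums_iff)
  have e2: "(\<integral>n. (real n)\<^sup>2 \<partial>poisson_dist \<Lambda>) = \<Lambda>\<^sup>2 + \<Lambda>"
    using 2 by (subst integral_poisson[OF \<Lambda>]) (simp_all add: sums_iff)
  have "(\<integral>n. (real n - \<Lambda>)\<^sup>2 \<partial>poisson_dist \<Lambda>) = (\<integral>n. (real n)\<^sup>2 - (2 * \<Lambda>) * real n + \<Lambda>\<^sup>2 \<partial>poisson_dist \<Lambda>)"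
    by (intro Bochner_Integration.integral_cong) (auto simp: power2_eq_square algebra_simps)
  also have "\<dots> = \<Lambda>"
    using i1 i2 by (simp add: e1 e2 prob_space) (simp add: power2_eq_square)
  finally show "(\<integral>n. (real n - \<Lambda>)\<^sup>2 \<partial>poisson_dist \<Lambda>) = \<Lambda>" .
qed

text \<open>The variance of the absolute deviation is nonnegative, so the square of its mean is at
  most the Poisson variance \<Lambda>.\<close>

lemma poisson_abs_deviation:
  assumes "0 < \<Lambda>"
  shows "integrable (poisson_dist \<Lambda>) (\<lambda>n. \<bar>real n - \<Lambda>\<bar>)" "(\<integral>n. \<bar>real n - \<Lambda>\<bar> \<partial>poisson_dist \<Lambda>) \<le> sqrt \<Lambda>"
proof -
  interpret prob_space "poisson_dist \<Lambda>" using assms by (intro prob_space_poisson) auto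
  note m = poisson_moments[of \<Lambda>]
  show i: "integrable (poisson_dist \<Lambda>) (\<lambda>n. \<bar>real n - \<Lambda>\<bar>)" using m assms by auto
  have "integrable (poisson_dist \<Lambda>) (\<lambda>n. (real n)\<^sup>2 - (2 * \<Lambda>) * real n + \<Lambda>\<^sup>2)" using m assms by auto
  then have i2: "integrable (poisson_dist \<Lambda>) (\<lambda>n. (real n - \<Lambda>)\<^sup>2)" by (simp add: power2_diff algebra_simps)
  have "(expectation (\<lambda>n. \<bar>real n - \<Lambda>\<bar>))\<^sup>2 \<le> expectation (\<lambda>n. \<bar>real n - \<Lambda>\<bar>\<^sup>2)"
    using variance_positive[of "\<lambda>n. \<bar>real n - \<Lambda>\<bar>"] i i2 by (subst (asm) variance_eq) auto
  then have "(expectation (\<lambda>n. \<bar>real n - \<Lambda>\<bar>))\<^sup>2 \<le> \<Lambda>" using m assms by simp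
  then show "(\<integral>n. \<bar>real n - \<Lambda>\<bar> \<partial>poisson_dist \<Lambda>) \<le> sqrt \<Lambda>" by (rule real_le_rsqrt)
qed

section \<open>The exponential formula for sums over the charged points\<close>

locale charged_poisson =
  fixes P :: "'w measure" and \<mu> :: "'a measure" and N :: "'w \<Rightarrow> 'a measure"
    and K :: "'w \<Rightarrow> nat" and \<xi> :: "nat \<Rightarrow> 'w \<Rightarrow> 'a"
  assumes prob: "prob_space P" and fin: "finite_measure \<mu>"
    and prm: "poisson_random_measure P \<mu> N"
    and points: "charged_points P (space \<mu>) N K \<xi>"
begin

sublocale P: prob_space P by (rule prob)
sublocale \<mu>: finite_measure \<mu> by (rule fin)

definition cnt :: "'a set \<Rightarrow> 'w \<Rightarrow> nat" where
  "cnt A \<omega> = card {k \<in> {1..K \<omega>}. \<xi> k \<omega> \<in> A}"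

lemma emeasure_N: "A \<in> sets \<mu> \<Longrightarrow> \<omega> \<in> space P \<Longrightarrow> emeasure (N \<omega>) A = of_nat (cnt A \<omega>)"
  using prm points unfolding poisson_random_measure_def charged_points_def cnt_def by auto

lemma points_in_space: "\<omega> \<in> space P \<Longrightarrow> k \<in> {1..K \<omega>} \<Longrightarrow> \<xi> k \<omega> \<in> space \<mu>"
  using points unfolding charged_points_def by auto

lemma cnt_measurable:
  assumes A: "A \<in> sets \<mu>"
  shows "cnt A \<in> P \<rightarrow>\<^sub>M count_space UNIV"
proof (subst measurable_count_space_eq2_countable, intro conjI)
  show "\<forall>n\<in>UNIV. cnt A -` {n} \<inter> space P \<in> sets P"
  proof
    fix n
    have "cnt A -` {n} \<inter> space P = (\<lambda>\<omega>. emeasure (N \<omega>) A) -` {of_nat n} \<inter> space P"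
      using emeasure_N[OF A] by auto
    moreover have "(\<lambda>\<omega>. emeasure (N \<omega>) A) \<in> borel_measurable P"
      using prm A unfolding poisson_random_measure_def by auto
    ultimately show "cnt A -` {n} \<inter> space P \<in> sets P" by (simp add: measurable_sets_borel measurable_sets)
  qed
qed auto

lemma distr_cnt:
  assumes A: "A \<in> sets \<mu>"
  shows "distr P (count_space UNIV) (cnt A) = poisson_dist (measure \<mu> A)"
proof (rule measure_eqI_countable[of _ UNIV])
  fix n :: nat
  have "emeasure \<mu> A < \<infinity>" by (simp add: less_top[symmetric])
  then have "measure P {\<omega>\<in>space P. emeasure (N \<omega>) A = of_nat n} = measure \<mu> A ^ n / fact n * exp (- measure \<mu> A)"
    using prm A unfolding poisson_random_measure_def by auto
  moreover have "{\<omega>\<in>space P. emeasure (N \<omega>) A = of_nat n} = cnt A -` {n} \<inter> space P"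
    using emeasure_N[OF A] by auto
  ultimately have "measure P (cnt A -` {n} \<inter> space P) = poisson_weight (measure \<mu> A) n"
    by (simp add: poisson_weight_def)
  then show "emeasure (distr P (count_space UNIV) (cnt A)) {n} = emeasure (poisson_dist (measure \<mu> A)) {n}"
    using cnt_measurable[OF A]
    by (simp add: emeasure_distr poisson_dist_def emeasure_density P.emeasure_eq_measure nn_integral_count_space_indicator[symmetric] max_def)
qed (auto simp: poisson_dist_def)

lemma char_cnt:
  assumes A: "A \<in> sets \<mu>"
  shows "(CLINT \<omega>|P. iexp (c * real (cnt A \<omega>))) = exp (of_real (measure \<mu> A) * (iexp c - 1))"
proof -
  have "(CLINT \<omega>|P. iexp (c * real (cnt A \<omega>))) = (CLINT \<omega>|P. (iexp c) ^ cnt A \<omega>)"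
    by (simp add: exp_of_nat_mult[symmetric] mult_ac)
  also have "\<dots> = (CLINT n|distr P (count_space UNIV) (cnt A). (iexp c) ^ n)"
    by (subst integral_distr[OF cnt_measurable[OF A]]) auto
  finally show ?thesis unfolding distr_cnt[OF A] by (simp add: integral_poisson_power)
qed

text \<open>The integral of \<open>F\<close> against \<open>N \<omega>\<close>, kept as a sum over
  numbered points because \<open>harmonic_coeff\<close> is written that way.\<close>

definition total :: "('a \<Rightarrow> real) \<Rightarrow> 'w \<Rightarrow> real" where
  "total F \<omega> = (\<Sum>k=1..K \<omega>. F (\<xi> k \<omega>))"

text \<open>On the finitely many level sets of \<open>F\<close> the counts are independent Poisson
  variables and the sum is a linear combination of them, so characteristic functions multiply.
  Measurability comes from the counts as well, since nothing is known about that of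
  \<open>\<xi> k\<close>.\<close>

lemma total_simple:
  assumes F: "simple_function \<mu> F"
  shows "total F \<in> borel_measurable P"
    and "(CLINT \<omega>|P. iexp (total F \<omega>)) = exp (CLINT x|\<mu>. iexp (F x) - 1)"
proof -
  define R where "R = F ` space \<mu>"
  have fR: "finite R" using F by (simp add: R_def simple_function_def)
  obtain c where c: "bij_betw c {0..<card R} R" using ex_bij_betw_nat_finite[OF fR] by blast
  define n where "n = card R"
  define A where "A i = F -` {c i} \<inter> space \<mu>" for i
  have c': "bij_betw c {..<n} R" using c by (simp add: n_def atLeast0LessThan)
  have A: "A i \<in> sets \<mu>" for i unfolding A_def by (rule simple_functionD(2)[OF F])
  \<comment> \<open>A point lies in exactly one level set. The range type of \<open>g\<close> is
    general because the identity serves for the real values and for the complex terms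
    \<open>iexp (F x) - 1\<close>.\<close>
  have one: "(\<Sum>i<n. indicator (A i) x * g (c i)) = g (F x)" if "x \<in> space \<mu>"
    for x and g :: "real \<Rightarrow> 'x::{semiring_1}"
  proof -
    have "F x \<in> c ` {..<n}" using that bij_betw_imp_surj_on[OF c'] by (simp add: R_def)
    then obtain j where j: "j < n" "c j = F x" by auto
    have "(\<Sum>i<n. indicator (A i) x * g (c i)) = (\<Sum>i<n. if i = j then g (c i) else 0)"
    proof (rule sum.cong[OF refl])
      fix i assume "i \<in> {..<n}"
      then have "c i = c j \<longleftrightarrow> i = j" using c' j unfolding bij_betw_def inj_on_def by auto
      then show "indicator (A i) x * g (c i) = (if i = j then g (c i) else 0)"
        using that j by (auto simp: A_def indicator_def)
    qed
    then show ?thesis using j by simp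
  qed
  have tot: "total F \<omega> = (\<Sum>i<n. c i * real (cnt (A i) \<omega>))" if \<omega>: "\<omega> \<in> space P" for \<omega>
  proof -
    have "total F \<omega> = (\<Sum>k=1..K \<omega>. \<Sum>i<n. indicator (A i) (\<xi> k \<omega>) * c i)"
      unfolding total_def
      by (intro sum.cong refl) (use one[of _ "\<lambda>x. x"] points_in_space[OF \<omega>] in auto)
    also have "\<dots> = (\<Sum>i<n. \<Sum>k=1..K \<omega>. indicator (A i) (\<xi> k \<omega>) * c i)" by (rule sum.swap)
    also have "\<dots> = (\<Sum>i<n. c i * real (cnt (A i) \<omega>))"
    proof (intro sum.cong refl)
      fix i
      have "real (cnt (A i) \<omega>) = (\<Sum>k\<in>{k \<in> {1..K \<omega>}. \<xi> k \<omega> \<in> A i}. 1)" by (simp add: cnt_def)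
      also have "\<dots> = (\<Sum>k=1..K \<omega>. if \<xi> k \<omega> \<in> A i then 1 else 0)" by (rule sum.inter_filter) simp
      also have "\<dots> = (\<Sum>k=1..K \<omega>. indicator (A i) (\<xi> k \<omega>))" by (simp add: indicator_def of_bool_def)
      finally show "(\<Sum>k=1..K \<omega>. indicator (A i) (\<xi> k \<omega>) * c i) = c i * real (cnt (A i) \<omega>)"
        by (simp add: sum_distrib_left mult.commute)
    qed
    finally show ?thesis .
  qed
  \<comment> \<open>The independence in \<open>prm\<close> concerns extended nonnegative masses;
    \<open>enn2real\<close> makes real variables of them by a measurable map, which keeps
    independence.\<close>
  define X where "X i \<omega> = c i * enn2real (emeasure (N \<omega>) (A i))" for i \<omega>
  have X: "X i \<omega> = c i * real (cnt (A i) \<omega>)" if "\<omega> \<in> space P" for i \<omega>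
    using emeasure_N[OF A that] by (simp add: X_def enn2real_of_nat)
  have "P.indep_vars (\<lambda>_. borel) (\<lambda>i \<omega>. emeasure (N \<omega>) (A i)) {..<n}"
  proof -
    have "disjoint_family_on A {..<n}"
      using c' unfolding disjoint_family_on_def A_def bij_betw_def inj_on_def by auto
    then show ?thesis using prm A unfolding poisson_random_measure_def by auto
  qed
  then have ind: "P.indep_vars (\<lambda>_. borel) X {..<n}"
    unfolding X_def by (rule P.indep_vars_compose2) measurable
  have Xm: "X i \<in> borel_measurable P" if "i < n" for i
    using ind that unfolding P.indep_vars_def by auto
  then have m: "(\<lambda>\<omega>. \<Sum>i<n. X i \<omega>) \<in> borel_measurable P" by auto
  have tX: "total F \<omega> = (\<Sum>i<n. X i \<omega>)" if "\<omega> \<in> space P" for \<omega>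
    using tot[OF that] X[OF that] by simp
  show "total F \<in> borel_measurable P"
    using m by (rule iffD2[OF measurable_cong, rotated]) (rule tX)
  have "(CLINT \<omega>|P. iexp (total F \<omega>)) = (CLINT \<omega>|P. iexp (1 * (\<Sum>i<n. X i \<omega>)))"
    by (intro Bochner_Integration.integral_cong refl) (simp add: tX)
  also have "\<dots> = char (distr P borel (\<lambda>\<omega>. \<Sum>i<n. X i \<omega>)) 1"
    unfolding char_def using m by (subst integral_distr) auto
  also have "\<dots> = (\<Prod>i<n. char (distr P borel (X i)) 1)" by (rule P.char_distr_sum[OF ind])
  also have "\<dots> = (\<Prod>i<n. exp (of_real (measure \<mu> (A i)) * (iexp (c i) - 1)))"
  proof (intro prod.cong refl)
    fix i assume "i \<in> {..<n}"
    then have "char (distr P borel (X i)) 1 = (CLINT \<omega>|P. iexp (1 * X i \<omega>))"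
      unfolding char_def using Xm by (subst integral_distr) auto
    also have "\<dots> = (CLINT \<omega>|P. iexp (c i * real (cnt (A i) \<omega>)))"
      by (intro Bochner_Integration.integral_cong refl) (simp add: X)
    finally show "char (distr P borel (X i)) 1 = exp (of_real (measure \<mu> (A i)) * (iexp (c i) - 1))"
      by (simp only: char_cnt[OF A])
  qed
  also have "\<dots> = exp (\<Sum>i<n. of_real (measure \<mu> (A i)) * (iexp (c i) - 1))" by (simp add: exp_sum)
  also have "(\<Sum>i<n. of_real (measure \<mu> (A i)) * (iexp (c i) - 1)) = (CLINT x|\<mu>. \<Sum>i<n. indicator (A i) x *\<^sub>R (iexp (c i) - 1))"
    using A by (subst Bochner_Integration.integral_sum) (auto simp: \<mu>.emeasure_finite less_top[symmetric] scaleR_conv_of_real)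
  also have "\<dots> = (CLINT x|\<mu>. iexp (F x) - 1)"
  proof (intro Bochner_Integration.integral_cong refl)
    fix x assume "x \<in> space \<mu>"
    have "(\<Sum>i<n. indicator (A i) x *\<^sub>R (iexp (c i) - 1)) = (\<Sum>i<n. indicator (A i) x * (iexp (c i) - 1))"
      by (intro sum.cong refl) (simp add: indicator_def)
    also have "\<dots> = iexp (F x) - 1" by (rule one[OF \<open>x \<in> space \<mu>\<close>])
    finally show "(\<Sum>i<n. indicator (A i) x *\<^sub>R (iexp (c i) - 1)) = iexp (F x) - 1" .
  qed
  finally show "(CLINT \<omega>|P. iexp (total F \<omega>)) = exp (CLINT x|\<mu>. iexp (F x) - 1)" .
qed

text \<open>Simple functions approximate \<open>F\<close> pointwise. Each \<open>\<omega>\<close>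
  has finitely many points, so the sums converge, and both sides pass to the limit by dominated
  convergence, with bound 1 on \<open>P\<close> and bound 2 on the finite measure
  \<open>\<mu>\<close>.\<close>

theorem
  assumes F: "F \<in> borel_measurable \<mu>"
  shows total_measurable: "total F \<in> borel_measurable P"
    and char_total: "(CLINT \<omega>|P. iexp (total F \<omega>)) = exp (CLINT x|\<mu>. iexp (F x) - 1)"
proof -
  obtain G where G: "\<And>i. simple_function \<mu> (G i)" "\<And>x. x \<in> space \<mu> \<Longrightarrow> (\<lambda>i. G i x) \<longlonglongrightarrow> F x"
    using borel_measurable_implies_sequence_metric[OF F, of 0] by blast
  have [measurable]: "G i \<in> borel_measurable \<mu>" for i using G(1) by (rule borel_measurable_simple_function)
  note [measurable] = F
  have lim: "(\<lambda>i. total (G i) \<omega>) \<longlonglongrightarrow> total F \<omega>" if "\<omega> \<in> space P" for \<omega>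
    unfolding total_def by (intro tendsto_sum G(2) points_in_space[OF that])
  have m [measurable]: "total (G i) \<in> borel_measurable P" for i by (rule total_simple(1)[OF G(1)])
  show tm [measurable]: "total F \<in> borel_measurable P"
    by (rule borel_measurable_LIMSEQ_metric[OF m lim])
  have "(\<lambda>i. CLINT \<omega>|P. iexp (total (G i) \<omega>)) \<longlonglongrightarrow> (CLINT \<omega>|P. iexp (total F \<omega>))"
    by (rule integral_dominated_convergence[where w="\<lambda>_. 1"])
       (auto intro!: tendsto_intros lim AE_I2)
  moreover have "(\<lambda>i. exp (CLINT x|\<mu>. iexp (G i x) - 1)) \<longlonglongrightarrow> exp (CLINT x|\<mu>. iexp (F x) - 1)"
  proof (intro tendsto_exp integral_dominated_convergence[where w="\<lambda>_. 2"])
    show "AE x in \<mu>. norm (iexp (G i x) - 1) \<le> 2" for i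
    proof (rule AE_I2)
      fix x show "norm (iexp (G i x) - 1) \<le> 2"
        using norm_triangle_ineq4[of "iexp (G i x)" 1] by simp
    qed
  qed (auto intro!: tendsto_intros G(2) AE_I2)
  ultimately show "(CLINT \<omega>|P. iexp (total F \<omega>)) = exp (CLINT x|\<mu>. iexp (F x) - 1)"
    unfolding total_simple(2)[OF G(1)] by (rule LIMSEQ_unique)
qed

end

section \<open>Taylor bounds for test functions\<close>

text \<open>Coordinates are set in motion one by one. Adding \<open>j\<close> to the moving set
  \<open>J\<close> gives a function of two variables with a derivative in the first and a continuous
  derivative in the second, hence differentiable along the diagonal. This replaces a total
  derivative on \<open>vecs I\<close>.\<close>

lemma directional_derivative:
  fixes g :: "('i \<Rightarrow> real) \<Rightarrow> real"
  assumes I: "finite I"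
    and cont: "\<And>i. i \<in> I \<Longrightarrow> continuous_on (vecs I) (g' i)"
    and deriv: "\<And>i x. i \<in> I \<Longrightarrow> x \<in> vecs I \<Longrightarrow> ((\<lambda>s. g (x(i := s))) has_real_derivative g' i x) (at (x i))"
    and x: "x \<in> vecs I"
  shows "((\<lambda>s. g (\<lambda>i\<in>I. x i + s * y i)) has_real_derivative
     (\<Sum>i\<in>I. g' i (\<lambda>i\<in>I. x i + s * y i) * y i)) (at s)"
proof -
  define p where "p J x s = (\<lambda>i\<in>I. x i + (if i \<in> J then s * y i else 0))" for J x and s :: real
  have pv: "p J x s \<in> vecs I" for J x s by (simp add: p_def)
  have "((\<lambda>s. g (p J x s)) has_real_derivative (\<Sum>i\<in>J. g' i (p J x s) * y i)) (at s)"
    if "finite J" "J \<subseteq> I" "x \<in> vecs I" for J x s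
    using that
  proof (induction J arbitrary: x s rule: finite_induct)
    case (insert j J)
    have j: "j \<in> I" and J: "J \<subseteq> I" "j \<notin> J" using insert by auto
    \<comment> \<open>The clock is split: \<open>r\<close> drives coordinate \<open>j\<close> alone
      and \<open>s\<close> the coordinates in \<open>J\<close>. Setting \<open>r = s\<close> at the
      end restores the common motion.\<close>
    define X where "X r = x(j := x j + r * y j)" for r
    have Xv: "X r \<in> vecs I" for r using insert.prems j by (auto simp: X_def PiE_iff extensional_def)
    have pX: "p J (X r) s = (p J x s)(j := x j + r * y j)" for r s
      using J j by (auto simp: p_def X_def restrict_def)
    have pX': "p (insert j J) x s = p J (X s) s" for s
      using J j by (auto simp: p_def X_def restrict_def)
    define f where "f s r = g (p J (X r) s)" for s r
    define fy where "fy s r = g' j (p J (X r) s) * y j" for s r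
    have 1: "((\<lambda>s. f s s1) has_derivative (*) (\<Sum>i\<in>J. g' i (p J (X s1) s1) * y i)) (at s1 within UNIV)" for s1
      using insert.IH[OF J(1) Xv, of s1 s1] unfolding f_def by (simp add: has_field_derivative_def)
    have 2: "((\<lambda>r. f s r) has_derivative blinfun_apply (blinfun_scaleR_left (fy s r))) (at r within UNIV)" for s r
    proof -
      have "((\<lambda>q. g ((p J (X r) s)(j := q))) has_real_derivative g' j (p J (X r) s)) (at (p J (X r) s j))"
        by (rule deriv[OF j pv])
      moreover have "p J (X r) s j = x j + r * y j" by (simp add: pX)
      ultimately have "((\<lambda>q. g ((p J x s)(j := q))) has_real_derivative g' j (p J (X r) s)) (at (x j + r * y j))"
        by (simp add: pX)
      moreover have "((\<lambda>r. x j + r * y j) has_real_derivative y j) (at r)"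
        by (auto intro!: derivative_eq_intros)
      ultimately have "((\<lambda>r. g ((p J x s)(j := x j + r * y j))) has_real_derivative g' j (p J (X r) s) * y j) (at r)"
        by (rule DERIV_chain2[where f="\<lambda>q. g ((p J x s)(j := q))"])
      then have "((\<lambda>r. f s r) has_real_derivative fy s r) (at r)"
        unfolding f_def fy_def pX .
      then show ?thesis unfolding has_field_derivative_def
        by (rule has_derivative_eq_rhs) (auto simp: mult.commute)
    qed
    have "continuous_on UNIV (\<lambda>q. p J (X (snd q)) (fst q))"
    proof (rule continuous_on_coordinatewise_then_product)
      fix i show "continuous_on UNIV (\<lambda>q. p J (X (snd q)) (fst q) i)"
      proof (cases "i \<in> I")
        case True
        then show ?thesis
          by (cases "i \<in> J"; cases "i = j") (auto simp: p_def X_def intro!: continuous_intros)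
      qed (simp add: p_def)
    qed
    then have "continuous_on UNIV (\<lambda>q. g' j (p J (X (snd q)) (fst q)))"
      by (rule continuous_on_compose2[OF cont[OF j]]) (use pv in blast)
    then have 3: "continuous_on UNIV (\<lambda>q. blinfun_scaleR_left (fy (fst q) (snd q)))"
      unfolding fy_def
      by (intro bounded_linear.continuous_on[OF bounded_linear_blinfun_scaleR_left] continuous_intros)
    have "((\<lambda>(s, r). f s r) has_derivative (\<lambda>(ts, tr). (\<Sum>i\<in>J. g' i (p J (X s) s) * y i) * ts + blinfun_apply (blinfun_scaleR_left (fy s s)) tr)) (at (s, s) within UNIV \<times> UNIV)"
      by (rule has_derivative_partialsI[OF 1 2])
         (use 3 in \<open>auto simp: continuous_on_eq_continuous_within case_prod_unfold\<close>)
    then have *: "((\<lambda>(s, r). f s r) has_derivative (\<lambda>(ts, tr). (\<Sum>i\<in>J. g' i (p J (X s) s) * y i) * ts + tr * fy s s)) (at (s, s))"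
      by simp
    have "((\<lambda>s. (s, s)) has_derivative (\<lambda>t. (t, t))) (at s)"
      by (intro derivative_eq_intros) auto
    from has_derivative_compose[OF this *]
    have "((\<lambda>s. f s s) has_derivative (\<lambda>t. (\<Sum>i\<in>J. g' i (p J (X s) s) * y i) * t + t * fy s s)) (at s)" by simp
    then have "((\<lambda>s. f s s) has_real_derivative ((\<Sum>i\<in>J. g' i (p J (X s) s) * y i) + fy s s)) (at s)"
      unfolding has_field_derivative_def by (rule has_derivative_eq_rhs) (auto simp: algebra_simps)
    then show ?case using insert.hyps by (simp add: f_def fy_def pX' add.commute)
  qed (auto simp: p_def)
  from this[OF I order_refl x, of s] have "((\<lambda>s. g (p I x s)) has_real_derivative (\<Sum>i\<in>I. g' i (p I x s) * y i)) (at s)" .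
  moreover have "p I x s = (\<lambda>i\<in>I. x i + s * y i)" for s by (auto simp: p_def)
  ultimately show ?thesis by simp
qed

lemma lists_length_Suc_image:
  "{is. set is \<subseteq> I \<and> length is = Suc j} = (\<lambda>(i, is). i # is) ` (I \<times> {is. set is \<subseteq> I \<and> length is = j})"
  by (auto simp: length_Suc_conv image_iff)

text \<open>In \<open>partials (i # is)\<close> the direction \<open>i\<close> comes last, so the
  inner sum is the derivative of \<open>partials is h\<close> along \<open>y\<close>, the form that
  \<open>directional_derivative\<close> delivers.\<close>

lemma D_form_Suc_diagonal:
  assumes "finite I"
  shows "D_form I (Suc j) h x (\<lambda>_. y) =
    (\<Sum>is\<in>{is. set is \<subseteq> I \<and> length is = j}. (\<Sum>i\<in>I. partials (i # is) h x * y i) * (\<Prod>k<j. y (is ! k)))"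
proof -
  let ?S = "{is. set is \<subseteq> I \<and> length is = j}"
  have "D_form I (Suc j) h x (\<lambda>_. y) = (\<Sum>(i, is)\<in>I \<times> ?S. partials (i # is) h x * (\<Prod>k<Suc j. y ((i # is) ! k)))"
    unfolding D_form_def lists_length_Suc_image
    by (subst sum.reindex) (auto simp: inj_on_def case_prod_unfold simp del: partials.simps prod.lessThan_Suc)
  also have "\<dots> = (\<Sum>i\<in>I. \<Sum>is\<in>?S. partials (i # is) h x * y i * (\<Prod>k<j. y (is ! k)))"
    unfolding sum.cartesian_product[symmetric]
    by (simp only: prod.lessThan_Suc_shift nth_Cons_0 nth_Cons_Suc mult.assoc)
  also have "\<dots> = (\<Sum>is\<in>?S. \<Sum>i\<in>I. partials (i # is) h x * y i * (\<Prod>k<j. y (is ! k)))"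
    by (rule sum.swap)
  finally show ?thesis by (simp only: sum_distrib_right)
qed

lemma D_form_line_derivative:
  assumes I: "finite I" and h: "h \<in> C_class k I" and j: "j < k" and x: "x \<in> vecs I"
  shows "((\<lambda>s. D_form I j h (\<lambda>i\<in>I. x i + s * y i) (\<lambda>_. y)) has_real_derivative
      D_form I (Suc j) h (\<lambda>i\<in>I. x i + s * y i) (\<lambda>_. y)) (at s)"
  unfolding D_form_Suc_diagonal[OF I] unfolding D_form_def
proof (rule DERIV_sum, rule DERIV_cmult_right)
  fix "is" assume "is \<in> {is. set is \<subseteq> I \<and> length is = j}"
  then have "is": "set is \<subseteq> I" "length is < k" "length is = j" using j by auto
  show "((\<lambda>s. partials is h (\<lambda>i\<in>I. x i + s * y i)) has_real_derivative
      (\<Sum>i\<in>I. partials (i # is) h (\<lambda>i\<in>I. x i + s * y i) * y i)) (at s)"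
  proof (rule directional_derivative[OF I _ _ x, where g'="\<lambda>i. partials (i # is) h"])
    fix i assume i: "i \<in> I"
    show "continuous_on (vecs I) (partials (i # is) h)"
      using h i "is" unfolding C_class_def by (auto simp del: partials.simps)
    fix z assume z: "z \<in> vecs I"
    have "(\<lambda>s. partials is h (z(i := s))) field_differentiable at (z i)"
      using h i "is" z unfolding C_class_def by auto
    then show "((\<lambda>s. partials is h (z(i := s))) has_real_derivative partials (i # is) h z) (at (z i))"
      by (simp add: DERIV_deriv_iff_field_differentiable)
  qed
qed

lemma D_form_diagonal_scale: "D_form I j h x (\<lambda>_ i. c * y i) = c ^ j * D_form I j h x (\<lambda>_. y)"
  by (simp add: D_form_def prod.distrib sum_distrib_left mult.left_commute)

lemma D_form_cong:
  assumes "\<And>k i. k < j \<Longrightarrow> i \<in> I \<Longrightarrow> u k i = v k i"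
  shows "D_form I j h x u = D_form I j h x v"
  unfolding D_form_def
proof (intro sum.cong prod.cong refl arg_cong2[of _ _ _ _ "(*)"])
  fix "is" k assume "is \<in> {is. set is \<subseteq> I \<and> length is = j}" "k \<in> {..<j}"
  then show "u k (is ! k) = v k (is ! k)" by (intro assms) auto
qed

lemma D_form_diagonal_bound:
  assumes I: "finite I" and D: "D_sup_norm I j h \<le> 1" and x: "x \<in> vecs I"
  shows "\<bar>D_form I j h x (\<lambda>_. y)\<bar> \<le> L2_set y I ^ j"
proof (cases "L2_set y I = 0")
  case True
  then have y: "y i = 0" if "i \<in> I" for i using that I by (simp add: L2_set_eq_0_iff)
  show ?thesis
  proof (cases "j = 0")
    \<comment> \<open>For \<open>j = 0\<close> and \<open>y = 0\<close> the right-hand side is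
      \<open>0 ^ 0 = 1\<close>, so the claim is the bound on \<open>\<bar>h x\<bar>\<close>
      itself.\<close>
    case True
    have "ennreal \<bar>D_form I 0 h x (\<lambda>_. y)\<bar> \<le> op_norm I 0 (D_form I 0 h x)"
      unfolding op_norm_def by (rule SUP_upper) auto
    also have "\<dots> \<le> 1" using D x unfolding D_sup_norm_def True by (simp add: SUP_le_iff)
    finally show ?thesis using True by simp
  next
    case False
    then have "D_form I j h x (\<lambda>_. y) = D_form I j h x (\<lambda>_ i. 0 * y i)" using y by (intro D_form_cong) auto
    also have "\<dots> = 0" using False by (subst D_form_diagonal_scale) (simp add: power_0_left)
    finally show ?thesis by (simp add: L2_set_nonneg)
  qed
next
  case False
  define n where "n = L2_set y I"
  have n: "n > 0" using False L2_set_nonneg[of y I] unfolding n_def by linarith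
  define u where "u = (\<lambda>i\<in>I. y i / n)"
  have "L2_set u I = L2_set (\<lambda>i. inverse n * y i) I" by (rule L2_set_cong) (auto simp: u_def field_simps)
  also have "\<dots> = inverse n * L2_set y I" using n by (simp add: L2_set_right_distrib)
  finally have u: "L2_set u I = 1" using n by (simp add: n_def)
  have "ennreal \<bar>D_form I j h x (\<lambda>_. u)\<bar> \<le> op_norm I j (D_form I j h x)"
    unfolding op_norm_def using u by (intro SUP_upper2[of "\<lambda>_. u"]) (auto simp: u_def)
  also have "\<dots> \<le> 1" using D x unfolding D_sup_norm_def by (simp add: SUP_le_iff)
  finally have b: "\<bar>D_form I j h x (\<lambda>_. u)\<bar> \<le> 1" by simp
  have "D_form I j h x (\<lambda>_. y) = D_form I j h x (\<lambda>_ i. n * u i)" using n by (intro D_form_cong) (auto simp: u_def)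
  also have "\<dots> = n ^ j * D_form I j h x (\<lambda>_. u)" by (rule D_form_diagonal_scale)
  finally show ?thesis using b n by (simp add: abs_mult n_def[symmetric] mult_left_le)
qed

text \<open>Points of \<open>vecs I\<close> are \<open>undefined\<close> outside \<open>I\<close>, a
  value that plain pointwise addition would not preserve.\<close>

definition vadd :: "'i set \<Rightarrow> ('i \<Rightarrow> real) \<Rightarrow> ('i \<Rightarrow> real) \<Rightarrow> 'i \<Rightarrow> real" where
  "vadd I x y = (\<lambda>i\<in>I. x i + y i)"

lemma vadd_in_vecs [simp]: "vadd I x y \<in> vecs I" by (simp add: vadd_def)

text \<open>Taylor's formula with Lagrange remainder along the segment with direction
  \<open>y\<close>. Only diagonal values of the forms occur, which
  \<open>D_form_diagonal_bound\<close> controls.\<close>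

lemma taylor_bound:
  assumes I: "finite I" and h: "h \<in> C_class 3 I" and x: "x \<in> vecs I" and n: "0 < n" "n \<le> 3"
    and D: "D_sup_norm I n h \<le> 1"
  shows "\<bar>h (vadd I x y) - (\<Sum>m<n. D_form I m h x (\<lambda>_. y) / fact m)\<bar> \<le> L2_set y I ^ n / fact n"
proof -
  define L where "L s = (\<lambda>i\<in>I. x i + s * y i)" for s
  have L: "L s \<in> vecs I" for s by (simp add: L_def)
  have L0: "L 0 = x" using x by (auto simp: L_def PiE_iff extensional_def restrict_def fun_eq_iff)
  have L1: "L 1 = vadd I x y" by (simp add: L_def vadd_def)
  define F where "F m s = D_form I m h (L s) (\<lambda>_. y)" for m s
  have F0: "F 0 s = h (L s)" for s
  proof -
    have "{is. set is \<subseteq> I \<and> length is = 0} = {[]}" by auto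
    then show ?thesis by (simp add: F_def D_form_def)
  qed
  have "\<exists>t>0. t < 1 \<and> F 0 1 = (\<Sum>m<n. F m 0 / fact m * 1 ^ m) + F n t / fact n * 1 ^ n"
    using n D_form_line_derivative[OF I h _ x] by (intro Maclaurin) (auto simp: F_def L_def)
  then obtain t where "F 0 1 = (\<Sum>m<n. F m 0 / fact m) + F n t / fact n" by auto
  then have "\<bar>h (vadd I x y) - (\<Sum>m<n. D_form I m h x (\<lambda>_. y) / fact m)\<bar> = \<bar>F n t\<bar> / fact n"
    by (simp add: F0 L1) (simp add: F_def L0)
  also have "\<dots> \<le> L2_set y I ^ n / fact n"
    unfolding F_def by (intro divide_right_mono D_form_diagonal_bound I D L) auto
  finally show ?thesis .
qed

section \<open>Lindeberg comparison of convolutions\<close>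

lemma
  fixes f :: "'a \<Rightarrow> 'c::{real_normed_field, banach, second_countable_topology}"
  assumes "sigma_finite_measure M" "sigma_finite_measure N"
    and f: "integrable M f" and g: "integrable N g"
  shows integrable_pair_mult: "integrable (M \<Otimes>\<^sub>M N) (\<lambda>p. f (fst p) * g (snd p))"
    and integral_pair_mult: "(\<integral>p. f (fst p) * g (snd p) \<partial>(M \<Otimes>\<^sub>M N)) = integral\<^sup>L M f * integral\<^sup>L N g"
proof -
  interpret pair_sigma_finite M N using assms by (simp add: pair_sigma_finite_def)
  have [measurable]: "f \<in> borel_measurable M" "g \<in> borel_measurable N" using f g by auto
  show *: "integrable (M \<Otimes>\<^sub>M N) (\<lambda>p. f (fst p) * g (snd p))"
    by (rule Fubini_integrable) (use f g in \<open>auto simp: norm_mult\<close>)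
  show "(\<integral>p. f (fst p) * g (snd p) \<partial>(M \<Otimes>\<^sub>M N)) = integral\<^sup>L M f * integral\<^sup>L N g"
    using integral_fst'[OF *] by simp
qed

abbreviation vborel :: "'i set \<Rightarrow> ('i \<Rightarrow> real) measure" where
  "vborel I \<equiv> Pi\<^sub>M I (\<lambda>_. borel)"

text \<open>The Borel sets of a function type with countable index are generated by the coordinates,
  whence the sort \<open>countable\<close> in the integration lemmas for test functions. Coordinates
  outside \<open>I\<close> are constant on \<open>vecs I\<close>.\<close>

lemma continuous_on_vecs_measurable:
  fixes h :: "('i::countable \<Rightarrow> real) \<Rightarrow> real"
  assumes "continuous_on (vecs I) h"
  shows "h \<in> borel_measurable (vborel I)"
proof -
  have "(\<lambda>x. x i) \<in> borel_measurable (vborel I)" for i :: 'i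
  proof (cases "i \<in> I")
    case False
    have "(\<lambda>x. x i) \<in> borel_measurable (vborel I) \<longleftrightarrow> (\<lambda>x. undefined :: real) \<in> borel_measurable (vborel I)"
      by (rule measurable_cong) (use False in \<open>auto simp: space_PiM PiE_iff extensional_def\<close>)
    then show ?thesis by simp
  qed (rule measurable_component_singleton)
  then have "(\<lambda>x. x) \<in> vborel I \<rightarrow>\<^sub>M borel" by (rule measurable_coordinatewise_then_product)
  then have "(\<lambda>x. x) \<in> vborel I \<rightarrow>\<^sub>M restrict_space borel (vecs I)"
    by (rule measurable_restrict_space2[rotated]) (auto simp: space_PiM)
  from measurable_compose[OF this borel_measurable_continuous_on_restrict[OF assms]] show ?thesis by simp
qed

lemma vadd_measurable [measurable]:
  assumes [measurable]: "f \<in> M \<rightarrow>\<^sub>M vborel I" "g \<in> M \<rightarrow>\<^sub>M vborel I"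
  shows "(\<lambda>x. vadd I (f x) (g x)) \<in> M \<rightarrow>\<^sub>M vborel I"
  unfolding vadd_def by measurable

lemma vadd_assoc: "vadd I x (vadd I u w) = vadd I (vadd I x u) w"
  and vadd_left_commute: "vadd I x (vadd I u w) = vadd I (vadd I x w) u"
  by (auto simp: vadd_def restrict_def fun_eq_iff)

lemma L2_set_sq: "(L2_set y I)\<^sup>2 = (\<Sum>i\<in>I. (y i)\<^sup>2)"
  by (simp add: L2_set_def sum_nonneg)

lemma D_form_0: "D_form I 0 h x (\<lambda>_. y) = h x"
proof -
  have "{is. set is \<subseteq> I \<and> length is = 0} = {[]}" by auto
  then show ?thesis by (simp add: D_form_def)
qed

lemma D_form_1: "finite I \<Longrightarrow> D_form I 1 h x (\<lambda>_. y) = (\<Sum>i\<in>I. partials [i] h x * y i)"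
proof -
  assume "finite I"
  have "{is. set is \<subseteq> I \<and> length is = 0} = {[]}" by auto
  then show ?thesis using D_form_Suc_diagonal[OF \<open>finite I\<close>, of 0 h x y] by (simp del: partials.simps)
qed

lemma D_form_2: "finite I \<Longrightarrow> D_form I 2 h x (\<lambda>_. y) = (\<Sum>i\<in>I. \<Sum>j\<in>I. partials [i, j] h x * (y i * y j))"
proof -
  assume I: "finite I"
  have S: "{is. set is \<subseteq> I \<and> length is = 1} = (\<lambda>j. [j]) ` I" by (auto simp: length_Suc_conv)
  have "D_form I 2 h x (\<lambda>_. y) = (\<Sum>j\<in>I. (\<Sum>i\<in>I. partials [i, j] h x * y i) * y j)"
    using D_form_Suc_diagonal[OF I, of 1 h x y] unfolding S
    by (subst (asm) sum.reindex) (auto simp: inj_on_def numeral_2_eq_2 simp del: partials.simps)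
  also have "\<dots> = (\<Sum>j\<in>I. \<Sum>i\<in>I. partials [i, j] h x * (y i * y j))"
    by (simp only: sum_distrib_right mult.assoc)
  also have "\<dots> = (\<Sum>i\<in>I. \<Sum>j\<in>I. partials [i, j] h x * (y i * y j))" by (rule sum.swap)
  finally show ?thesis .
qed

lemma
  assumes I: "finite I" and h: "h \<in> test_class I" and x: "x \<in> vecs I"
  shows taylor2: "\<bar>h (vadd I x y) - (h x + (\<Sum>i\<in>I. partials [i] h x * y i))\<bar> \<le> (L2_set y I)\<^sup>2 / 2"
    and taylor3: "\<bar>h (vadd I x y) - (h x + (\<Sum>i\<in>I. partials [i] h x * y i)
      + (\<Sum>i\<in>I. \<Sum>j\<in>I. partials [i, j] h x * (y i * y j)) / 2)\<bar> \<le> (L2_set y I) ^ 3 / 6"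
proof -
  have h': "h \<in> C_class 3 I" "D_sup_norm I 2 h \<le> 1" "D_sup_norm I 3 h \<le> 1" using h by (auto simp: test_class_def)
  have s2: "(\<Sum>m<2. D_form I m h x (\<lambda>_. y) / fact m) = h x + (\<Sum>i\<in>I. partials [i] h x * y i)"
    by (simp only: numeral_2_eq_2 sum.lessThan_Suc)
       (simp add: D_form_0 D_form_1[OF I, unfolded One_nat_def] del: partials.simps)
  have s3: "(\<Sum>m<3. D_form I m h x (\<lambda>_. y) / fact m) = h x + (\<Sum>i\<in>I. partials [i] h x * y i)
      + (\<Sum>i\<in>I. \<Sum>j\<in>I. partials [i, j] h x * (y i * y j)) / 2"
    by (simp only: numeral_3_eq_3 sum.lessThan_Suc)
       (simp add: D_form_0 D_form_1[OF I, unfolded One_nat_def] D_form_2[OF I, unfolded numeral_2_eq_2] del: partials.simps)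
  show "\<bar>h (vadd I x y) - (h x + (\<Sum>i\<in>I. partials [i] h x * y i))\<bar> \<le> (L2_set y I)\<^sup>2 / 2"
    using taylor_bound[OF I h'(1) x _ _ h'(2), of y] unfolding s2 by simp
  show "\<bar>h (vadd I x y) - (h x + (\<Sum>i\<in>I. partials [i] h x * y i)
      + (\<Sum>i\<in>I. \<Sum>j\<in>I. partials [i, j] h x * (y i * y j)) / 2)\<bar> \<le> (L2_set y I) ^ 3 / 6"
    using taylor_bound[OF I h'(1) x _ _ h'(3), of y] unfolding s3 by (simp add: fact_numeral)
qed

lemma test_class_measurable:
  fixes h :: "('i::countable \<Rightarrow> real) \<Rightarrow> real"
  assumes "h \<in> test_class I"
  shows "h \<in> borel_measurable (vborel I)"
proof (rule continuous_on_vecs_measurable)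
  have "continuous_on (vecs I) (partials [] h)"
    using assms unfolding test_class_def C_class_def by (auto simp del: partials.simps)
  moreover have "partials [] h = h" by (rule ext) simp
  ultimately show "continuous_on (vecs I) h" by simp
qed

text \<open>Expansion at the origin bounds \<open>h\<close> by an affine function plus half the
  squared norm, both integrable.\<close>

lemma test_class_integrable:
  fixes h :: "('i::countable \<Rightarrow> real) \<Rightarrow> real"
  assumes I: "finite I" and h: "h \<in> test_class I" and M: "prob_space M"
    and X[measurable]: "X \<in> M \<rightarrow>\<^sub>M vborel I"
    and sq: "\<And>i. i \<in> I \<Longrightarrow> integrable M (\<lambda>\<omega>. (X \<omega> i)\<^sup>2)"
  shows "integrable M (\<lambda>\<omega>. h (X \<omega>))"
proof -
  interpret prob_space M by fact
  have Xi [measurable]: "(\<lambda>\<omega>. X \<omega> i) \<in> borel_measurable M" if "i \<in> I" for i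
    using measurable_compose[OF X measurable_component_singleton[OF that]] .
  have int1: "integrable M (\<lambda>\<omega>. X \<omega> i)" if "i \<in> I" for i
    using square_integrable_imp_integrable[OF Xi[OF that] sq[OF that]] .
  define z where "z = (\<lambda>i\<in>I. 0 :: real)"
  define A where "A \<omega> = h z + (\<Sum>i\<in>I. partials [i] h z * X \<omega> i)" for \<omega>
  have iA: "integrable M A" unfolding A_def using int1 by (auto simp del: partials.simps)
  have iB: "integrable M (\<lambda>\<omega>. (\<Sum>i\<in>I. (X \<omega> i)\<^sup>2) / 2)" using sq by auto
  have [measurable]: "(\<lambda>\<omega>. h (X \<omega>)) \<in> borel_measurable M"
    by (rule measurable_compose[OF X test_class_measurable[OF h]])
  have "integrable M (\<lambda>\<omega>. h (X \<omega>) - A \<omega>)"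
  proof (rule Bochner_Integration.integrable_bound[OF iB])
    show "(\<lambda>\<omega>. h (X \<omega>) - A \<omega>) \<in> borel_measurable M" using iA by measurable
    show "AE \<omega> in M. norm (h (X \<omega>) - A \<omega>) \<le> norm ((\<Sum>i\<in>I. (X \<omega> i)\<^sup>2) / 2)"
    proof (rule AE_I2)
      fix \<omega> assume "\<omega> \<in> space M"
      then have "X \<omega> \<in> vecs I" using measurable_space[OF X] by (auto simp: space_PiM)
      then have "vadd I z (X \<omega>) = X \<omega>" by (auto simp: vadd_def z_def PiE_iff extensional_def fun_eq_iff)
      then show "norm (h (X \<omega>) - A \<omega>) \<le> norm ((\<Sum>i\<in>I. (X \<omega> i)\<^sup>2) / 2)"
        using taylor2[OF I h, of z "X \<omega>"] by (simp add: z_def A_def L2_set_sq sum_nonneg del: partials.simps)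
    qed
  qed
  from Bochner_Integration.integrable_add[OF this iA] show ?thesis by simp
qed

section \<open>Convolution of laws with finite second moments\<close>

definition L2_law :: "'i set \<Rightarrow> ('i \<Rightarrow> real) measure \<Rightarrow> bool" where
  "L2_law I M \<longleftrightarrow> prob_space M \<and> sets M = sets (vborel I) \<and> (\<forall>i\<in>I. integrable M (\<lambda>x. (x i)\<^sup>2))"

definition conv :: "'i set \<Rightarrow> ('i \<Rightarrow> real) measure \<Rightarrow> ('i \<Rightarrow> real) measure \<Rightarrow> ('i \<Rightarrow> real) measure" where
  "conv I M N = distr (M \<Otimes>\<^sub>M N) (vborel I) (\<lambda>p. vadd I (fst p) (snd p))"

lemma sets_conv [simp]: "sets (conv I M N) = sets (vborel I)" by (simp add: conv_def)

lemma conv_map_measurable: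
  assumes "sets M = sets (vborel I)" "sets N = sets (vborel I)"
  shows "(\<lambda>p. vadd I (fst p) (snd p)) \<in> M \<Otimes>\<^sub>M N \<rightarrow>\<^sub>M vborel I"
proof -
  note [measurable_cong] = assms
  show ?thesis by measurable
qed

lemma L2_lawD: "L2_law I M \<Longrightarrow> prob_space M" "L2_law I M \<Longrightarrow> sets M = sets (vborel I)"
  "L2_law I M \<Longrightarrow> i \<in> I \<Longrightarrow> integrable M (\<lambda>x. (x i)\<^sup>2)" "L2_law I M \<Longrightarrow> sigma_finite_measure M"
  by (auto simp: L2_law_def prob_space_def finite_measure_def)

lemma space_L2_law: "L2_law I M \<Longrightarrow> space M = vecs I"
  using sets_eq_imp_space_eq[OF L2_lawD(2)] by (simp add: space_PiM)

lemma
  assumes M: "L2_law I M" and N: "L2_law I N" and i: "i \<in> I"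
  shows L2_pair_fst: "integrable (M \<Otimes>\<^sub>M N) (\<lambda>p. (fst p i)\<^sup>2)"
    and L2_pair_snd: "integrable (M \<Otimes>\<^sub>M N) (\<lambda>p. (snd p i)\<^sup>2)"
proof -
  interpret M: prob_space M using M by (rule L2_lawD)
  interpret N: prob_space N using N by (rule L2_lawD)
  show "integrable (M \<Otimes>\<^sub>M N) (\<lambda>p. (fst p i)\<^sup>2)"
    using integrable_pair_mult[OF L2_lawD(4)[OF M] L2_lawD(4)[OF N] L2_lawD(3)[OF M i], of "\<lambda>_. 1"] by simp
  show "integrable (M \<Otimes>\<^sub>M N) (\<lambda>p. (snd p i)\<^sup>2)"
    using integrable_pair_mult[OF L2_lawD(4)[OF M] L2_lawD(4)[OF N] _ L2_lawD(3)[OF N i], of "\<lambda>_. 1"] by simp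
qed

lemma integrable_square_add:
  fixes f g :: "'a \<Rightarrow> real"
  assumes [measurable]: "f \<in> borel_measurable M" "g \<in> borel_measurable M"
    and f: "integrable M (\<lambda>x. (f x)\<^sup>2)" and g: "integrable M (\<lambda>x. (g x)\<^sup>2)"
  shows "integrable M (\<lambda>x. (f x + g x)\<^sup>2)"
proof (rule Bochner_Integration.integrable_bound)
  show "integrable M (\<lambda>x. 2 * (f x)\<^sup>2 + 2 * (g x)\<^sup>2)" using f g by simp
  show "AE x in M. norm ((f x + g x)\<^sup>2) \<le> norm (2 * (f x)\<^sup>2 + 2 * (g x)\<^sup>2)"
  proof (rule AE_I2)
    fix x
    have "(f x + g x)\<^sup>2 + (f x - g x)\<^sup>2 = 2 * (f x)\<^sup>2 + 2 * (g x)\<^sup>2" by (simp add: power2_eq_square algebra_simps)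
    then have "(f x + g x)\<^sup>2 \<le> 2 * (f x)\<^sup>2 + 2 * (g x)\<^sup>2" using zero_le_power2[of "f x - g x"] by linarith
    then show "norm ((f x + g x)\<^sup>2) \<le> norm (2 * (f x)\<^sup>2 + 2 * (g x)\<^sup>2)" by simp
  qed
qed measurable

lemma L2_law_conv:
  assumes M: "L2_law I M" and N: "L2_law I N"
  shows "L2_law I (conv I M N)"
proof -
  note s = L2_lawD(2)[OF M] L2_lawD(2)[OF N]
  note [measurable_cong] = s
  interpret M: prob_space M using M by (rule L2_lawD)
  interpret N: prob_space N using N by (rule L2_lawD)
  interpret MN: pair_prob_space M N ..
  note m = conv_map_measurable[OF s]
  have "integrable (conv I M N) (\<lambda>x. (x i)\<^sup>2)" if i: "i \<in> I" for i
  proof -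
    have [measurable]: "(\<lambda>x. x i) \<in> borel_measurable M" "(\<lambda>x. x i) \<in> borel_measurable N"
      unfolding measurable_cong_sets[OF s(1) refl] measurable_cong_sets[OF s(2) refl]
      by (rule measurable_component_singleton[OF i])+
    have "integrable (M \<Otimes>\<^sub>M N) (\<lambda>p. (fst p i + snd p i)\<^sup>2)"
      by (rule integrable_square_add) (use L2_pair_fst[OF M N i] L2_pair_snd[OF M N i] in simp_all)
    moreover have "(\<lambda>x. (x i)\<^sup>2) \<in> borel_measurable (vborel I)" using i by measurable
    ultimately show ?thesis unfolding conv_def using i
      by (subst integrable_distr_eq[OF m]) (simp_all add: vadd_def)
  qed
  moreover have "prob_space (conv I M N)" unfolding conv_def by (rule MN.prob_space_distr[OF m])
  ultimately show ?thesis by (simp add: L2_law_def)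
qed

lemma char_vec_conv:
  assumes I: "finite I" and M: "L2_law I M" and N: "L2_law I N"
  shows "char_vec I (conv I M N) u = char_vec I M u * char_vec I N u"
proof -
  note s = L2_lawD(2)[OF M] L2_lawD(2)[OF N]
  interpret M: prob_space M using M by (rule L2_lawD)
  interpret N: prob_space N using N by (rule L2_lawD)
  note m = conv_map_measurable[OF s]
  have L: "(\<lambda>x. iexp (\<Sum>i\<in>I. u i * x i)) \<in> borel_measurable (vborel I)" by measurable
  have iM: "integrable M (\<lambda>x. iexp (\<Sum>i\<in>I. u i * x i))"
    by (rule M.integrable_const_bound[where B=1]) (use L in \<open>auto simp: measurable_cong_sets[OF s(1) refl]\<close>)
  have iN: "integrable N (\<lambda>x. iexp (\<Sum>i\<in>I. u i * x i))"
    by (rule N.integrable_const_bound[where B=1]) (use L in \<open>auto simp: measurable_cong_sets[OF s(2) refl]\<close>)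
  have e: "iexp (\<Sum>i\<in>I. u i * vadd I x y i) = iexp (\<Sum>i\<in>I. u i * x i) * iexp (\<Sum>i\<in>I. u i * y i)" for x y
  proof -
    have "(\<Sum>i\<in>I. u i * vadd I x y i) = (\<Sum>i\<in>I. u i * x i) + (\<Sum>i\<in>I. u i * y i)"
      by (simp add: vadd_def distrib_left sum.distrib)
    then show ?thesis by (simp only: of_real_add distrib_left exp_add)
  qed
  have "char_vec I (conv I M N) u = (CLINT p|M \<Otimes>\<^sub>M N. iexp (\<Sum>i\<in>I. u i * vadd I (fst p) (snd p) i))"
    unfolding char_vec_def conv_def by (rule integral_distr[OF m L])
  also have "\<dots> = char_vec I M u * char_vec I N u"
    unfolding e char_vec_def by (rule integral_pair_mult[OF L2_lawD(4)[OF M] L2_lawD(4)[OF N] iM iN])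
  finally show ?thesis .
qed

text \<open>The shift is absorbed into the random vector, whose second moments stay finite; the test
  function remains \<open>h\<close> itself.\<close>

lemma test_shift_integrable:
  fixes h :: "('i::countable \<Rightarrow> real) \<Rightarrow> real"
  assumes I: "finite I" and h: "h \<in> test_class I" and M: "L2_law I M" and x: "x \<in> vecs I"
  shows "integrable M (\<lambda>y. h (vadd I x y))"
proof (rule test_class_integrable[OF I h L2_lawD(1)[OF M]])
  note s = L2_lawD(2)[OF M]
  note [measurable_cong] = s
  interpret prob_space M using M by (rule L2_lawD)
  have [measurable]: "(\<lambda>_. x) \<in> M \<rightarrow>\<^sub>M vborel I" using x by (auto simp: space_PiM)
  show "vadd I x \<in> M \<rightarrow>\<^sub>M vborel I" by measurable
  fix i assume i: "i \<in> I"
  have [measurable]: "(\<lambda>x. x i) \<in> borel_measurable M" unfolding measurable_cong_sets[OF s refl]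
    by (rule measurable_component_singleton[OF i])
  have "integrable M (\<lambda>y. (x i + y i)\<^sup>2)"
    by (rule integrable_square_add) (use L2_lawD(3)[OF M i] in auto)
  then show "integrable M (\<lambda>y. (vadd I x y i)\<^sup>2)" using i by (simp add: vadd_def)
qed

text \<open>Fubini in both orders. The shift \<open>x\<close> is carried along so that each inner
  integral has the shape of the outer one, with \<open>x\<close> replaced by a partial sum.\<close>

lemma
  fixes h :: "('i::countable \<Rightarrow> real) \<Rightarrow> real"
  assumes I: "finite I" and h: "h \<in> test_class I" and M: "L2_law I M" and N: "L2_law I N" and x: "x \<in> vecs I"
  shows conv_integral1: "(\<integral>z. h (vadd I x z) \<partial>conv I M N) = (\<integral>u. \<integral>w. h (vadd I (vadd I x u) w) \<partial>N \<partial>M)" (is ?a)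
    and conv_integral2: "(\<integral>z. h (vadd I x z) \<partial>conv I M N) = (\<integral>w. \<integral>u. h (vadd I (vadd I x w) u) \<partial>M \<partial>N)" (is ?b)
    and conv_integrable1: "integrable M (\<lambda>u. \<integral>w. h (vadd I (vadd I x u) w) \<partial>N)" (is ?c)
    and conv_integrable2: "integrable N (\<lambda>w. \<integral>u. h (vadd I (vadd I x w) u) \<partial>M)" (is ?d)
proof -
  note s = L2_lawD(2)[OF M] L2_lawD(2)[OF N]
  note m = conv_map_measurable[OF s]
  interpret M: prob_space M using M by (rule L2_lawD)
  interpret N: prob_space N using N by (rule L2_lawD)
  interpret MN: pair_prob_space M N ..
  have xm: "(\<lambda>_. x) \<in> vborel I \<rightarrow>\<^sub>M vborel I" using x by (auto simp: space_PiM)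
  have hm: "(\<lambda>z. h (vadd I x z)) \<in> borel_measurable (vborel I)"
    by (rule measurable_compose[OF vadd_measurable[OF xm measurable_ident_sets[OF refl]] test_class_measurable[OF h]])
  have "integrable (conv I M N) (\<lambda>z. h (vadd I x z))"
    by (rule test_shift_integrable[OF I h L2_law_conv[OF M N] x])
  then have *: "integrable (M \<Otimes>\<^sub>M N) (\<lambda>p. h (vadd I x (vadd I (fst p) (snd p))))"
    unfolding conv_def by (subst (asm) integrable_distr_eq[OF m hm])
  then have i: "integrable (M \<Otimes>\<^sub>M N) (\<lambda>(u, w). h (vadd I x (vadd I u w)))" by (simp add: case_prod_unfold)
  have c: "(\<integral>z. h (vadd I x z) \<partial>conv I M N) = (\<integral>p. h (vadd I x (vadd I (fst p) (snd p))) \<partial>(M \<Otimes>\<^sub>M N))"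
    unfolding conv_def by (rule integral_distr[OF m hm])
  show ?a using MN.integral_fst[OF i] c by (simp add: vadd_assoc case_prod_unfold)
  show ?b using MN.integral_snd[OF i] c by (simp add: vadd_left_commute case_prod_unfold)
  show ?c using MN.integrable_fst[OF i] by (simp add: vadd_assoc)
  show ?d using MN.integrable_snd[OF i] by (simp add: vadd_left_commute)
qed

lemma (in prob_space) integral_diff_le:
  fixes f g :: "'a \<Rightarrow> real"
  assumes "integrable M f" "integrable M g" "\<And>x. x \<in> space M \<Longrightarrow> \<bar>f x - g x\<bar> \<le> B"
  shows "\<bar>integral\<^sup>L M f - integral\<^sup>L M g\<bar> \<le> B"
proof -
  have "\<bar>integral\<^sup>L M f - integral\<^sup>L M g\<bar> = \<bar>\<integral>x. f x - g x \<partial>M\<bar>" using assms by simp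
  also have "\<dots> \<le> (\<integral>x. \<bar>f x - g x\<bar> \<partial>M)" by (rule integral_abs_bound)
  also have "\<dots> \<le> (\<integral>x. B \<partial>M)" using assms by (intro integral_mono) auto
  finally show ?thesis by (simp add: prob_space)
qed

text \<open>Convolutions commute, so the exchanged summand can always be applied first: only \<open>h\<close> itself, and
  no smoothed version of it, is ever expanded.\<close>

lemma lindeberg:
  fixes h :: "('i::countable \<Rightarrow> real) \<Rightarrow> real"
  assumes I: "finite I" and h: "h \<in> test_class I"
    and a: "L2_law I a" and g: "L2_law I g" and L: "\<And>k. L2_law I (L k)" and G: "\<And>k. L2_law I (G k)"
    and 0: "L 0 = G 0" and LS: "\<And>k. L (Suc k) = conv I a (L k)" and GS: "\<And>k. G (Suc k) = conv I g (G k)"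
    and step: "\<And>x. x \<in> vecs I \<Longrightarrow> \<bar>(\<integral>u. h (vadd I x u) \<partial>a) - (\<integral>u. h (vadd I x u) \<partial>g)\<bar> \<le> B"
    and x: "x \<in> vecs I"
  shows "\<bar>(\<integral>y. h (vadd I x y) \<partial>L k) - (\<integral>y. h (vadd I x y) \<partial>G k)\<bar> \<le> real k * B"
  using x
proof (induction k arbitrary: x)
  case (Suc k)
  interpret Lk: prob_space "L k" using L by (rule L2_lawD)
  interpret g: prob_space g using g by (rule L2_lawD)
  \<comment> \<open>The exchanged summand is integrated innermost, from a shifted point
    \<open>vadd I x w\<close>, where \<open>step\<close> applies.\<close>
  have 1: "\<bar>(\<integral>y. h (vadd I x y) \<partial>conv I a (L k)) - (\<integral>y. h (vadd I x y) \<partial>conv I g (L k))\<bar> \<le> B"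
    unfolding conv_integral2[OF I h a L Suc.prems] conv_integral2[OF I h g L Suc.prems]
    by (intro Lk.integral_diff_le conv_integrable2 I h a g L Suc.prems step) simp
  \<comment> \<open>Now the common summand \<open>g\<close> is outermost, and the induction
    hypothesis is used at every shifted point; hence \<open>x\<close> is arbitrary in the
    induction.\<close>
  have 2: "\<bar>(\<integral>y. h (vadd I x y) \<partial>conv I g (L k)) - (\<integral>y. h (vadd I x y) \<partial>conv I g (G k))\<bar> \<le> real k * B"
    unfolding conv_integral1[OF I h g L Suc.prems] conv_integral1[OF I h g G Suc.prems]
    by (intro g.integral_diff_le conv_integrable1 I h g L G Suc.prems Suc.IH) simp
  show ?case unfolding LS GS using 1 2 by (simp add: algebra_simps)
qed (simp add: 0)

text \<open>Centring removes the gradient term of the Taylor expansion. The bound measures the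
  effect of adding an independent Gaussian in \<open>gauss_smoothing\<close>.\<close>

lemma second_order_bound:
  fixes h :: "('i::countable \<Rightarrow> real) \<Rightarrow> real"
  assumes I: "finite I" and h: "h \<in> test_class I" and M: "L2_law I M" and x: "x \<in> vecs I"
    and mean: "\<And>i. i \<in> I \<Longrightarrow> (\<integral>y. y i \<partial>M) = 0"
  shows "\<bar>(\<integral>y. h (vadd I x y) \<partial>M) - h x\<bar> \<le> (\<Sum>i\<in>I. \<integral>y. (y i)\<^sup>2 \<partial>M) / 2"
proof -
  interpret prob_space M using M by (rule L2_lawD)
  note s = L2_lawD(2)[OF M]
  have m: "(\<lambda>y. y i) \<in> borel_measurable M" if "i \<in> I" for i
    unfolding measurable_cong_sets[OF s refl] by (rule measurable_component_singleton[OF that])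
  have i1: "integrable M (\<lambda>y. y i)" if "i \<in> I" for i
    using square_integrable_imp_integrable[OF m[OF that] L2_lawD(3)[OF M that]] .
  have ih: "integrable M (\<lambda>y. h (vadd I x y))" by (rule test_shift_integrable[OF I h M x])
  have ip: "integrable M (\<lambda>y. h x + (\<Sum>i\<in>I. partials [i] h x * y i))"
    using i1 by (auto simp del: partials.simps)
  have ep: "(\<integral>y. h x + (\<Sum>i\<in>I. partials [i] h x * y i) \<partial>M) = h x"
    using i1 mean by (subst Bochner_Integration.integral_add) (auto simp: prob_space simp del: partials.simps)
  have "\<bar>(\<integral>y. h (vadd I x y) \<partial>M) - h x\<bar> = \<bar>\<integral>y. h (vadd I x y) - (h x + (\<Sum>i\<in>I. partials [i] h x * y i)) \<partial>M\<bar>"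
    unfolding Bochner_Integration.integral_diff[OF ih ip] ep ..
  also have "\<dots> \<le> (\<integral>y. \<bar>h (vadd I x y) - (h x + (\<Sum>i\<in>I. partials [i] h x * y i))\<bar> \<partial>M)"
    by (rule integral_abs_bound)
  also have "\<dots> \<le> (\<integral>y. (\<Sum>i\<in>I. (y i)\<^sup>2) / 2 \<partial>M)"
    using taylor2[OF I h x] ih ip L2_lawD(3)[OF M]
    by (intro integral_mono) (auto simp: L2_set_sq simp del: partials.simps)
  also have "\<dots> = (\<Sum>i\<in>I. \<integral>y. (y i)\<^sup>2 \<partial>M) / 2"
    using L2_lawD(3)[OF M] by simp
  finally show ?thesis .
qed

text \<open>For mean 0 and covariance \<open>v\<close> times the identity, the second-order Taylor
  polynomial integrates to a value that depends on the law only through \<open>v\<close>. Two such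
  laws can therefore be compared through that value.\<close>

lemma third_order_bound:
  fixes h :: "('i::countable \<Rightarrow> real) \<Rightarrow> real"
  assumes I: "finite I" and h: "h \<in> test_class I" and M: "L2_law I M" and x: "x \<in> vecs I"
    and mean: "\<And>i. i \<in> I \<Longrightarrow> (\<integral>y. y i \<partial>M) = 0"
    and cov: "\<And>i j. i \<in> I \<Longrightarrow> j \<in> I \<Longrightarrow> (\<integral>y. y i * y j \<partial>M) = (if i = j then v else 0)"
    and third: "integrable M (\<lambda>y. (L2_set y I) ^ 3)"
  shows "\<bar>(\<integral>y. h (vadd I x y) \<partial>M) - (h x + (\<Sum>i\<in>I. partials [i, i] h x * v) / 2)\<bar> \<le> (\<integral>y. (L2_set y I) ^ 3 \<partial>M) / 6"
proof -
  interpret prob_space M using M by (rule L2_lawD)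
  note s = L2_lawD(2)[OF M]
  have m: "(\<lambda>y. y i) \<in> borel_measurable M" if "i \<in> I" for i
    unfolding measurable_cong_sets[OF s refl] by (rule measurable_component_singleton[OF that])
  have i1: "integrable M (\<lambda>y. y i)" if "i \<in> I" for i
    using square_integrable_imp_integrable[OF m[OF that] L2_lawD(3)[OF M that]] .
  have i2: "integrable M (\<lambda>y. y i * y j)" if "i \<in> I" "j \<in> I" for i j
  proof (rule Bochner_Integration.integrable_bound)
    show "integrable M (\<lambda>y. (y i)\<^sup>2 + (y j)\<^sup>2)" using L2_lawD(3)[OF M] that by auto
    show "AE y in M. norm (y i * y j) \<le> norm ((y i)\<^sup>2 + (y j)\<^sup>2)"
    proof (rule AE_I2)
      fix y :: "'i \<Rightarrow> real"
      have "2 * (\<bar>y i\<bar> * \<bar>y j\<bar>) \<le> (y i)\<^sup>2 + (y j)\<^sup>2"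
        using zero_le_power2[of "\<bar>y i\<bar> - \<bar>y j\<bar>"] by (simp add: power2_diff)
      moreover have "0 \<le> \<bar>y i\<bar> * \<bar>y j\<bar>" by simp
      ultimately show "norm (y i * y j) \<le> norm ((y i)\<^sup>2 + (y j)\<^sup>2)" unfolding real_norm_def abs_mult by linarith
    qed
  qed (use m that in measurable)
  define Q where "Q y = h x + (\<Sum>i\<in>I. partials [i] h x * y i) + (\<Sum>i\<in>I. \<Sum>j\<in>I. partials [i, j] h x * (y i * y j)) / 2" for y
  have ih: "integrable M (\<lambda>y. h (vadd I x y))" by (rule test_shift_integrable[OF I h M x])
  have iq: "integrable M (\<lambda>y. (\<Sum>i\<in>I. partials [i] h x * y i))" using i1 by (auto simp del: partials.simps)
  have iq2: "integrable M (\<lambda>y. (\<Sum>i\<in>I. \<Sum>j\<in>I. partials [i, j] h x * (y i * y j)) / 2)" using i2 by (auto simp del: partials.simps)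
  have iQ: "integrable M Q" unfolding Q_def using iq iq2 by (auto simp del: partials.simps)
  have "integral\<^sup>L M Q = h x + (\<Sum>i\<in>I. partials [i] h x * (\<integral>y. y i \<partial>M)) + (\<Sum>i\<in>I. \<Sum>j\<in>I. partials [i, j] h x * (\<integral>y. y i * y j \<partial>M)) / 2"
    unfolding Q_def using i1 i2 iq iq2 by (simp add: prob_space del: partials.simps)
  also have "\<dots> = h x + (\<Sum>i\<in>I. partials [i, i] h x * v) / 2"
  proof -
    have "(\<Sum>j\<in>I. partials [i, j] h x * (\<integral>y. y i * y j \<partial>M)) = partials [i, i] h x * v" if "i \<in> I" for i
    proof -
      have "(\<Sum>j\<in>I. partials [i, j] h x * (\<integral>y. y i * y j \<partial>M)) = (\<Sum>j\<in>I. if i = j then partials [i, j] h x * v else 0)"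
        using that by (intro sum.cong refl) (simp add: cov del: partials.simps)
      then show ?thesis using that I by (simp del: partials.simps)
    qed
    then show ?thesis by (simp add: mean del: partials.simps)
  qed
  finally have eQ: "integral\<^sup>L M Q = h x + (\<Sum>i\<in>I. partials [i, i] h x * v) / 2" .
  have "\<bar>(\<integral>y. h (vadd I x y) \<partial>M) - integral\<^sup>L M Q\<bar> = \<bar>\<integral>y. h (vadd I x y) - Q y \<partial>M\<bar>"
    unfolding Bochner_Integration.integral_diff[OF ih iQ] ..
  also have "\<dots> \<le> (\<integral>y. \<bar>h (vadd I x y) - Q y\<bar> \<partial>M)" by (rule integral_abs_bound)
  also have "\<dots> \<le> (\<integral>y. (L2_set y I) ^ 3 / 6 \<partial>M)"
    using taylor3[OF I h x] ih iQ third unfolding Q_def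
    by (intro integral_mono) (auto simp del: partials.simps)
  finally show ?thesis unfolding eQ by simp
qed

section \<open>Isotropic Gaussian laws\<close>

abbreviation std_normal :: "real measure" where "std_normal \<equiv> std_normal_distribution"

lemma prob_space_std_normal: "prob_space std_normal"
  by (rule prob_space_normal_density) simp

lemma
  shows std_normal_integrable: "integrable std_normal (\<lambda>x. x ^ k)"
    and std_normal_moment: "(\<integral>x. x ^ k \<partial>std_normal) = (\<integral>x. std_normal_density x * x ^ k \<partial>lborel)"
  using integrable_std_normal_moment[of k]
  by (auto simp: integrable_density integral_density)

lemma std_normal_moments:
  "(\<integral>x. x \<partial>std_normal) = 0" "(\<integral>x. x\<^sup>2 \<partial>std_normal) = 1" "(\<integral>x. x ^ 4 \<partial>std_normal) = 3"
  using std_normal_moment[of 1] std_normal_moment[of 2] std_normal_moment[of 4]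
    integral_std_normal_moment_odd[of 0] integral_std_normal_moment_even[of 1] integral_std_normal_moment_even[of 2]
  by (simp_all add: fact_numeral)

text \<open>Built by scaling rather than by a density, so that \<open>s = 0\<close> is the point
  mass at the origin, the common start \<open>L 0 = G 0\<close> of the induction in
  \<open>lindeberg\<close>.\<close>

definition gauss :: "'i set \<Rightarrow> real \<Rightarrow> ('i \<Rightarrow> real) measure" where
  "gauss I s = distr (Pi\<^sub>M I (\<lambda>_. std_normal)) (vborel I) (\<lambda>x. \<lambda>i\<in>I. sqrt s * x i)"

lemma gauss_map_measurable: "(\<lambda>x. \<lambda>i\<in>I. sqrt s * x i) \<in> Pi\<^sub>M I (\<lambda>_. std_normal) \<rightarrow>\<^sub>M vborel I"
  by measurable

lemma gauss_integral:
  fixes f :: "_ \<Rightarrow> 'b::{banach, second_countable_topology}"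
  assumes "f \<in> borel_measurable (vborel I)"
  shows "integral\<^sup>L (gauss I s) f = (\<integral>x. f (\<lambda>i\<in>I. sqrt s * x i) \<partial>Pi\<^sub>M I (\<lambda>_. std_normal))"
    and "integrable (gauss I s) f \<longleftrightarrow> integrable (Pi\<^sub>M I (\<lambda>_. std_normal)) (\<lambda>x. f (\<lambda>i\<in>I. sqrt s * x i))"
  unfolding gauss_def
  by (rule integral_distr[OF gauss_map_measurable assms], rule integrable_distr_eq[OF gauss_map_measurable assms])

text \<open>A function of one coordinate is a product over all coordinates whose other factors are
  1, so the product formula applies.\<close>

lemma
  fixes f :: "real \<Rightarrow> real"
  assumes I: "finite I" "i \<in> I" and f: "integrable std_normal f"
  shows PiM_std_normal_integrable: "integrable (Pi\<^sub>M I (\<lambda>_. std_normal)) (\<lambda>x. f (x i))"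
    and PiM_std_normal_integral: "(\<integral>x. f (x i) \<partial>Pi\<^sub>M I (\<lambda>_. std_normal)) = integral\<^sup>L std_normal f"
proof -
  interpret std: prob_space std_normal by (rule prob_space_std_normal)
  interpret product_sigma_finite "\<lambda>_. std_normal"
    by (simp add: product_sigma_finite_def std.sigma_finite_measure_axioms)
  have i: "integrable std_normal (if k = i then f else (\<lambda>_. 1))" for k using f by auto
  have p: "(\<Prod>k\<in>I. (if k = i then f else (\<lambda>_. 1)) (x k)) = f (x i)" for x
  proof -
    have "(\<Prod>k\<in>I. (if k = i then f else (\<lambda>_. 1)) (x k)) = (\<Prod>k\<in>I. if k = i then f (x k) else 1)"
      by (intro prod.cong) auto
    then show ?thesis using I by simp
  qed
  have q: "(\<Prod>k\<in>I. integral\<^sup>L std_normal (if k = i then f else (\<lambda>_. 1))) = integral\<^sup>L std_normal f"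
  proof -
    have "(\<Prod>k\<in>I. integral\<^sup>L std_normal (if k = i then f else (\<lambda>_. 1))) = (\<Prod>k\<in>I. if k = i then integral\<^sup>L std_normal f else 1)"
      using std.prob_space by (intro prod.cong) auto
    then show ?thesis using I by simp
  qed
  show "integrable (Pi\<^sub>M I (\<lambda>_. std_normal)) (\<lambda>x. f (x i))"
    using product_integrable_prod[OF I(1), of "\<lambda>k. if k = i then f else (\<lambda>_. 1)", OF i] by (simp only: p)
  show "(\<integral>x. f (x i) \<partial>Pi\<^sub>M I (\<lambda>_. std_normal)) = integral\<^sup>L std_normal f"
    using product_integral_prod[OF I(1), of "\<lambda>k. if k = i then f else (\<lambda>_. 1)", OF i] by (simp only: p q)
qed

lemma PiM_std_normal_mult:
  assumes I: "finite I" "i \<in> I" "j \<in> I" and ij: "i \<noteq> j"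
  shows "(\<integral>x. x i * x j \<partial>Pi\<^sub>M I (\<lambda>_. std_normal)) = 0"
proof -
  interpret std: prob_space std_normal by (rule prob_space_std_normal)
  interpret product_sigma_finite "\<lambda>_. std_normal"
    by (simp add: product_sigma_finite_def std.sigma_finite_measure_axioms)
  have i: "integrable std_normal (if k = i \<or> k = j then (\<lambda>x. x) else (\<lambda>_. 1))" for k
    using std_normal_integrable[of 1] by auto
  have p: "(\<Prod>k\<in>I. (if k = i \<or> k = j then (\<lambda>x. x) else (\<lambda>_. 1)) (x k)) = x i * x j" for x :: "_ \<Rightarrow> real"
  proof -
    have "(\<Prod>k\<in>I. (if k = i \<or> k = j then (\<lambda>x. x) else (\<lambda>_. 1)) (x k))
       = (\<Prod>k\<in>I. (if k = i then x k else 1) * (if k = j then x k else 1))"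
      using ij by (intro prod.cong) auto
    then show ?thesis using I by (simp add: prod.distrib)
  qed
  have "(\<integral>x. x i * x j \<partial>Pi\<^sub>M I (\<lambda>_. std_normal)) = (\<Prod>k\<in>I. integral\<^sup>L std_normal (if k = i \<or> k = j then (\<lambda>x. x) else (\<lambda>_. 1)))"
    using product_integral_prod[OF I(1), of "\<lambda>k. if k = i \<or> k = j then (\<lambda>x. x) else (\<lambda>_. 1)", OF i] by (simp only: p)
  also have "\<dots> = 0"
    by (rule prod_zero[OF I(1)]) (auto intro!: bexI[OF _ I(2)] simp: std_normal_moments)
  finally show ?thesis .
qed

lemma prob_space_gauss: "prob_space (gauss I s)"
  unfolding gauss_def
  by (intro prob_space.prob_space_distr prob_space_PiM prob_space_std_normal gauss_map_measurable)

lemma sets_gauss [simp]: "sets (gauss I s) = sets (vborel I)" by (simp add: gauss_def)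

lemma gauss_moments:
  assumes I: "finite I" and s: "0 \<le> s" and i: "i \<in> I"
  shows "integrable (gauss I s) (\<lambda>x. (x i)\<^sup>2)" "(\<integral>x. x i \<partial>gauss I s) = 0"
    "(\<integral>x. (x i)\<^sup>2 \<partial>gauss I s) = s"
    "integrable (gauss I s) (\<lambda>x. (x i) ^ 4)" "(\<integral>x. (x i) ^ 4 \<partial>gauss I s) = 3 * s\<^sup>2"
proof -
  have m: "(\<lambda>x. (x i) ^ k) \<in> borel_measurable (vborel I)" for k using i by measurable
  have r: "((\<lambda>i\<in>I. sqrt s * x i) i) ^ k = sqrt s ^ k * x i ^ k" for x :: "_ \<Rightarrow> real" and k
    using i by (simp add: power_mult_distrib)
  have ik: "integrable (gauss I s) (\<lambda>x. (x i) ^ k)" for k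
    unfolding gauss_integral(2)[OF m] r
    by (intro integrable_mult_right PiM_std_normal_integrable I i std_normal_integrable)
  have e: "(\<integral>x. (x i) ^ k \<partial>gauss I s) = sqrt s ^ k * (\<integral>x. x ^ k \<partial>std_normal)" for k
    unfolding gauss_integral(1)[OF m] r
    by (subst integral_mult_right_zero, subst PiM_std_normal_integral[OF I i std_normal_integrable]) simp
  have s4: "sqrt s ^ 4 = s\<^sup>2" using s by (simp add: power4_eq_xxxx power2_eq_square mult.assoc)
  show "integrable (gauss I s) (\<lambda>x. (x i)\<^sup>2)" "integrable (gauss I s) (\<lambda>x. (x i) ^ 4)" by (rule ik)+
  show "(\<integral>x. x i \<partial>gauss I s) = 0" using e[of 1] by (simp add: std_normal_moments)
  show "(\<integral>x. (x i)\<^sup>2 \<partial>gauss I s) = s" using e[of 2] s by (simp add: std_normal_moments)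
  show "(\<integral>x. (x i) ^ 4 \<partial>gauss I s) = 3 * s\<^sup>2" using e[of 4] s4 by (simp add: std_normal_moments)
qed

lemma gauss_cov:
  assumes I: "finite I" and s: "0 \<le> s" and ij: "i \<in> I" "j \<in> I"
  shows "(\<integral>x. x i * x j \<partial>gauss I s) = (if i = j then s else 0)"
proof (cases "i = j")
  case True
  then show ?thesis using gauss_moments(3)[OF I s ij(1)] by (simp add: power2_eq_square)
next
  case False
  have m: "(\<lambda>x. x i * x j) \<in> borel_measurable (vborel I)" using ij by measurable
  have r: "(\<lambda>i\<in>I. sqrt s * x i) i * (\<lambda>i\<in>I. sqrt s * x i) j = s * (x i * x j)" for x :: "_ \<Rightarrow> real"
  proof -
    have "(\<lambda>i\<in>I. sqrt s * x i) i * (\<lambda>i\<in>I. sqrt s * x i) j = (sqrt s * x i) * (sqrt s * x j)"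
      using ij by (simp only: restrict_apply if_True)
    also have "\<dots> = (sqrt s * sqrt s) * (x i * x j)" by (simp only: mult_ac)
    also have "sqrt s * sqrt s = s" using s by simp
    finally show ?thesis .
  qed
  show ?thesis unfolding gauss_integral(1)[OF m] r using PiM_std_normal_mult[OF I ij False] False by simp
qed

lemma L2_law_gauss: "finite I \<Longrightarrow> 0 \<le> s \<Longrightarrow> L2_law I (gauss I s)"
  by (simp add: L2_law_def prob_space_gauss gauss_moments)

lemma char_vec_gauss:
  assumes I: "finite I" and s: "0 \<le> s"
  shows "char_vec I (gauss I s) u = of_real (exp (- s * (\<Sum>i\<in>I. (u i)\<^sup>2) / 2))"
proof -
  interpret std: prob_space std_normal by (rule prob_space_std_normal)
  interpret product_sigma_finite "\<lambda>_. std_normal"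
    by (simp add: product_sigma_finite_def std.sigma_finite_measure_axioms)
  have m: "(\<lambda>x. iexp (\<Sum>i\<in>I. u i * x i)) \<in> borel_measurable (vborel I)" by measurable
  have e: "iexp (\<Sum>i\<in>I. u i * (\<lambda>i\<in>I. sqrt s * x i) i) = (\<Prod>i\<in>I. iexp ((u i * sqrt s) * x i))" for x :: "_ \<Rightarrow> real"
    using I by (simp add: exp_sum[symmetric] sum_distrib_left mult.assoc)
  have i: "integrable std_normal (\<lambda>x. iexp (t * x))" for t by (rule std.integrable_iexp) auto
  have "char_vec I (gauss I s) u = (CLINT x|Pi\<^sub>M I (\<lambda>_. std_normal). \<Prod>i\<in>I. iexp ((u i * sqrt s) * x i))"
    unfolding char_vec_def gauss_integral(1)[OF m] e ..
  also have "\<dots> = (\<Prod>i\<in>I. CLINT x|std_normal. iexp ((u i * sqrt s) * x))"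
    by (rule product_integral_prod[OF I i])
  also have "\<dots> = (\<Prod>i\<in>I. char std_normal (u i * sqrt s))" by (simp only: char_def)
  also have "\<dots> = (\<Prod>i\<in>I. of_real (exp (- (s * (u i)\<^sup>2) / 2)))"
    using s by (simp add: char_std_normal_distribution power_mult_distrib mult.commute)
  also have "\<dots> = of_real (exp (\<Sum>i\<in>I. - (s * (u i)\<^sup>2) / 2))" by (simp only: of_real_prod exp_sum[OF I])
  also have "(\<Sum>i\<in>I. - (s * (u i)\<^sup>2) / 2) = - s * (\<Sum>i\<in>I. (u i)\<^sup>2) / 2"
    by (simp add: sum_negf sum_divide_distrib sum_distrib_left)
  finally show ?thesis .
qed

lemma gauss_eqI:
  assumes "finite I" "0 \<le> s" "prob_space M" "sets M = sets (vborel I)"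
    and "\<And>u. char_vec I M u = of_real (exp (- s * (\<Sum>i\<in>I. (u i)\<^sup>2) / 2))"
  shows "M = gauss I s"
  using assms by (intro char_vec_unique prob_space_gauss) (auto simp: char_vec_gauss)

text \<open>Read off the characteristic functions. It identifies the sum of \<open>k\<close>
  Gaussian summands and splits the wider of two Gaussians in \<open>gauss_smoothing\<close>.\<close>

lemma conv_gauss:
  assumes I: "finite I" and "0 \<le> s" "0 \<le> r"
  shows "conv I (gauss I s) (gauss I r) = gauss I (s + r)"
proof (rule gauss_eqI)
  note L = L2_law_gauss[OF I]
  show "prob_space (conv I (gauss I s) (gauss I r))"
    using L2_law_conv[OF L L] assms by (auto dest: L2_lawD)
  show "char_vec I (conv I (gauss I s) (gauss I r)) u = of_real (exp (- (s + r) * (\<Sum>i\<in>I. (u i)\<^sup>2) / 2))" for u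
    using assms by (simp add: char_vec_conv[OF I L L] char_vec_gauss flip: of_real_mult exp_add)
      (simp add: algebra_simps add_divide_distrib diff_divide_distrib)
qed (use assms in auto)

lemma gauss_0: "gauss I 0 = return (vborel I) (\<lambda>i\<in>I. 0)"
proof -
  interpret prob_space "Pi\<^sub>M I (\<lambda>_. std_normal)" by (intro prob_space_PiM prob_space_std_normal)
  show ?thesis unfolding gauss_def by (simp add: distr_const space_PiM)
qed

text \<open>Once \<open>r\<close> is fixed the bound is free of the dimension. The cube is
  interpolated between the second and fourth powers, and Cauchy-Schwarz over the coordinates reduces
  the fourth power of the norm to one-coordinate moments \<open>3 * s\<^sup>2\<close>; the result is
  \<open>(r ^ 3 + 3 * r ^ 3) / 2\<close>.\<close>

lemma gauss_third_moment:
  assumes I: "finite I" and s: "0 < s" and r: "0 < r" "r\<^sup>2 = real (card I) * s"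
  shows "integrable (gauss I s) (\<lambda>y. (L2_set y I) ^ 3)" "(\<integral>y. (L2_set y I) ^ 3 \<partial>gauss I s) \<le> 2 * r ^ 3"
proof -
  note gm = gauss_moments[OF I less_imp_le[OF s]]
  define d where "d = real (card I)"
  define F where "F y = (r * (\<Sum>i\<in>I. (y i)\<^sup>2) + d / r * (\<Sum>i\<in>I. (y i) ^ 4)) / 2" for y :: "'a \<Rightarrow> real"
  have iF: "integrable (gauss I s) F" unfolding F_def using gm by auto
  have eF: "integral\<^sup>L (gauss I s) F = 2 * r ^ 3"
  proof -
    have "integral\<^sup>L (gauss I s) F = (r * (d * s) + d / r * (d * (3 * s\<^sup>2))) / 2"
      unfolding F_def using gm by (simp add: d_def)
    also have "d / r * (d * (3 * s\<^sup>2)) = 3 * (d * s)\<^sup>2 / r" by (simp add: power2_eq_square)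
    also have "d * s = r\<^sup>2" using r by (simp add: d_def)
    finally show ?thesis using r by (simp add: power2_eq_square power3_eq_cube field_simps)
  qed
  have b: "(L2_set y I) ^ 3 \<le> F y" for y
  proof -
    define n where "n = L2_set y I"
    have n0: "n \<ge> 0" by (simp add: n_def L2_set_nonneg)
    have n2: "n\<^sup>2 = (\<Sum>i\<in>I. (y i)\<^sup>2)" by (simp add: n_def L2_set_sq)
    have "(\<Sum>i\<in>I. 1 * (y i)\<^sup>2)\<^sup>2 \<le> (\<Sum>i\<in>I. 1\<^sup>2) * (\<Sum>i\<in>I. ((y i)\<^sup>2)\<^sup>2)"
      by (rule Cauchy_Schwarz_ineq_sum)
    then have n4: "n ^ 4 \<le> d * (\<Sum>i\<in>I. (y i) ^ 4)"
      by (simp add: n2[symmetric] d_def flip: power_mult)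
    \<comment> \<open>The interpolation is sharp at \<open>n = r\<close>, the root mean square of
      the Gaussian norm.\<close>
    have "0 \<le> n\<^sup>2 * (n - r)\<^sup>2" by simp
    then have "2 * r * n ^ 3 \<le> r\<^sup>2 * n\<^sup>2 + n ^ 4"
      by (simp add: power2_eq_square power3_eq_cube power4_eq_xxxx algebra_simps)
    also have "\<dots> \<le> r\<^sup>2 * n\<^sup>2 + d * (\<Sum>i\<in>I. (y i) ^ 4)" using n4 by simp
    finally have "n ^ 3 \<le> (r\<^sup>2 * n\<^sup>2 + d * (\<Sum>i\<in>I. (y i) ^ 4)) / (2 * r)"
      using r by (simp add: pos_le_divide_eq mult.commute mult.left_commute)
    also have "\<dots> = F y" unfolding F_def n2[symmetric] using r(1) by (simp add: field_simps power2_eq_square)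
    finally show ?thesis by (simp add: n_def)
  qed
  have m: "(\<lambda>y. (L2_set y I) ^ 3) \<in> borel_measurable (gauss I s)"
    unfolding L2_set_def measurable_cong_sets[OF sets_gauss refl] by measurable
  show i: "integrable (gauss I s) (\<lambda>y. (L2_set y I) ^ 3)"
  proof (rule Bochner_Integration.integrable_bound[OF iF m], rule AE_I2)
    fix y show "norm (L2_set y I ^ 3) \<le> norm (F y)"
      using b[of y] L2_set_nonneg[of y I] by simp
  qed
  show "(\<integral>y. (L2_set y I) ^ 3 \<partial>gauss I s) \<le> 2 * r ^ 3"
    unfolding eF[symmetric] by (rule integral_mono[OF i iF b])
qed

text \<open>The Gaussian of larger variance is the other one plus an independent Gaussian carrying
  the difference of the variances, whose second moments sum to that difference times
  \<open>card I\<close>.\<close>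

lemma gauss_smoothing:
  fixes h :: "('i::countable \<Rightarrow> real) \<Rightarrow> real"
  assumes I: "finite I" and h: "h \<in> test_class I" and s: "0 \<le> s" and q: "0 \<le> q" and x: "x \<in> vecs I"
  shows "\<bar>(\<integral>y. h (vadd I x y) \<partial>gauss I s) - (\<integral>y. h (vadd I x y) \<partial>gauss I q)\<bar> \<le> \<bar>s - q\<bar> * real (card I) / 2"
proof -
  have *: "\<bar>(\<integral>y. h (vadd I x y) \<partial>gauss I s) - (\<integral>y. h (vadd I x y) \<partial>gauss I q)\<bar> \<le> \<bar>s - q\<bar> * real (card I) / 2"
    if "0 \<le> q" "q \<le> s" for s q
  proof -
    interpret prob_space "gauss I q" by (rule prob_space_gauss)
    have L: "L2_law I (gauss I (s - q))" "L2_law I (gauss I q)" using that I by (auto intro: L2_law_gauss)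
    have "gauss I s = conv I (gauss I (s - q)) (gauss I q)" using that by (simp add: conv_gauss[OF I])
    then have e: "(\<integral>y. h (vadd I x y) \<partial>gauss I s) = (\<integral>w. \<integral>u. h (vadd I (vadd I x w) u) \<partial>gauss I (s - q) \<partial>gauss I q)"
      using conv_integral2[OF I h L x] by simp
    show ?thesis unfolding e
    proof (rule integral_diff_le[OF conv_integrable2[OF I h L x] test_shift_integrable[OF I h L(2) x]])
      fix w
      have "\<bar>(\<integral>u. h (vadd I (vadd I x w) u) \<partial>gauss I (s - q)) - h (vadd I x w)\<bar>
        \<le> (\<Sum>i\<in>I. \<integral>y. (y i)\<^sup>2 \<partial>gauss I (s - q)) / 2"
        using that by (intro second_order_bound[OF I h L(1)]) (auto simp: gauss_moments[OF I])
      then show "\<bar>(\<integral>u. h (vadd I (vadd I x w) u) \<partial>gauss I (s - q)) - h (vadd I x w)\<bar> \<le> \<bar>s - q\<bar> * real (card I) / 2"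
        using that by (simp add: gauss_moments[OF I] mult.commute)
    qed
  qed
  show ?thesis using *[of q s] *[of s q] s q by (cases "q \<le> s") (auto simp: abs_minus_commute)
qed

lemma char_centred_normal:
  assumes "0 \<le> v"
  shows "char (centred_normal v) t = of_real (exp (- v * t\<^sup>2 / 2))"
proof (cases "v = 0")
  case True
  then show ?thesis by (simp add: centred_normal_def char_def integral_return)
next
  case False
  then have v: "sqrt v > 0" using assms by simp
  interpret std: prob_space std_normal by (rule prob_space_std_normal)
  have "distributed std_normal lborel (\<lambda>x. x) std_normal_density"
    by (auto simp: distributed_def distr_id2)
  from std.normal_density_affine[OF this, of "sqrt v" 0]
  have "distributed std_normal lborel (\<lambda>x. sqrt v * x) (normal_density 0 (sqrt v))" using v by simp
  then have "distr std_normal lborel (\<lambda>x. sqrt v * x) = centred_normal v"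
    using False by (simp add: distributed_def centred_normal_def)
  then have "char (centred_normal v) t = char (distr std_normal lborel (\<lambda>x. sqrt v * x)) t" by simp
  also have "\<dots> = char std_normal (t * sqrt v)"
    unfolding char_def by (subst integral_distr) (auto simp: mult.assoc)
  finally show ?thesis using assms by (simp add: char_std_normal_distribution power_mult_distrib mult.commute)
qed

text \<open>The characteristic function at \<open>u\<close> is that of the scalar combination with
  coefficients \<open>u\<close>, taken at 1, and \<open>centred_gaussian_vector\<close> prescribes
  the law of each such combination.\<close>

lemma distr_centred_gaussian_vector:
  assumes I: "finite I" and v: "0 \<le> v" and Q: "prob_space Q"
    and Z: "centred_gaussian_vector Q I (\<lambda>i j. if i = j then v else 0) Z"
  shows "distr Q (vborel I) Z = gauss I v"
proof (rule gauss_eqI[OF I v])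
  interpret prob_space Q by fact
  have Zm: "Z \<in> Q \<rightarrow>\<^sub>M vborel I" using Z by (simp add: centred_gaussian_vector_def)
  show "prob_space (distr Q (vborel I) Z)" by (rule prob_space_distr[OF Zm])
  fix u :: "'a \<Rightarrow> real"
  have Zi: "(\<lambda>\<omega>. Z \<omega> i) \<in> borel_measurable Q" if "i \<in> I" for i
    using measurable_compose[OF Zm measurable_component_singleton[OF that]] .
  have m: "(\<lambda>x. iexp (\<Sum>i\<in>I. u i * x i)) \<in> borel_measurable (vborel I)" by measurable
  have sm: "(\<lambda>\<omega>. \<Sum>i\<in>I. u i * Z \<omega> i) \<in> borel_measurable Q"
    by (intro borel_measurable_sum borel_measurable_times Zi) auto
  have e: "(\<Sum>i\<in>I. \<Sum>j\<in>I. u i * (if i = j then v else 0) * u j) = v * (\<Sum>i\<in>I. (u i)\<^sup>2)"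
  proof -
    have "(\<Sum>j\<in>I. u i * (if i = j then v else 0) * u j) = v * (u i)\<^sup>2" if "i \<in> I" for i
    proof -
      have "(\<Sum>j\<in>I. u i * (if i = j then v else 0) * u j) = (\<Sum>j\<in>I. if i = j then u i * v * u j else 0)"
        by (intro sum.cong) auto
      then show ?thesis using I that by (simp add: power2_eq_square)
    qed
    then show ?thesis by (simp add: sum_distrib_left)
  qed
  have "char_vec I (distr Q (vborel I) Z) u = (CLINT \<omega>|Q. iexp (\<Sum>i\<in>I. u i * Z \<omega> i))"
    unfolding char_vec_def by (rule integral_distr[OF Zm m])
  also have "\<dots> = char (distr Q borel (\<lambda>\<omega>. \<Sum>i\<in>I. u i * Z \<omega> i)) 1"
    unfolding char_def by (subst integral_distr[OF sm]) auto
  also have "distr Q borel (\<lambda>\<omega>. \<Sum>i\<in>I. u i * Z \<omega> i)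
      = centred_normal (\<Sum>i\<in>I. \<Sum>j\<in>I. u i * (if i = j then v else 0) * u j)"
    using Z unfolding centred_gaussian_vector_def by blast
  also note e
  also have "char (centred_normal (v * (\<Sum>i\<in>I. (u i)\<^sup>2))) 1 = of_real (exp (- v * (\<Sum>i\<in>I. (u i)\<^sup>2) / 2))"
    using v by (subst char_centred_normal) (auto intro!: mult_nonneg_nonneg sum_nonneg)
  finally show "char_vec I (distr Q (vborel I) Z) u = of_real (exp (- v * (\<Sum>i\<in>I. (u i)\<^sup>2) / 2))" .
qed simp

section \<open>Compound Poisson laws\<close>

text \<open>All partial sums live on one sequence space, so that an independent Poisson number can
  select \<open>k\<close> in \<open>compound_law\<close>.\<close>

definition iid_sum :: "'i set \<Rightarrow> ('a \<Rightarrow> 'i \<Rightarrow> real) \<Rightarrow> nat \<Rightarrow> (nat \<Rightarrow> 'a) \<Rightarrow> 'i \<Rightarrow> real" where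
  "iid_sum I f k \<omega> = (\<lambda>i\<in>I. \<Sum>j<k. f (\<omega> j) i)"

definition iid_law :: "'i set \<Rightarrow> 'a measure \<Rightarrow> ('a \<Rightarrow> 'i \<Rightarrow> real) \<Rightarrow> nat \<Rightarrow> ('i \<Rightarrow> real) measure" where
  "iid_law I U f k = distr (Pi\<^sub>M UNIV (\<lambda>_. U)) (vborel I) (iid_sum I f k)"

lemma iid_sum_measurable:
  assumes f[measurable]: "f \<in> U \<rightarrow>\<^sub>M vborel I"
  shows "iid_sum I f k \<in> Pi\<^sub>M UNIV (\<lambda>_. U) \<rightarrow>\<^sub>M vborel I"
proof -
  have "(\<lambda>\<omega>. f (\<omega> j) i) \<in> borel_measurable (Pi\<^sub>M UNIV (\<lambda>_. U))" if "i \<in> I" for i j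
  proof -
    have "(\<lambda>x. f x i) \<in> borel_measurable U"
      using measurable_compose[OF f measurable_component_singleton[OF that]] .
    then show ?thesis by measurable
  qed
  then show ?thesis unfolding iid_sum_def
    by (intro measurable_restrict borel_measurable_sum) auto
qed

lemma iid_law_0:
  assumes U: "prob_space U"
  shows "iid_law I U f 0 = return (vborel I) (\<lambda>i\<in>I. 0)"
proof -
  interpret prob_space "Pi\<^sub>M UNIV (\<lambda>_::nat. U)" by (intro prob_space_PiM U)
  have "iid_sum I f 0 = (\<lambda>_. \<lambda>i\<in>I. 0)" by (auto simp: iid_sum_def)
  then show ?thesis unfolding iid_law_def by (simp add: distr_const space_PiM)
qed

text \<open>An i.i.d. sequence is its first entry followed by an independent copy of itself. The
  head is split off rather than the last summand, as hypothesis \<open>LS\<close> of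
  \<open>lindeberg\<close> has it.\<close>

lemma iid_law_Suc:
  assumes U: "prob_space U" and f: "f \<in> U \<rightarrow>\<^sub>M vborel I"
  shows "iid_law I U f (Suc k) = conv I (distr U (vborel I) f) (iid_law I U f k)"
proof -
  interpret U: prob_space U by fact
  interpret S: sequence_space U by unfold_locales
  note [measurable] = f iid_sum_measurable[OF f]
  interpret L: prob_space "iid_law I U f k"
    unfolding iid_law_def by (intro S.P.prob_space_distr) measurable
  have "iid_law I U f (Suc k) = distr (distr (U \<Otimes>\<^sub>M S.S) S.S (\<lambda>(s, \<omega>). case_nat s \<omega>)) (vborel I) (iid_sum I f (Suc k))"
    unfolding iid_law_def S.PiM_iter ..
  also have "\<dots> = distr (U \<Otimes>\<^sub>M S.S) (vborel I) (\<lambda>p. iid_sum I f (Suc k) (case_nat (fst p) (snd p)))"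
    by (subst distr_distr) (auto simp: comp_def case_prod_unfold)
  also have "\<dots> = distr (U \<Otimes>\<^sub>M S.S) (vborel I) (\<lambda>p. vadd I (f (fst p)) (iid_sum I f k (snd p)))"
    by (rule arg_cong[where f="distr _ _"])
       (auto simp: iid_sum_def vadd_def sum.lessThan_Suc_shift fun_eq_iff simp del: sum.lessThan_Suc)
  also have "\<dots> = distr (distr (U \<Otimes>\<^sub>M S.S) (vborel I \<Otimes>\<^sub>M vborel I) (\<lambda>(x, y). (f x, iid_sum I f k y))) (vborel I) (\<lambda>p. vadd I (fst p) (snd p))"
    by (subst distr_distr) (auto simp: comp_def case_prod_unfold)
  also have "distr (U \<Otimes>\<^sub>M S.S) (vborel I \<Otimes>\<^sub>M vborel I) (\<lambda>(x, y). (f x, iid_sum I f k y)) = distr U (vborel I) f \<Otimes>\<^sub>M iid_law I U f k"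
    unfolding iid_law_def
    by (rule pair_measure_distr[symmetric])
       (auto intro!: prob_space_imp_sigma_finite S.P.prob_space_distr)
  finally show ?thesis by (simp add: conv_def)
qed

lemma L2_law_return_0: "finite I \<Longrightarrow> L2_law I (return (vborel I) (\<lambda>i\<in>I. 0))"
  using L2_law_gauss[of I 0] by (simp add: gauss_0)

lemma L2_law_iid:
  assumes I: "finite I" and U: "prob_space U" and f: "f \<in> U \<rightarrow>\<^sub>M vborel I" and a: "L2_law I (distr U (vborel I) f)"
  shows "L2_law I (iid_law I U f k)"
  by (induction k) (simp_all add: iid_law_0[OF U] iid_law_Suc[OF U f] L2_law_return_0[OF I] L2_law_conv[OF a])

lemma char_vec_return_0: "char_vec I (return (vborel I) (\<lambda>i\<in>I. 0)) u = 1"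
proof -
  have "(\<lambda>x. iexp (\<Sum>i\<in>I. u i * x i)) \<in> borel_measurable (vborel I)" by measurable
  then show ?thesis unfolding char_vec_def by (subst integral_return) (auto simp: space_PiM)
qed

lemma char_vec_iid:
  assumes I: "finite I" and U: "prob_space U" and f: "f \<in> U \<rightarrow>\<^sub>M vborel I" and a: "L2_law I (distr U (vborel I) f)"
  shows "char_vec I (iid_law I U f k) u = char_vec I (distr U (vborel I) f) u ^ k"
  by (induction k)
     (simp_all add: iid_law_0[OF U] iid_law_Suc[OF U f] char_vec_return_0 char_vec_conv[OF I a L2_law_iid[OF I U f a]])

definition compound_law :: "'i set \<Rightarrow> real \<Rightarrow> 'a measure \<Rightarrow> ('a \<Rightarrow> 'i \<Rightarrow> real) \<Rightarrow> ('i \<Rightarrow> real) measure" where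
  "compound_law I \<Lambda> U f = distr (poisson_dist \<Lambda> \<Otimes>\<^sub>M Pi\<^sub>M UNIV (\<lambda>_. U)) (vborel I) (\<lambda>p. iid_sum I f (fst p) (snd p))"

context
  fixes I :: "'i set" and \<Lambda> :: real and U :: "'a measure" and f :: "'a \<Rightarrow> 'i \<Rightarrow> real" and r :: real
  assumes I: "finite I" and \<Lambda>: "0 < \<Lambda>" and U: "prob_space U" and f: "f \<in> U \<rightarrow>\<^sub>M vborel I"
    and bd: "\<And>z i. z \<in> space U \<Longrightarrow> i \<in> I \<Longrightarrow> \<bar>f z i\<bar> \<le> r"
begin

interpretation U: prob_space U by (rule U)
interpretation S: sequence_space U by unfold_locales
interpretation Po: prob_space "poisson_dist \<Lambda>" using \<Lambda> by (intro prob_space_poisson) simp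
interpretation PS: pair_prob_space "poisson_dist \<Lambda>" S.S ..

lemma compound_map_measurable:
  "(\<lambda>p. iid_sum I f (fst p) (snd p)) \<in> poisson_dist \<Lambda> \<Otimes>\<^sub>M S.S \<rightarrow>\<^sub>M vborel I"
proof -
  have "sets (poisson_dist \<Lambda> \<Otimes>\<^sub>M S.S) = sets (count_space UNIV \<Otimes>\<^sub>M S.S)"
    by (intro sets_pair_measure_cong) (simp_all add: poisson_dist_def)
  then show ?thesis unfolding measurable_cong_sets[OF _ refl]
    by (subst measurable_cong_sets[OF _ refl], assumption)
       (intro measurable_pair_measure_countable1, auto intro: iid_sum_measurable[OF f])
qed

lemma L2_law_summand: "L2_law I (distr U (vborel I) f)"
proof -
  have "integrable (distr U (vborel I) f) (\<lambda>x. (x i)\<^sup>2)" if i: "i \<in> I" for i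
  proof -
    have m: "(\<lambda>x. (x i)\<^sup>2) \<in> borel_measurable (vborel I)" using i by measurable
    have "integrable U (\<lambda>z. (f z i)\<^sup>2)"
    proof (rule U.integrable_const_bound[where B="r\<^sup>2"])
      show "AE z in U. norm ((f z i)\<^sup>2) \<le> r\<^sup>2"
        using bd[OF _ i] by (intro AE_I2) (simp add: abs_le_square_iff[symmetric] order_trans[OF _ abs_ge_self])
      show "(\<lambda>z. (f z i)\<^sup>2) \<in> borel_measurable U" by (rule measurable_compose[OF f m])
    qed
    then show ?thesis by (subst integrable_distr_eq[OF f m])
  qed
  then show ?thesis by (simp add: L2_law_def U.prob_space_distr[OF f])
qed

text \<open>The coordinates of a sum of \<open>k\<close> jumps are at most \<open>r * real k\<close>
  in absolute value, and the Poisson law has a second moment.\<close>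

lemma L2_law_compound: "L2_law I (compound_law I \<Lambda> U f)"
proof -
  note m = compound_map_measurable
  have "integrable (compound_law I \<Lambda> U f) (\<lambda>x. (x i)\<^sup>2)" if i: "i \<in> I" for i
  proof -
    have mi: "(\<lambda>x. (x i)\<^sup>2) \<in> borel_measurable (vborel I)" using i by measurable
    have "integrable (poisson_dist \<Lambda> \<Otimes>\<^sub>M S.S) (\<lambda>p. r\<^sup>2 * (real (fst p))\<^sup>2)"
      using integrable_pair_mult[OF Po.sigma_finite_measure_axioms S.P.sigma_finite_measure_axioms poisson_moments(3)[OF less_imp_le[OF \<Lambda>]], of "\<lambda>_. 1"]
      by simp
    then have "integrable (poisson_dist \<Lambda> \<Otimes>\<^sub>M S.S) (\<lambda>p. (iid_sum I f (fst p) (snd p) i)\<^sup>2)"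
    proof (rule Bochner_Integration.integrable_bound)
      show "(\<lambda>p. (iid_sum I f (fst p) (snd p) i)\<^sup>2) \<in> borel_measurable (poisson_dist \<Lambda> \<Otimes>\<^sub>M S.S)"
        by (rule measurable_compose[OF m mi])
      show "AE p in poisson_dist \<Lambda> \<Otimes>\<^sub>M S.S. norm ((iid_sum I f (fst p) (snd p) i)\<^sup>2) \<le> norm (r\<^sup>2 * (real (fst p))\<^sup>2)"
      proof (rule AE_I2)
        fix p assume "p \<in> space (poisson_dist \<Lambda> \<Otimes>\<^sub>M S.S)"
        then have "snd p j \<in> space U" for j by (auto simp: space_pair_measure space_PiM)
        then have "(\<Sum>j<fst p. \<bar>f (snd p j) i\<bar>) \<le> (\<Sum>j<fst p. r)"
          using i bd by (intro sum_mono) auto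
        then have "\<bar>iid_sum I f (fst p) (snd p) i\<bar> \<le> (\<Sum>j<fst p. r)"
          using i sum_abs[of "\<lambda>j. f (snd p j) i" "{..<fst p}"] unfolding iid_sum_def by (simp only: restrict_apply if_True)
        also have "\<dots> = \<bar>r * real (fst p)\<bar>"
        proof -
          obtain z where "z \<in> space U" using U.not_empty by auto
          then have "0 \<le> r" using bd[OF _ i] abs_ge_zero order_trans by blast
          then show ?thesis by (simp add: abs_mult)
        qed
        finally show "norm ((iid_sum I f (fst p) (snd p) i)\<^sup>2) \<le> norm (r\<^sup>2 * (real (fst p))\<^sup>2)"
          by (simp add: abs_le_square_iff flip: power_mult_distrib)
      qed
    qed
    then show ?thesis unfolding compound_law_def by (subst integrable_distr_eq[OF m mi])
  qed
  then show ?thesis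
    unfolding L2_law_def by (auto simp: compound_law_def intro!: PS.prob_space_distr m)
qed

text \<open>Given \<open>k\<close> this is a \<open>k\<close>-th power, averaged by the Poisson
  generating function. The result has the form of \<open>char_total\<close>, which is how the two
  constructions will be identified.\<close>

lemma char_vec_compound:
  "char_vec I (compound_law I \<Lambda> U f) u = exp (of_real \<Lambda> * (char_vec I (distr U (vborel I) f) u - 1))"
proof -
  note m = compound_map_measurable
  have e: "(\<lambda>x. iexp (\<Sum>i\<in>I. u i * x i)) \<in> borel_measurable (vborel I)" by measurable
  have *: "integrable (poisson_dist \<Lambda> \<Otimes>\<^sub>M S.S) (\<lambda>(k, \<omega>). iexp (\<Sum>i\<in>I. u i * iid_sum I f k \<omega> i))"
    by (rule PS.integrable_const_bound[where B=1])
       (use measurable_compose[OF m e] in \<open>auto simp: case_prod_unfold\<close>)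
  have "char_vec I (compound_law I \<Lambda> U f) u = (CLINT p|poisson_dist \<Lambda> \<Otimes>\<^sub>M S.S. iexp (\<Sum>i\<in>I. u i * iid_sum I f (fst p) (snd p) i))"
    unfolding char_vec_def compound_law_def by (rule integral_distr[OF m e])
  also have "\<dots> = (CLINT k|poisson_dist \<Lambda>. CLINT \<omega>|S.S. iexp (\<Sum>i\<in>I. u i * iid_sum I f k \<omega> i))"
    using PS.integral_fst[OF *] by (simp only: case_prod_unfold)
  also have "\<dots> = (CLINT k|poisson_dist \<Lambda>. char_vec I (iid_law I U f k) u)"
    unfolding char_vec_def iid_law_def by (subst integral_distr[OF iid_sum_measurable[OF f] e]) simp
  also have "\<dots> = exp (of_real \<Lambda> * (char_vec I (distr U (vborel I) f) u - 1))"
    using \<Lambda> by (simp add: char_vec_iid[OF I U f L2_law_summand] integral_poisson_power)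
  finally show ?thesis .
qed

lemma compound_integral:
  fixes h :: "('i \<Rightarrow> real) \<Rightarrow> real"
  assumes hm: "h \<in> borel_measurable (vborel I)" and ih: "integrable (compound_law I \<Lambda> U f) h"
  shows "integral\<^sup>L (compound_law I \<Lambda> U f) h = (\<integral>k. integral\<^sup>L (iid_law I U f k) h \<partial>poisson_dist \<Lambda>)"
    and "integrable (poisson_dist \<Lambda>) (\<lambda>k. integral\<^sup>L (iid_law I U f k) h)"
proof -
  note m = compound_map_measurable
  have *: "integrable (poisson_dist \<Lambda> \<Otimes>\<^sub>M S.S) (\<lambda>(k, \<omega>). h (iid_sum I f k \<omega>))"
    using ih unfolding compound_law_def by (subst (asm) integrable_distr_eq[OF m hm]) (simp add: case_prod_unfold)
  have e: "integral\<^sup>L (iid_law I U f k) h = (\<integral>\<omega>. h (iid_sum I f k \<omega>) \<partial>S.S)" for k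
    unfolding iid_law_def by (rule integral_distr[OF iid_sum_measurable[OF f] hm])
  have "integral\<^sup>L (compound_law I \<Lambda> U f) h = (\<integral>p. h (iid_sum I f (fst p) (snd p)) \<partial>(poisson_dist \<Lambda> \<Otimes>\<^sub>M S.S))"
    unfolding compound_law_def by (rule integral_distr[OF m hm])
  then show "integral\<^sup>L (compound_law I \<Lambda> U f) h = (\<integral>k. integral\<^sup>L (iid_law I U f k) h \<partial>poisson_dist \<Lambda>)"
    unfolding e using PS.integral_fst[OF *] by (simp add: case_prod_unfold)
  show "integrable (poisson_dist \<Lambda>) (\<lambda>k. integral\<^sup>L (iid_law I U f k) h)"
    unfolding e using PS.integrable_fst[OF *] .
qed

end

text \<open>The intermediate law is \<open>gauss I (real k * v)\<close>: given \<open>k\<close> it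
  differs from the sum by Lindeberg's exchange and from the target by its variance alone. The two
  errors are averaged over \<open>k\<close>, whose mean is \<Lambda> and whose mean absolute
  deviation is at most sqrt \<Lambda>.\<close>

theorem compound_gauss_bound:
  fixes h :: "('i::countable \<Rightarrow> real) \<Rightarrow> real"
  assumes I: "finite I" and \<Lambda>: "0 < \<Lambda>" and U: "prob_space U" and f: "f \<in> U \<rightarrow>\<^sub>M vborel I"
    and r: "0 < r" and norm: "\<And>z. z \<in> space U \<Longrightarrow> L2_set (f z) I = r"
    and mean: "\<And>i. i \<in> I \<Longrightarrow> (\<integral>z. f z i \<partial>U) = 0"
    and cov: "\<And>i j. i \<in> I \<Longrightarrow> j \<in> I \<Longrightarrow> (\<integral>z. f z i * f z j \<partial>U) = (if i = j then v else 0)"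
    and v: "real (card I) * v = r\<^sup>2"
    and h: "h \<in> test_class I"
  shows "\<bar>integral\<^sup>L (compound_law I \<Lambda> U f) h - integral\<^sup>L (gauss I (\<Lambda> * v)) h\<bar> \<le> (\<Lambda> * r ^ 3 + sqrt \<Lambda> * r\<^sup>2) / 2"
proof -
  interpret U: prob_space U by fact
  interpret Po: prob_space "poisson_dist \<Lambda>" using \<Lambda> by (intro prob_space_poisson) simp
  have bd: "\<bar>f z i\<bar> \<le> r" if "z \<in> space U" "i \<in> I" for z i
  proof -
    have "\<bar>f z i\<bar>\<^sup>2 \<le> (L2_set (f z) I)\<^sup>2"
      unfolding L2_set_sq using member_le_sum[of i I "\<lambda>i. (f z i)\<^sup>2"] that I by simp
    then show ?thesis unfolding norm[OF that(1)] using r by (simp add: power2_le_iff_abs_le)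
  qed
  have v0: "0 < v"
  proof -
    have "0 < real (card I) * v" unfolding v using r by simp
    then show ?thesis by (simp add: zero_less_mult_iff)
  qed
  define a where "a = distr U (vborel I) f"
  have a: "L2_law I a" unfolding a_def by (rule L2_law_summand[OF I \<Lambda> U f bd])
  have g: "L2_law I (gauss I v)" using L2_law_gauss[OF I] v0 by simp
  \<comment> \<open>The convolution lemmas carry a shift; the origin as shift recovers plain
    integrals.\<close>
  define z0 where "z0 = (\<lambda>i\<in>I. 0 :: real)"
  have z0: "z0 \<in> vecs I" "vadd I z0 x = x" if "x \<in> vecs I" for x
    using that by (auto simp: z0_def vadd_def PiE_iff extensional_def fun_eq_iff)
  have h0: "(\<integral>y. h (vadd I z0 y) \<partial>M) = integral\<^sup>L M h" if "L2_law I M" for M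
    by (rule Bochner_Integration.integral_cong) (auto simp: z0 space_L2_law[OF that])
  \<comment> \<open>Both laws are compared with the same second-order value \<open>c\<close>. The
    jumps have norm exactly \<open>r\<close> and cost \<open>r ^ 3 / 6\<close>, the Gaussian costs
    at most \<open>2 * r ^ 3 / 6\<close>.\<close>
  have step: "\<bar>(\<integral>u. h (vadd I x u) \<partial>a) - (\<integral>u. h (vadd I x u) \<partial>gauss I v)\<bar> \<le> r ^ 3 / 2" if x: "x \<in> vecs I" for x
  proof -
    define c where "c = h x + (\<Sum>i\<in>I. partials [i, i] h x * v) / 2"
    have ai: "integral\<^sup>L a G = (\<integral>z. G (f z) \<partial>U)" if "G \<in> borel_measurable (vborel I)" for G :: "_ \<Rightarrow> real"
      unfolding a_def by (rule integral_distr[OF f that])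
    have m3: "(\<lambda>y. L2_set y I ^ 3) \<in> borel_measurable (vborel I)" unfolding L2_set_def by measurable
    have "\<bar>(\<integral>u. h (vadd I x u) \<partial>a) - c\<bar> \<le> (\<integral>y. L2_set y I ^ 3 \<partial>a) / 6"
      unfolding c_def
    proof (rule third_order_bound[OF I h a x])
      show "(\<integral>y. y i \<partial>a) = 0" if "i \<in> I" for i using that mean by (subst ai) auto
      show "(\<integral>y. y i * y j \<partial>a) = (if i = j then v else 0)" if "i \<in> I" "j \<in> I" for i j
        using that cov by (subst ai) auto
      have "integrable U (\<lambda>z. L2_set (f z) I ^ 3)"
        by (rule iffD1[OF Bochner_Integration.integrable_cong[OF refl], of _ "\<lambda>_. r ^ 3"]) (simp_all add: norm)
      then show "integrable a (\<lambda>y. L2_set y I ^ 3)" unfolding a_def by (subst integrable_distr_eq[OF f m3])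
    qed
    also have "(\<integral>y. L2_set y I ^ 3 \<partial>a) = (\<integral>z. r ^ 3 \<partial>U)"
      unfolding ai[OF m3] by (intro Bochner_Integration.integral_cong refl) (simp add: norm)
    finally have A: "\<bar>(\<integral>u. h (vadd I x u) \<partial>a) - c\<bar> \<le> r ^ 3 / 6" by (simp add: U.prob_space)
    note t = gauss_third_moment[OF I v0 r v[symmetric]]
    have "\<bar>(\<integral>u. h (vadd I x u) \<partial>gauss I v) - c\<bar> \<le> (\<integral>y. L2_set y I ^ 3 \<partial>gauss I v) / 6"
      unfolding c_def using v0
      by (intro third_order_bound[OF I h g x] t) (simp_all add: gauss_moments[OF I] gauss_cov[OF I])
    then have "\<bar>(\<integral>u. h (vadd I x u) \<partial>gauss I v) - c\<bar> \<le> 2 * r ^ 3 / 6" using t(2) by simp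
    with A show ?thesis by linarith
  qed
  have L: "L2_law I (iid_law I U f k)" for k by (rule L2_law_iid[OF I U f a[unfolded a_def]])
  have G: "L2_law I (gauss I (real k * v))" for k using L2_law_gauss[OF I] v0 by simp
  have k: "\<bar>integral\<^sup>L (iid_law I U f k) h - integral\<^sup>L (gauss I (real k * v)) h\<bar> \<le> real k * (r ^ 3 / 2)" for k
    unfolding h0[OF L, symmetric] h0[OF G, symmetric]
  proof (rule lindeberg[OF I h a g L G _ _ _ step])
    show "iid_law I U f 0 = gauss I (real 0 * v)" by (simp add: iid_law_0[OF U] gauss_0)
    show "iid_law I U f (Suc k) = conv I a (iid_law I U f k)" for k unfolding a_def by (rule iid_law_Suc[OF U f])
    show "gauss I (real (Suc k) * v) = conv I (gauss I v) (gauss I (real k * v))" for k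
      using v0 by (subst conv_gauss[OF I]) (auto simp: algebra_simps)
    show "z0 \<in> vecs I" by (simp add: z0_def)
  qed
  have s: "\<bar>integral\<^sup>L (gauss I (real k * v)) h - integral\<^sup>L (gauss I (\<Lambda> * v)) h\<bar> \<le> \<bar>real k - \<Lambda>\<bar> * (r\<^sup>2 / 2)" for k
  proof -
    have "L2_law I (gauss I (\<Lambda> * v))" using L2_law_gauss[OF I] v0 \<Lambda> by simp
    then have "\<bar>integral\<^sup>L (gauss I (real k * v)) h - integral\<^sup>L (gauss I (\<Lambda> * v)) h\<bar> \<le> \<bar>real k * v - \<Lambda> * v\<bar> * real (card I) / 2"
      using gauss_smoothing[OF I h, of "real k * v" "\<Lambda> * v" z0] v0 \<Lambda> h0[OF G, of k] h0
      by (simp add: z0_def)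
    \<comment> \<open>The trace \<open>real (card I) * v\<close> equals \<open>r\<^sup>2\<close>,
      which removes the dimension.\<close>
    also have "\<bar>real k * v - \<Lambda> * v\<bar> * real (card I) / 2 = \<bar>real k - \<Lambda>\<bar> * (real (card I) * v / 2)"
      using v0 by (simp add: abs_mult flip: left_diff_distrib)
    finally show ?thesis by (simp only: v)
  qed
  have hm: "h \<in> borel_measurable (vborel I)" by (rule test_class_measurable[OF h])
  have cL: "L2_law I (compound_law I \<Lambda> U f)" by (rule L2_law_compound[OF I \<Lambda> U f bd])
  have ih: "integrable (compound_law I \<Lambda> U f) h"
    using test_shift_integrable[OF I h cL, of z0]
    by (rule iffD1[OF Bochner_Integration.integrable_cong[OF refl], rotated])
       (auto simp: z0 space_L2_law[OF cL], simp add: z0_def)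
  note c = compound_integral[OF I \<Lambda> U f bd hm ih]
  let ?g = "integral\<^sup>L (gauss I (\<Lambda> * v)) h"
  have "\<bar>integral\<^sup>L (compound_law I \<Lambda> U f) h - ?g\<bar> = \<bar>\<integral>k. integral\<^sup>L (iid_law I U f k) h - ?g \<partial>poisson_dist \<Lambda>\<bar>"
    using c by (simp add: Po.prob_space)
  also have "\<dots> \<le> (\<integral>k. \<bar>integral\<^sup>L (iid_law I U f k) h - ?g\<bar> \<partial>poisson_dist \<Lambda>)" by (rule integral_abs_bound)
  also have "\<dots> \<le> (\<integral>k. real k * (r ^ 3 / 2) + \<bar>real k - \<Lambda>\<bar> * (r\<^sup>2 / 2) \<partial>poisson_dist \<Lambda>)"
  proof (rule integral_mono)
    show "integrable (poisson_dist \<Lambda>) (\<lambda>k. \<bar>integral\<^sup>L (iid_law I U f k) h - ?g\<bar>)" using c by simp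
    show "integrable (poisson_dist \<Lambda>) (\<lambda>k. real k * (r ^ 3 / 2) + \<bar>real k - \<Lambda>\<bar> * (r\<^sup>2 / 2))"
      using poisson_moments(1)[of \<Lambda>] poisson_abs_deviation(1)[OF \<Lambda>] \<Lambda> by simp
    show "\<bar>integral\<^sup>L (iid_law I U f n) h - ?g\<bar> \<le> real n * (r ^ 3 / 2) + \<bar>real n - \<Lambda>\<bar> * (r\<^sup>2 / 2)" for n
      using k[of n] s[of n] by linarith
  qed
  also have "\<dots> = \<Lambda> * (r ^ 3 / 2) + (\<integral>k. \<bar>real k - \<Lambda>\<bar> \<partial>poisson_dist \<Lambda>) * (r\<^sup>2 / 2)"
    using poisson_moments(1,2)[of \<Lambda>] poisson_abs_deviation(1)[OF \<Lambda>] \<Lambda> by simp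
  also have "\<dots> \<le> \<Lambda> * (r ^ 3 / 2) + sqrt \<Lambda> * (r\<^sup>2 / 2)"
    using poisson_abs_deviation(2)[OF \<Lambda>] by (intro add_left_mono mult_right_mono) auto
  finally show ?thesis by (simp add: add_divide_distrib)
qed

section \<open>From the Poisson random measure to a compound Poisson vector\<close>

lemma scale_measure_eq_density: "scale_measure c M = density M (\<lambda>_. c)"
  by (rule measure_eqI) (simp_all add: emeasure_density nn_integral_cmult_indicator)

lemma integral_const_density:
  fixes g :: "'a \<Rightarrow> 'b::{banach, second_countable_topology}"
  assumes "0 \<le> c" "g \<in> borel_measurable M"
  shows "integral\<^sup>L (density M (\<lambda>_. ennreal c)) g = c *\<^sub>R integral\<^sup>L M g"
  using assms by (subst integral_density) auto

text \<open>A typical jump is \<open>f\<close> at a point drawn from the normalised intensity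
  \<open>U\<close>. The vector of totals has the compound law because the characteristic functions
  agree, so the order of the points never enters.\<close>

theorem (in charged_poisson) poisson_gauss_bound:
  fixes f :: "'a \<Rightarrow> 'i::countable \<Rightarrow> real" and Z :: "'z \<Rightarrow> 'i \<Rightarrow> real"
  assumes I: "finite I" and pos: "0 < measure \<mu> (space \<mu>)"
    and f: "\<And>i. i \<in> I \<Longrightarrow> (\<lambda>z. f z i) \<in> borel_measurable \<mu>"
    and r: "0 < r" and norm: "\<And>z. z \<in> space \<mu> \<Longrightarrow> (\<Sum>i\<in>I. (f z i)\<^sup>2) = r\<^sup>2"
    and mean: "\<And>i. i \<in> I \<Longrightarrow> (\<integral>z. f z i \<partial>\<mu>) = 0"
    and cov: "\<And>i j. i \<in> I \<Longrightarrow> j \<in> I \<Longrightarrow> (\<integral>z. f z i * f z j \<partial>\<mu>) = (if i = j then \<sigma> else 0)"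
    and Q: "prob_space Q" and Z: "centred_gaussian_vector Q I (\<lambda>i j. if i = j then \<sigma> else 0) Z"
    and h: "h \<in> test_class I"
  shows "\<bar>(\<integral>\<omega>. h (\<lambda>i\<in>I. total (\<lambda>z. f z i) \<omega>) \<partial>P) - (\<integral>\<omega>. h (Z \<omega>) \<partial>Q)\<bar>
    \<le> (measure \<mu> (space \<mu>) * r ^ 3 + sqrt (measure \<mu> (space \<mu>)) * r\<^sup>2) / 2"
proof -
  define \<Lambda> where "\<Lambda> = measure \<mu> (space \<mu>)"
  have \<Lambda>: "0 < \<Lambda>" using pos by (simp add: \<Lambda>_def)
  define U where "U = density \<mu> (\<lambda>_. ennreal (1 / \<Lambda>))"
  have sU: "space U = space \<mu>" "sets U = sets \<mu>" by (simp_all add: U_def)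
  have iU: "integral\<^sup>L U g = (1 / \<Lambda>) *\<^sub>R integral\<^sup>L \<mu> g" if "g \<in> borel_measurable \<mu>"
    for g :: "'a \<Rightarrow> 'b::{banach, second_countable_topology}"
    unfolding U_def using \<Lambda> that by (intro integral_const_density) auto
  have U: "prob_space U"
  proof
    have "emeasure U (space U) = ennreal (1 / \<Lambda>) * ennreal \<Lambda>"
      unfolding U_def by (simp add: emeasure_density nn_integral_cmult_indicator \<mu>.emeasure_eq_measure \<Lambda>_def)
    also have "\<dots> = ennreal (1 / \<Lambda> * \<Lambda>)" using \<Lambda> by (subst ennreal_mult) auto
    finally show "emeasure U (space U) = 1" using \<Lambda> by simp
  qed
  interpret U: prob_space U by (rule U)
  define F where "F z = (\<lambda>i\<in>I. f z i)" for z
  have F\<mu>: "F \<in> \<mu> \<rightarrow>\<^sub>M vborel I" unfolding F_def by (intro measurable_restrict f)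
  then have F: "F \<in> U \<rightarrow>\<^sub>M vborel I" unfolding measurable_cong_sets[OF sU(2) refl] .
  define v where "v = \<sigma> / \<Lambda>"
  \<comment> \<open>Integrating the constant squared norm gives the trace of the covariance. This
    yields both \<open>0 < \<sigma>\<close> and the relation between \<open>v\<close> and
    \<open>r\<close>.\<close>
  have \<sigma>: "real (card I) * \<sigma> = \<Lambda> * r\<^sup>2"
  proof -
    have i: "integrable \<mu> (\<lambda>z. (f z i)\<^sup>2)" if "i \<in> I" for i
    proof (rule \<mu>.integrable_const_bound[where B="r\<^sup>2"])
      show "AE z in \<mu>. norm ((f z i)\<^sup>2) \<le> r\<^sup>2"
      proof (rule AE_I2)
        fix z assume "z \<in> space \<mu>"
        from norm[OF this] show "norm ((f z i)\<^sup>2) \<le> r\<^sup>2"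
          using member_le_sum[of i I "\<lambda>i. (f z i)\<^sup>2"] that I by simp
      qed
    qed (use f[OF that] in measurable)
    have "real (card I) * \<sigma> = (\<Sum>i\<in>I. \<integral>z. (f z i)\<^sup>2 \<partial>\<mu>)"
      using cov by (simp add: power2_eq_square)
    also have "\<dots> = (\<integral>z. (\<Sum>i\<in>I. (f z i)\<^sup>2) \<partial>\<mu>)" using i by simp
    also have "\<dots> = (\<integral>z. r\<^sup>2 \<partial>\<mu>)" by (intro Bochner_Integration.integral_cong refl norm)
    finally show ?thesis by (simp add: \<Lambda>_def)
  qed
  have "0 < real (card I) * \<sigma>" unfolding \<sigma> using \<Lambda> r by simp
  then have \<sigma>0: "0 < \<sigma>" by (simp add: zero_less_mult_iff)
  have main: "\<bar>integral\<^sup>L (compound_law I \<Lambda> U F) h - integral\<^sup>L (gauss I (\<Lambda> * v)) h\<bar> \<le> (\<Lambda> * r ^ 3 + sqrt \<Lambda> * r\<^sup>2) / 2"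
  proof (rule compound_gauss_bound[OF I \<Lambda> U F r _ _ _ _ h])
    show "L2_set (F z) I = r" if "z \<in> space U" for z
    proof -
      have "L2_set (F z) I = L2_set (f z) I" by (rule L2_set_cong) (auto simp: F_def)
      then show ?thesis using norm[of z] that r sU by (simp add: L2_set_def)
    qed
    show "(\<integral>z. F z i \<partial>U) = 0" if "i \<in> I" for i
      using that mean f by (simp add: F_def iU)
    show "(\<integral>z. F z i * F z j \<partial>U) = (if i = j then v else 0)" if "i \<in> I" "j \<in> I" for i j
      using that cov f by (simp add: F_def iU v_def)
    show "real (card I) * v = r\<^sup>2" using \<sigma> \<Lambda> by (simp add: v_def)
  qed
  have bd: "\<bar>F z i\<bar> \<le> r" if "z \<in> space U" "i \<in> I" for z i
  proof -
    have "(f z i)\<^sup>2 \<le> r\<^sup>2" using norm[of z] member_le_sum[of i I "\<lambda>i. (f z i)\<^sup>2"] that I sU by simp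
    then show ?thesis using r that by (simp add: F_def power2_le_iff_abs_le)
  qed
  let ?V = "\<lambda>\<omega>. \<lambda>i\<in>I. total (\<lambda>z. f z i) \<omega>"
  have Vm: "?V \<in> P \<rightarrow>\<^sub>M vborel I" by (intro measurable_restrict total_measurable f)
  have law: "distr P (vborel I) ?V = compound_law I \<Lambda> U F"
  proof (rule char_vec_unique[OF I])
    show "prob_space (distr P (vborel I) ?V)" by (rule P.prob_space_distr[OF Vm])
    note L = L2_law_compound[OF I \<Lambda> U F bd]
    show "prob_space (compound_law I \<Lambda> U F)" "sets (compound_law I \<Lambda> U F) = sets (vborel I)"
      using L2_lawD[OF L] by auto
    fix u :: "'i \<Rightarrow> real"
    define G where "G z = (\<Sum>i\<in>I. u i * f z i)" for z
    have G [measurable]: "G \<in> borel_measurable \<mu>"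
      unfolding G_def by (intro borel_measurable_sum borel_measurable_times f) auto
    have e: "(\<lambda>x. iexp (\<Sum>i\<in>I. u i * x i)) \<in> borel_measurable (vborel I)" by measurable
    have t: "(\<Sum>i\<in>I. u i * ?V \<omega> i) = total G \<omega>" for \<omega>
    proof -
      have "(\<Sum>i\<in>I. u i * ?V \<omega> i) = (\<Sum>i\<in>I. \<Sum>k=1..K \<omega>. u i * f (\<xi> k \<omega>) i)"
        by (simp add: total_def sum_distrib_left)
      also have "\<dots> = total G \<omega>" unfolding total_def G_def by (rule sum.swap)
      finally show ?thesis .
    qed
    have ie: "integrable \<mu> (\<lambda>z. iexp (G z))"
      by (rule \<mu>.integrable_const_bound[where B=1]) auto
    have "char_vec I (distr U (vborel I) F) u = (CLINT z|U. iexp (\<Sum>i\<in>I. u i * F z i))"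
      unfolding char_vec_def by (rule integral_distr[OF F e])
    also have "\<dots> = (CLINT z|U. iexp (G z))" by (simp add: F_def G_def)
    also have "\<dots> = (1 / \<Lambda>) *\<^sub>R (CLINT z|\<mu>. iexp (G z))" by (rule iU) measurable
    finally have c: "of_real \<Lambda> * (char_vec I (distr U (vborel I) F) u - 1) = (CLINT z|\<mu>. iexp (G z)) - of_real \<Lambda>"
      using \<Lambda> by (simp add: scaleR_conv_of_real right_diff_distrib)
    have "char_vec I (distr P (vborel I) ?V) u = (CLINT \<omega>|P. iexp (total G \<omega>))"
      unfolding char_vec_def by (subst integral_distr[OF Vm e]) (simp only: t)
    also have "\<dots> = exp (CLINT z|\<mu>. iexp (G z) - 1)" by (rule char_total[OF G])
    also have "(CLINT z|\<mu>. iexp (G z) - 1) = (CLINT z|\<mu>. iexp (G z)) - of_real \<Lambda>"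
      using ie by (simp add: \<Lambda>_def scaleR_conv_of_real)
    also have "\<dots> = of_real \<Lambda> * (char_vec I (distr U (vborel I) F) u - 1)" by (rule c[symmetric])
    also have "exp \<dots> = char_vec I (compound_law I \<Lambda> U F) u"
      by (rule char_vec_compound[OF I \<Lambda> U F bd, symmetric])
    finally show "char_vec I (distr P (vborel I) ?V) u = char_vec I (compound_law I \<Lambda> U F) u" .
  qed simp
  note hm = test_class_measurable[OF h]
  have "(\<integral>\<omega>. h (?V \<omega>) \<partial>P) = integral\<^sup>L (compound_law I \<Lambda> U F) h"
    unfolding law[symmetric] by (rule integral_distr[OF Vm hm, symmetric])
  moreover have "(\<integral>\<omega>. h (Z \<omega>) \<partial>Q) = integral\<^sup>L (gauss I (\<Lambda> * v)) h"
  proof -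
    have "\<Lambda> * v = \<sigma>" using \<Lambda> by (simp add: v_def)
    moreover have "Z \<in> Q \<rightarrow>\<^sub>M vborel I" using Z by (simp add: centred_gaussian_vector_def)
    ultimately show ?thesis
      using distr_centred_gaussian_vector[OF I less_imp_le[OF \<sigma>0] Q Z] integral_distr[OF _ hm, of Z Q] by simp
  qed
  ultimately show ?thesis using main by (simp add: \<Lambda>_def)
qed

section \<open>Legendre polynomials\<close>

text \<open>By Leibniz' rule, at the root \<open>a\<close> only the term with all \<open>n\<close>
  derivatives on the power survives. Applied to the factor \<open>[:- 1, 1:] ^ l\<close> in
  Rodrigues' formula it evaluates \<open>legendre l\<close> at 1.\<close>

lemma pderiv_power_at_root:
  fixes r :: "real poly"
  shows "poly ((pderiv ^^ n) ([:- a, 1:] ^ n * r)) a = fact n * poly r a"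
proof (induction n arbitrary: r)
  case (Suc n)
  have "pderiv ([:- a, 1:] ^ Suc n * r) = [:- a, 1:] ^ n * (smult (real (Suc n)) r + [:- a, 1:] * pderiv r)"
    by (simp only: pderiv_mult pderiv_power_Suc) (simp add: pderiv_pCons algebra_simps)
  then have "poly ((pderiv ^^ Suc n) ([:- a, 1:] ^ Suc n * r)) a
      = fact n * poly (smult (real (Suc n)) r + [:- a, 1:] * pderiv r) a"
    by (simp only: funpow_Suc_right o_def Suc.IH)
  then show ?case by simp
qed simp

lemma legendre_at_1: "poly (legendre l) 1 = 1"
proof -
  have "[:- 1, 0, 1:] = [:- 1, 1:] * [:1, 1 :: real:]" by simp
  then have "[:- 1, 0, 1:] ^ l = [:- 1, 1:] ^ l * [:1, 1 :: real:] ^ l" by (simp only: power_mult_distrib)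
  then show ?thesis unfolding legendre_def by (simp only: poly_smult pderiv_power_at_root) simp
qed

abbreviation (input) X2m1 :: "real poly" where "X2m1 \<equiv> [:- 1, 0, 1:]"

text \<open>Repeated differentiation of
  \<open>X2m1 * pderiv q = smult (2 * real l) ([:0, 1:] * q)\<close>. The instance n = m + l is the
  differential equation of the m-th derivative of the Legendre polynomial.\<close>

lemma rodrigues_ode:
  fixes l n :: nat
  defines "q \<equiv> X2m1 ^ l"
  shows "(u\<^sup>2 - 1) * poly ((pderiv ^^ (n + 2)) q) u + 2 * (real n + 1 - real l) * u * poly ((pderiv ^^ (n + 1)) q) u
    + (real n + 1) * (real n - 2 * real l) * poly ((pderiv ^^ n) q) u = 0"
proof (induction n arbitrary: u)
  case 0
  have b: "X2m1 * pderiv q = smult (2 * real l) ([:0, 1:] * q)"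
  proof (cases l)
    case (Suc k)
    then show ?thesis unfolding q_def
      by (simp only: pderiv_power_Suc) (simp add: pderiv_pCons algebra_simps)
  qed (simp add: q_def pderiv_1)
  from arg_cong[OF this, of "\<lambda>p. poly (pderiv p) u"] show ?case
    by (simp add: pderiv_mult pderiv_smult pderiv_pCons pderiv_diff power2_eq_square algebra_simps)
next
  case (Suc n)
  define p0 p1 p2 where "p0 = (pderiv ^^ n) q" "p1 = (pderiv ^^ (n + 1)) q" "p2 = (pderiv ^^ (n + 2)) q"
  have d: "pderiv p0 = p1" "pderiv p1 = p2" by (simp_all add: p0_p1_p2_def)
  \<comment> \<open>The identity holds at every point, hence between polynomials, and may be
    differentiated once more.\<close>
  have "poly (X2m1 * p2 + smult (2 * (real n + 1 - real l)) ([:0, 1:] * p1) + smult ((real n + 1) * (real n - 2 * real l)) p0) v = poly 0 v" for v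
    using Suc[of v] unfolding p0_p1_p2_def[symmetric] by (simp add: power2_eq_square algebra_simps)
  then have "X2m1 * p2 + smult (2 * (real n + 1 - real l)) ([:0, 1:] * p1) + smult ((real n + 1) * (real n - 2 * real l)) p0 = 0"
    by (intro poly_ext)
  from arg_cong[OF this, of "\<lambda>p. poly (pderiv p) u"]
  have "(u\<^sup>2 - 1) * poly (pderiv p2) u + 2 * (real n + 2 - real l) * u * poly p2 u
    + (real n + 2) * (real n + 1 - 2 * real l) * poly p1 u = 0"
    by (simp only: pderiv_mult pderiv_smult pderiv_add d) (simp add: pderiv_pCons power2_eq_square algebra_simps)
  then show ?case by (simp add: p0_p1_p2_def add.commute)
qed

definition legendre_deriv :: "nat \<Rightarrow> nat \<Rightarrow> real poly" where "legendre_deriv l m = (pderiv ^^ m) (legendre l)"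

lemma pderiv_funpow_smult: "(pderiv ^^ n) (smult c p) = smult c ((pderiv ^^ n) (p :: real poly))"
  by (induction n) (simp_all add: pderiv_smult)

lemma pderiv_legendre_deriv: "pderiv (legendre_deriv l m) = legendre_deriv l (Suc m)" by (simp add: legendre_deriv_def)

lemma legendre_deriv_eq: "legendre_deriv l m = smult (1 / (2 ^ l * fact l)) ((pderiv ^^ (m + l)) (X2m1 ^ l))"
  by (simp add: legendre_deriv_def legendre_def pderiv_funpow_smult funpow_add)

lemma legendre_deriv_ode:
  "(1 - u\<^sup>2) * poly (legendre_deriv l (m + 2)) u = 2 * (real m + 1) * u * poly (legendre_deriv l (m + 1)) u
     - (real l + real m + 1) * (real l - real m) * poly (legendre_deriv l m) u"
proof -
  define c where "c = 1 / (2 ^ l * fact l :: real)"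
  define p where "p k = poly ((pderiv ^^ (m + l + k)) (X2m1 ^ l)) u" for k
  have "(u\<^sup>2 - 1) * p 2 + 2 * (real m + 1) * u * p 1 + (real m + real l + 1) * (real m - real l) * p 0 = 0"
    using rodrigues_ode[of u "m + l" l] by (simp add: p_def del: funpow.simps)
  then have "(1 - u\<^sup>2) * p 2 = 2 * (real m + 1) * u * p 1 - (real l + real m + 1) * (real l - real m) * p 0"
    by (simp add: algebra_simps)
  from arg_cong[OF this, of "\<lambda>x. c * x"]
  have "(1 - u\<^sup>2) * (c * p 2) = 2 * (real m + 1) * u * (c * p 1) - (real l + real m + 1) * (real l - real m) * (c * p 0)"
    by (simp add: algebra_simps)
  moreover have "c * p k = poly (legendre_deriv l (m + k)) u" for k
    by (simp add: legendre_deriv_eq c_def p_def add.commute add.left_commute del: funpow.simps)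
  ultimately show ?thesis by (simp del: One_nat_def)
qed

lemma degree_pderiv_funpow: "degree ((pderiv ^^ n) p) = degree p - n" for p :: "real poly"
  by (induction n) (simp_all add: degree_pderiv)

text \<open>\<open>X2m1 ^ l\<close> has degree 2 l, so already the l-th derivative of
  \<open>legendre l\<close> is constant. This closes the telescoping in
  \<open>addition_poly_eq_1\<close>.\<close>

lemma legendre_deriv_eq_0: "l < m \<Longrightarrow> legendre_deriv l m = 0"
proof -
  assume "l < m"
  have "degree (X2m1 ^ l) = 2 * l" by (simp add: degree_power_eq)
  then have "degree (legendre_deriv l l) = 0" unfolding legendre_deriv_eq by (simp add: degree_pderiv_funpow)
  then have z: "legendre_deriv l (Suc l) = 0" by (simp add: pderiv_legendre_deriv[symmetric] pderiv_eq_0_iff)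
  have "legendre_deriv l (Suc l + k) = 0" for k
  proof (induction k)
    case (Suc k)
    then show ?case using pderiv_legendre_deriv[of l "Suc l + k"] by simp
  qed (use z in simp)
  from this[of "m - Suc l"] show ?thesis using \<open>l < m\<close> by simp
qed

definition legendre_const :: "nat \<Rightarrow> nat \<Rightarrow> real" where "legendre_const l m = fact (l - m) / fact (l + m)"

text \<open>The ratio of consecutive constants is the zeroth-order coefficient of
  \<open>legendre_deriv_ode\<close>; this match makes the normalised sum telescope and the
  normalised integrals agree.\<close>

lemma legendre_const_Suc: "m < l \<Longrightarrow> legendre_const l m = (real l + real m + 1) * (real l - real m) * legendre_const l (Suc m)"
proof -
  assume "m < l"
  then have "l - m = Suc (l - Suc m)" by simp
  then have "(fact (l - m) :: real) = (real l - real m) * fact (l - Suc m)" using \<open>m < l\<close>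
    by (simp only: fact_Suc) (simp add: of_nat_diff)
  moreover have "(fact (l + Suc m) :: real) = (real l + real m + 1) * fact (l + m)" by simp
  moreover have "real l + real m + 1 \<noteq> 0" by linarith
  ultimately show ?thesis by (simp add: legendre_const_def divide_simps)
qed

definition one_minus_sq :: "real poly" where "one_minus_sq = [:1, 0, -1:]"

lemma poly_one_minus_sq [simp]: "poly one_minus_sq u = 1 - u\<^sup>2" by (simp add: one_minus_sq_def power2_eq_square)

lemma pderiv_one_minus_sq: "pderiv one_minus_sq = [:0, -2:]" by (simp add: one_minus_sq_def pderiv_pCons)

text \<open>The differential equation of order \<open>m - 1\<close>, solved for its middle
  term.\<close>

lemma legendre_deriv_recursion:
  assumes "m \<ge> 1" "m \<le> l"
  shows "smult (2 * real m) ([:0, 1:] * legendre_deriv l m) = one_minus_sq * legendre_deriv l (Suc m) + smult ((real l + real m) * (real l - real m + 1)) (legendre_deriv l (m - 1))"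
proof -
  obtain k where k: "m = Suc k" using assms by (cases m) auto
  show ?thesis
  proof (rule poly_ext)
    fix u
    show "poly (smult (2 * real m) ([:0, 1:] * legendre_deriv l m)) u = poly (one_minus_sq * legendre_deriv l (Suc m) + smult ((real l + real m) * (real l - real m + 1)) (legendre_deriv l (m - 1))) u"
      using legendre_deriv_ode[of u l k] unfolding k by (simp add: algebra_simps)
  qed
qed

text \<open>As a polynomial in cos \<theta>, the sum of the squared spherical harmonics divided by
  \<open>(2 * real l + 1) / (4 * pi)\<close>. Orders m and -m share one term, hence the weight 2,
  and squaring removes the root in \<open>assoc_legendre\<close>.\<close>

definition addition_poly :: "nat \<Rightarrow> real poly" where
  "addition_poly l = (\<Sum>m\<le>l. smult ((if m = 0 then 1 else 2) * legendre_const l m) (one_minus_sq ^ m * (legendre_deriv l m)\<^sup>2))"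

text \<open>The derivative telescopes by Legendre's equation, and the value at 1 is that of \<open>legendre l\<close>.\<close>

lemma addition_poly_eq_1: "addition_poly l = 1"
proof -
  \<comment> \<open>Twice \<open>b k\<close> will be the derivative of the partial sum up to
    \<open>k\<close>, and \<open>b l\<close> vanishes because it contains the derivative of order l
    + 1.\<close>
  define b where "b m = smult (legendre_const l m) (one_minus_sq ^ m * legendre_deriv l m * legendre_deriv l (Suc m))" for m
  have t0: "pderiv (smult (legendre_const l 0) (one_minus_sq ^ 0 * (legendre_deriv l 0)\<^sup>2)) = smult 2 (b 0)"
    by (rule poly_ext) (simp add: b_def power2_eq_square pderiv_mult pderiv_smult pderiv_legendre_deriv)
  have t: "pderiv (smult (2 * legendre_const l (Suc k)) (one_minus_sq ^ Suc k * (legendre_deriv l (Suc k))\<^sup>2)) = smult 2 (b (Suc k) - b k)"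
    if "Suc k \<le> l" for k
  proof -
    have r: "smult (2 * (real k + 1)) ([:0, 1:] * legendre_deriv l (Suc k)) = one_minus_sq * legendre_deriv l (Suc (Suc k)) + smult ((real l + real k + 1) * (real l - real k)) (legendre_deriv l k)"
      using legendre_deriv_recursion[of "Suc k" l] that by (simp add: algebra_simps)
    have "poly (pderiv (smult (2 * legendre_const l (Suc k)) (one_minus_sq ^ Suc k * (legendre_deriv l (Suc k))\<^sup>2))) u = poly (smult 2 (b (Suc k) - b k)) u" for u
    proof -
      have "2 * (real k + 1) * u * poly (legendre_deriv l (Suc k)) u = (1 - u\<^sup>2) * poly (legendre_deriv l (Suc (Suc k))) u + (real l + real k + 1) * (real l - real k) * poly (legendre_deriv l k) u"
        using arg_cong[OF r, of "\<lambda>p. poly p u"] by (simp add: mult.assoc mult.left_commute)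
      from arg_cong[OF this, of "\<lambda>x. (2 * legendre_const l (Suc k) * (1 - u\<^sup>2) ^ k * poly (legendre_deriv l (Suc k)) u) * x"]
      have m: "(2 * legendre_const l (Suc k) * (1 - u\<^sup>2) ^ k * poly (legendre_deriv l (Suc k)) u) * (2 * (real k + 1) * u * poly (legendre_deriv l (Suc k)) u)
        = (2 * legendre_const l (Suc k) * (1 - u\<^sup>2) ^ k * poly (legendre_deriv l (Suc k)) u) * ((1 - u\<^sup>2) * poly (legendre_deriv l (Suc (Suc k))) u + (real l + real k + 1) * (real l - real k) * poly (legendre_deriv l k) u)" .
      have c: "legendre_const l k = (real l + real k + 1) * (real l - real k) * legendre_const l (Suc k)"
        using that by (intro legendre_const_Suc) auto
      \<comment> \<open>The subtracted term is where the derivative hits the power of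
        \<open>one_minus_sq\<close>. By \<open>m\<close> it splits in two: one part cancels half of
        the first term, the other is twice \<open>b k\<close> by \<open>c\<close>.\<close>
      have "poly (pderiv (smult (2 * legendre_const l (Suc k)) (one_minus_sq ^ Suc k * (legendre_deriv l (Suc k))\<^sup>2))) u
        = 4 * legendre_const l (Suc k) * (1 - u\<^sup>2) ^ k * (1 - u\<^sup>2) * poly (legendre_deriv l (Suc k)) u * poly (legendre_deriv l (Suc (Suc k))) u
         - (2 * legendre_const l (Suc k) * (1 - u\<^sup>2) ^ k * poly (legendre_deriv l (Suc k)) u) * (2 * (real k + 1) * u * poly (legendre_deriv l (Suc k)) u)"
        by (simp only: pderiv_smult pderiv_mult pderiv_power_Suc pderiv_one_minus_sq pderiv_legendre_deriv power2_eq_square[of "legendre_deriv _ _"])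
           (simp add: algebra_simps)
      then show ?thesis unfolding m by (simp add: b_def c algebra_simps)
    qed
    then show ?thesis by (rule poly_ext)
  qed
  have pd: "pderiv (\<Sum>m\<le>k. smult ((if m = 0 then 1 else 2) * legendre_const l m) (one_minus_sq ^ m * (legendre_deriv l m)\<^sup>2)) = smult 2 (b k)" if "k \<le> l" for k
    using that
  proof (induction k)
    case (Suc k)
    then show ?case using t[of k] by (simp add: pderiv_add smult_diff_right del: power_Suc)
  qed (use t0 in simp)
  have "pderiv (addition_poly l) = 0"
    using pd[of l] by (simp add: addition_poly_def b_def legendre_deriv_eq_0)
  then obtain c where c: "addition_poly l = [:c:]" by (auto simp: pderiv_eq_0_iff dest: degree_eq_zeroE)
  \<comment> \<open>At 1 the powers of \<open>one_minus_sq\<close> vanish except for m = 0.\<close>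
  have "poly (addition_poly l) 1 = (\<Sum>m\<le>l. if m = 0 then 1 else 0)"
    unfolding addition_poly_def poly_sum by (intro sum.cong) (auto simp: legendre_const_def legendre_deriv_def legendre_at_1)
  then have "c = 1" by (simp add: c)
  then show ?thesis by (simp add: c)
qed

text \<open>The substitution u = cos \<theta> makes this the integral of \<open>p\<close> over
  [-1, 1]; it is kept in \<theta> because sphere integrals factor in that variable.\<close>

definition cos_integral :: "real poly \<Rightarrow> real" where
  "cos_integral p = (LBINT \<theta>:{0..pi}. poly p (cos \<theta>) * sin \<theta>)"

lemma cos_integral_integrable: "set_integrable lborel {0..pi} (\<lambda>\<theta>. poly p (cos \<theta>) * sin \<theta>)"
  by (rule borel_integrable_atLeastAtMost') (intro continuous_intros)

lemma cos_integral_add: "cos_integral (p + q) = cos_integral p + cos_integral q"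
  using cos_integral_integrable[of p] cos_integral_integrable[of q]
  by (simp add: cos_integral_def ring_distribs set_integral_add)

lemma cos_integral_smult: "cos_integral (smult c p) = c * cos_integral p"
  by (simp add: cos_integral_def mult.assoc)

lemma cos_integral_sum: "cos_integral (\<Sum>i\<in>A. f i) = (\<Sum>i\<in>A. cos_integral (f i))"
  by (induction A rule: infinite_finite_induct) (simp_all add: cos_integral_add, simp_all add: cos_integral_def)

lemma cos_integral_pderiv: "cos_integral (pderiv p) = poly p 1 - poly p (-1)"
proof -
  have "(LBINT \<theta>:{0..pi}. poly (pderiv p) (cos \<theta>) * sin \<theta>) = (- poly p (cos pi)) - (- poly p (cos 0))"
    unfolding set_lebesgue_integral_def
    by (rule integral_FTC_Icc)
       (auto intro!: derivative_eq_intros continuous_intros simp flip: has_real_derivative_iff_has_vector_derivative)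
  then show ?thesis by (simp add: cos_integral_def)
qed

lemma cos_integral_1: "cos_integral 1 = 2"
  using cos_integral_pderiv[of "[:0, 1:]"] by (simp add: pderiv_pCons one_pCons)

text \<open>Legendre's equation in divergence form exhibits a nonzero multiple of
  \<open>legendre l\<close> as the derivative of a polynomial that vanishes at both
  endpoints.\<close>

lemma cos_integral_legendre: "l \<ge> 1 \<Longrightarrow> cos_integral (legendre l) = 0"
proof -
  assume l: "l \<ge> 1"
  have "pderiv (one_minus_sq * legendre_deriv l 1) = smult (- (real l * (real l + 1))) (legendre l)"
  proof (rule poly_ext)
    fix u
    show "poly (pderiv (one_minus_sq * legendre_deriv l 1)) u = poly (smult (- (real l * (real l + 1))) (legendre l)) u"
      using legendre_deriv_ode[of u l 0]
      by (simp add: pderiv_mult pderiv_one_minus_sq pderiv_legendre_deriv numeral_2_eq_2 algebra_simps) (simp add: legendre_deriv_def)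
  qed
  from arg_cong[OF this, of cos_integral] have "- (real l * (real l + 1)) * cos_integral (legendre l) = 0"
    unfolding cos_integral_smult cos_integral_pderiv by simp
  then show ?thesis using l by (simp add: add_eq_0_iff)
qed

text \<open>Integration by parts shows that the normalised integral is the same for every
  \<open>m\<close>. Its value then follows from the addition theorem: \<open>addition_poly l\<close>
  is 1 and contains 2 l + 1 copies of it, while \<open>cos_integral 1\<close> is 2.\<close>

lemma cos_integral_legendre_deriv_sq:
  assumes "m \<le> l"
  shows "legendre_const l m * cos_integral (one_minus_sq ^ m * (legendre_deriv l m)\<^sup>2) = 2 / (2 * real l + 1)"
proof -
  have step: "legendre_const l (Suc m) * cos_integral (one_minus_sq ^ Suc m * (legendre_deriv l (Suc m))\<^sup>2) = legendre_const l m * cos_integral (one_minus_sq ^ m * (legendre_deriv l m)\<^sup>2)"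
    if m: "Suc m \<le> l" for m
  proof -
    \<comment> \<open>The polynomial under the derivative vanishes at both endpoints, thanks to the
      positive power of \<open>one_minus_sq\<close>.\<close>
    have "pderiv (one_minus_sq ^ Suc m * legendre_deriv l m * legendre_deriv l (Suc m)) = one_minus_sq ^ Suc m * (legendre_deriv l (Suc m))\<^sup>2 +
      smult (- ((real l + real m + 1) * (real l - real m))) (one_minus_sq ^ m * (legendre_deriv l m)\<^sup>2)"
    proof (rule poly_ext)
      fix u
      have r: "(1 - u\<^sup>2) * poly (legendre_deriv l (Suc (Suc m))) u
        = 2 * (real m + 1) * u * poly (legendre_deriv l (Suc m)) u - (real l + real m + 1) * (real l - real m) * poly (legendre_deriv l m) u"
        using legendre_deriv_ode[of u l m] by (simp add: numeral_2_eq_2)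
      have "poly (pderiv (one_minus_sq ^ Suc m * legendre_deriv l m * legendre_deriv l (Suc m))) u
        = (1 - u\<^sup>2) * (1 - u\<^sup>2) ^ m * (poly (legendre_deriv l (Suc m)) u)\<^sup>2
          + (1 - u\<^sup>2) ^ m * poly (legendre_deriv l m) u * ((1 - u\<^sup>2) * poly (legendre_deriv l (Suc (Suc m))) u - 2 * (real m + 1) * u * poly (legendre_deriv l (Suc m)) u)"
        by (simp only: pderiv_mult pderiv_power_Suc pderiv_one_minus_sq pderiv_legendre_deriv)
           (simp add: algebra_simps power2_eq_square)
      then show "poly (pderiv (one_minus_sq ^ Suc m * legendre_deriv l m * legendre_deriv l (Suc m))) u = poly (one_minus_sq ^ Suc m * (legendre_deriv l (Suc m))\<^sup>2 +
        smult (- ((real l + real m + 1) * (real l - real m))) (one_minus_sq ^ m * (legendre_deriv l m)\<^sup>2)) u"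
        unfolding r by (simp add: algebra_simps power2_eq_square)
    qed
    from arg_cong[OF this, of cos_integral]
    have "cos_integral (one_minus_sq ^ Suc m * (legendre_deriv l (Suc m))\<^sup>2) = (real l + real m + 1) * (real l - real m) * cos_integral (one_minus_sq ^ m * (legendre_deriv l m)\<^sup>2)"
      unfolding cos_integral_pderiv cos_integral_add cos_integral_smult by simp
    moreover have "legendre_const l m = (real l + real m + 1) * (real l - real m) * legendre_const l (Suc m)"
      using m by (intro legendre_const_Suc) auto
    ultimately show ?thesis by simp
  qed
  have c: "legendre_const l m * cos_integral (one_minus_sq ^ m * (legendre_deriv l m)\<^sup>2) = legendre_const l 0 * cos_integral (one_minus_sq ^ 0 * (legendre_deriv l 0)\<^sup>2)" if "m \<le> l" for m
    using that by (induction m) (use step in \<open>simp_all del: power_Suc\<close>)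
  define c0 where "c0 = legendre_const l 0 * cos_integral (one_minus_sq ^ 0 * (legendre_deriv l 0)\<^sup>2)"
  have "2 = cos_integral (addition_poly l)" by (simp add: addition_poly_eq_1 cos_integral_1)
  also have "\<dots> = (\<Sum>m\<le>l. (if m = 0 then 1 else 2) * c0)"
    unfolding addition_poly_def cos_integral_sum cos_integral_smult
    by (intro sum.cong refl) (use c in \<open>simp add: c0_def mult.assoc\<close>)
  also have "\<dots> = (1 + 2 * real l) * c0"
    by (subst sum.atMost_shift) (simp add: algebra_simps)
  finally have "c0 = 2 / (2 * real l + 1)" by (simp add: field_simps add_eq_0_iff)
  then show ?thesis using c[OF assms] by (simp add: c0_def)
qed

section \<open>Spherical harmonics\<close>

text \<open>Order 0 falls under the cosine and gives 1, so the three branches of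
  \<open>sph_harmonic_angles\<close> become one product. The natural multiple lets De Moivre's
  formula apply.\<close>

definition trig :: "int \<Rightarrow> real \<Rightarrow> real" where
  "trig m \<phi> = (if m \<ge> 0 then cos (real (nat \<bar>m\<bar>) * \<phi>) else sin (real (nat \<bar>m\<bar>) * \<phi>))"

definition sph_const :: "nat \<Rightarrow> int \<Rightarrow> real" where
  "sph_const l m = sqrt ((2 * real l + 1) / (4 * pi) * ((if m = 0 then 1 else 2) * legendre_const l (nat \<bar>m\<bar>)))"

lemma legendre_const_nonneg: "0 \<le> legendre_const l m" by (simp add: legendre_const_def)

lemma sph_const_sq: "(sph_const l m)\<^sup>2 = (2 * real l + 1) / (4 * pi) * ((if m = 0 then 1 else 2) * legendre_const l (nat \<bar>m\<bar>))"
  unfolding sph_const_def by (rule real_sqrt_pow2) (simp add: legendre_const_nonneg)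

lemma sph_harmonic_angles_eq:
  assumes "m \<in> orders l"
  shows "sph_harmonic_angles l m \<theta> \<phi> = sph_const l m * assoc_legendre l (nat \<bar>m\<bar>) (cos \<theta>) * trig m \<phi>"
proof -
  consider "m \<ge> 1" | "m = 0" | "m \<le> -1" by linarith
  then show ?thesis
  proof cases
    case 1
    then have e: "nat (int l - m) = l - nat m" "nat (int l + m) = l + nat m" "\<bar>m\<bar> = m" "real (nat m) = of_int m" by auto
    have "(2 * real l + 1) / (2 * pi) * (fact (l - nat m) / fact (l + nat m))
      = (2 * real l + 1) / (4 * pi) * ((if m = 0 then 1 else 2) * legendre_const l (nat \<bar>m\<bar>))"
      using 1 by (simp add: legendre_const_def)
    with 1 show ?thesis unfolding sph_harmonic_angles_def sph_const_def trig_def e by simp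
  next
    case 2
    then show ?thesis by (simp add: sph_harmonic_angles_def sph_const_def trig_def legendre_const_def assoc_legendre_def)
  next
    case 3
    then have e: "nat (int l - m) = l + nat (- m)" "nat (int l + m) = l - nat (- m)" "\<bar>m\<bar> = - m" "real (nat (- m)) = - of_int m" by auto
    have "(2 * real l + 1) / (2 * pi) * (fact (l - nat (- m)) / fact (l + nat (- m)))
      = (2 * real l + 1) / (4 * pi) * ((if m = 0 then 1 else 2) * legendre_const l (nat \<bar>m\<bar>))"
      using 3 by (simp add: legendre_const_def)
    with 3 show ?thesis unfolding sph_harmonic_angles_def sph_const_def trig_def e by simp
  qed
qed

lemma trig_sq_add: "m > 0 \<Longrightarrow> (trig m \<phi>)\<^sup>2 + (trig (- m) \<phi>)\<^sup>2 = 1"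
  by (simp add: trig_def)

lemma assoc_legendre_sq: "\<bar>u\<bar> \<le> 1 \<Longrightarrow> (assoc_legendre l m u)\<^sup>2 = poly (one_minus_sq ^ m * (legendre_deriv l m)\<^sup>2) u"
  by (simp add: assoc_legendre_def legendre_deriv_def power_mult_distrib abs_square_le_1 flip: power_mult power_even_eq)
     (simp add: mult.commute[of m 2] power_mult abs_square_le_1)

lemma sum_orders: "(\<Sum>m\<in>orders l. f m) = f 0 + (\<Sum>k=1..l. f (int k) + f (- int k))"
  for f :: "int \<Rightarrow> 'a::comm_monoid_add"
proof (induction l)
  case (Suc l)
  have "orders (Suc l) = insert (int (Suc l)) (insert (- int (Suc l)) (orders l))" by auto
  then show ?case using Suc by (simp add: ac_simps)
qed simp

text \<open>The squares of cosine and sine in opposite orders add to 1, which leaves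
  \<open>addition_poly l\<close> at cos \<theta>. Any \<open>x\<close> is allowed because
  \<open>sph_harmonic\<close> always evaluates at two real angles.\<close>

theorem sum_sph_harmonic_sq:
  "(\<Sum>m\<in>orders l. (sph_harmonic l m x)\<^sup>2) = (2 * real l + 1) / (4 * pi)"
proof -
  define \<theta> \<phi> where "\<theta> = arccos (x $ 3)" "\<phi> = Arg (Complex (x $ 1) (x $ 2))"
  define K where "K = (2 * real l + 1) / (4 * pi)"
  define g where "g k = legendre_const l k * poly (one_minus_sq ^ k * (legendre_deriv l k)\<^sup>2) (cos \<theta>)" for k
  have Y: "(sph_harmonic l m x)\<^sup>2 = K * ((if m = 0 then 1 else 2) * g (nat \<bar>m\<bar>)) * (trig m \<phi>)\<^sup>2"
    if "m \<in> orders l" for m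
    by (simp add: sph_harmonic_def sph_harmonic_angles_eq[OF that] \<theta>_\<phi>_def[symmetric] power_mult_distrib
      sph_const_sq K_def[symmetric] assoc_legendre_sq g_def)
  have "(\<Sum>m\<in>orders l. (sph_harmonic l m x)\<^sup>2) = (\<Sum>m\<in>orders l. K * ((if m = 0 then 1 else 2) * g (nat \<bar>m\<bar>)) * (trig m \<phi>)\<^sup>2)"
    by (intro sum.cong refl Y)
  also have "\<dots> = K * g 0 + (\<Sum>k=1..l. K * (2 * g k))"
    unfolding sum_orders
  proof (intro arg_cong2[of _ _ _ _ "(+)"] sum.cong refl)
    fix k assume "k \<in> {1..l}"
    then have k: "int k > 0" by auto
    have "K * ((if int k = 0 then 1 else 2) * g (nat \<bar>int k\<bar>)) * (trig (int k) \<phi>)\<^sup>2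
      + K * ((if - int k = 0 then 1 else 2) * g (nat \<bar>- int k\<bar>)) * (trig (- int k) \<phi>)\<^sup>2
      = K * (2 * g k) * ((trig (int k) \<phi>)\<^sup>2 + (trig (- int k) \<phi>)\<^sup>2)"
      using k by (simp add: algebra_simps)
    then show "K * ((if int k = 0 then 1 else 2) * g (nat \<bar>int k\<bar>)) * (trig (int k) \<phi>)\<^sup>2
      + K * ((if - int k = 0 then 1 else 2) * g (nat \<bar>- int k\<bar>)) * (trig (- int k) \<phi>)\<^sup>2 = K * (2 * g k)"
      unfolding trig_sq_add[OF k] by simp
  qed (simp add: trig_def)
  also have "\<dots> = K * (g 0 + (\<Sum>k=1..l. 2 * g k))" by (simp add: distrib_left sum_distrib_left)
  also have "g 0 + (\<Sum>k=1..l. 2 * g k) = (\<Sum>k\<le>l. (if k = 0 then 1 else 2) * g k)"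
  proof -
    have "{..l} = insert 0 {1..l}" by auto
    then show ?thesis by simp
  qed
  also have "\<dots> = poly (addition_poly l) (cos \<theta>)"
    unfolding addition_poly_def poly_sum by (intro sum.cong refl) (simp add: g_def)
  finally show ?thesis by (simp add: addition_poly_eq_1 K_def)
qed

text \<open>De Moivre's formula turns the multiple angle into a power of the normalised
  \<open>z\<close>, visibly measurable in \<open>z\<close>. The value 1 at \<open>z = 0\<close>
  reflects \<open>Arg 0 = 0\<close>.\<close>

lemma trig_Arg: "trig m (Arg z) = (if m \<ge> 0 then Re ((if z = 0 then 1 else z / of_real (cmod z)) ^ nat \<bar>m\<bar>)
    else Im ((if z = 0 then 1 else z / of_real (cmod z)) ^ nat \<bar>m\<bar>))"
proof -
  have "(if z = 0 then 1 else z / of_real (cmod z)) = cis (Arg z)"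
    by (auto simp: cis_Arg sgn_eq Arg_zero)
  then show ?thesis by (simp only: Complex.DeMoivre trig_def) simp
qed

text \<open>\<open>Arg\<close> recovers a longitude only modulo 2 \<pi>; this carries
  \<open>trig\<close> across that ambiguity.\<close>

lemma trig_cis_cong: "cis a = cis b \<Longrightarrow> trig m a = trig m b"
proof -
  assume "cis a = cis b"
  then have "cis a ^ nat \<bar>m\<bar> = cis b ^ nat \<bar>m\<bar>" by simp
  then show ?thesis unfolding Complex.DeMoivre trig_def by (auto simp: complex_eq_iff)
qed

lemma sph_harmonic_on_S2:
  assumes "m \<in> orders l" "x \<in> S2"
  shows "sph_harmonic l m x = sph_const l m * assoc_legendre l (nat \<bar>m\<bar>) (x $ 3) * trig m (Arg (Complex (x $ 1) (x $ 2)))"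
proof -
  have "\<bar>x $ 3\<bar> \<le> 1" using component_le_norm_cart[of x 3] assms(2) by simp
  then show ?thesis by (simp add: sph_harmonic_def sph_harmonic_angles_eq[OF assms(1)] cos_arccos_abs)
qed

lemma sph_harmonic_sph_point:
  assumes "m \<in> orders l" "0 < \<theta>" "\<theta> < pi"
  shows "sph_harmonic l m (sph_point (\<theta>, \<phi>)) = sph_const l m * assoc_legendre l (nat \<bar>m\<bar>) (cos \<theta>) * trig m \<phi>"
proof -
  have s: "sin \<theta> > 0" using assms by (intro sin_gt_zero) auto
  have z: "Complex (sin \<theta> * cos \<phi>) (sin \<theta> * sin \<phi>) = of_real (sin \<theta>) * cis \<phi>"
    by (simp add: complex_eq_iff)
  have "cis (Arg (of_real (sin \<theta>) * cis \<phi>)) = sgn (of_real (sin \<theta>) * cis \<phi>)"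
    using s by (intro cis_Arg) (auto simp: cis_neq_zero)
  also have "\<dots> = cis \<phi>" using s by (simp add: sgn_mult sgn_of_real sgn_cis)
  finally have "trig m (Arg (of_real (sin \<theta>) * cis \<phi>)) = trig m \<phi>" by (rule trig_cis_cong)
  then show ?thesis using sph_harmonic_on_S2[OF assms(1) sph_point_S2[of "(\<theta>, \<phi>)"]]
    by (simp add: sph_point_def vector_3 z)
qed

section \<open>Integration over the sphere in spherical coordinates\<close>

lemma sets_S2_measure [measurable_cong]: "sets S2_measure = sets (restrict_space borel S2)"
  by (simp add: S2_measure_def)

lemma space_S2_measure: "space S2_measure = S2"
  by (simp add: S2_measure_def space_restrict_space)

lemma sph_harmonic_measurable:
  assumes m: "m \<in> orders l"
  shows "sph_harmonic l m \<in> borel_measurable S2_measure"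
proof -
  have [measurable]: "(\<lambda>x::real^3. Complex (x $ 1) (x $ 2)) \<in> borel_measurable borel"
    unfolding Complex_eq by measurable
  have [measurable]: "(\<lambda>u. poly p u) \<in> borel_measurable borel" for p :: "real poly"
    by (intro borel_measurable_continuous_onI continuous_intros)
  have "(\<lambda>x::real^3. sph_const l m * assoc_legendre l (nat \<bar>m\<bar>) (x $ 3) * trig m (Arg (Complex (x $ 1) (x $ 2)))) \<in> borel_measurable borel"
    unfolding trig_Arg assoc_legendre_def by (cases "m \<ge> 0") (simp_all only: if_True if_False, measurable)
  then have "(\<lambda>x::real^3. sph_const l m * assoc_legendre l (nat \<bar>m\<bar>) (x $ 3) * trig m (Arg (Complex (x $ 1) (x $ 2)))) \<in> borel_measurable S2_measure"
    unfolding measurable_cong_sets[OF sets_S2_measure refl] by (rule measurable_restrict_space1)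
  then show ?thesis
    by (rule iffD1[OF measurable_cong, rotated]) (simp add: space_S2_measure sph_harmonic_on_S2[OF m])
qed

text \<open>The factorisation is asked for away from the poles only: at the poles the longitude is
  lost, but the density sin \<theta> vanishes.\<close>

lemma S2_integral_separable:
  fixes g :: "real ^ 3 \<Rightarrow> real"
  assumes g: "g \<in> borel_measurable S2_measure"
    and eq: "\<And>\<theta> \<phi>. 0 < \<theta> \<Longrightarrow> \<theta> < pi \<Longrightarrow> g (sph_point (\<theta>, \<phi>)) = a \<theta> * b \<phi>"
    and a: "continuous_on {0..pi} a" and b: "continuous_on {0..2*pi} b"
  shows "integral\<^sup>L S2_measure g = (LBINT \<theta>:{0..pi}. a \<theta> * sin \<theta>) * (LBINT \<phi>:{0..2*pi}. b \<phi>)"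
proof -
  let ?R = "{0..pi} \<times> {0..2 * pi} :: (real \<times> real) set"
  let ?D = "density (restrict_space lborel ?R) (\<lambda>(\<theta>, \<phi>). ennreal (sin \<theta>))"
  have mp: "sph_point \<in> ?D \<rightarrow>\<^sub>M restrict_space borel S2"
    using sph_point_measurable sph_point_S2
    by (auto intro!: measurable_restrict_space1 measurable_restrict_space2 simp: measurable_lborel2)
  have gm: "g \<in> borel_measurable (restrict_space borel S2)"
    using g unfolding measurable_cong_sets[OF sets_S2_measure refl] .
  have gs: "(\<lambda>p. g (sph_point p)) \<in> borel_measurable (restrict_space lborel ?R)"
    using measurable_compose[OF mp gm] by (simp add: measurable_cong_sets[OF sets_density refl])
  have sm: "(\<lambda>p::real\<times>real. sin (fst p)) \<in> borel_measurable (restrict_space lborel ?R)"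
  proof (rule measurable_restrict_space1)
    have "(\<lambda>p::real\<times>real. sin (fst p)) \<in> borel_measurable borel"
      by (intro borel_measurable_continuous_onI continuous_intros)
    then show "(\<lambda>p::real\<times>real. sin (fst p)) \<in> borel_measurable lborel" by simp
  qed
  have R: "?R \<inter> space lborel \<in> sets lborel" by (simp add: borel_closed closed_Times)
  have "integral\<^sup>L S2_measure g = (\<integral>p. g (sph_point p) \<partial>?D)"
    unfolding S2_measure_def by (rule integral_distr[OF mp gm])
  also have "\<dots> = (\<integral>p. sin (fst p) *\<^sub>R g (sph_point p) \<partial>restrict_space lborel ?R)"
    unfolding case_prod_unfold
    by (rule integral_density[OF gs sm]) (auto intro!: AE_I2 sin_ge_zero simp: space_restrict_space)
  also have "\<dots> = (\<integral>p. indicator ?R p *\<^sub>R (sin (fst p) *\<^sub>R g (sph_point p)) \<partial>lborel)"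
    by (rule integral_restrict_space[OF R])
  also have "\<dots> = (\<integral>p. (indicator {0..pi} (fst p) * (a (fst p) * sin (fst p))) * (indicator {0..2*pi} (snd p) * b (snd p)) \<partial>(lborel \<Otimes>\<^sub>M lborel))"
  proof -
    have "indicator ?R p *\<^sub>R (sin (fst p) *\<^sub>R g (sph_point p)) =
      (indicator {0..pi} (fst p) * (a (fst p) * sin (fst p))) * (indicator {0..2*pi} (snd p) * b (snd p))" for p :: "real \<times> real"
    proof (cases p)
      case (Pair \<theta> \<phi>)
      show ?thesis
      proof (cases "0 < \<theta> \<and> \<theta> < pi")
        case True
        then show ?thesis by (simp add: Pair eq indicator_times)
      next
        case False
        then have "\<theta> \<in> {0..pi} \<Longrightarrow> sin \<theta> = 0" by auto
        then show ?thesis by (auto simp: Pair indicator_times split: split_indicator)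
      qed
    qed
    then show ?thesis by (simp only: lborel_prod)
  qed
  also have "\<dots> = (\<integral>x. indicator {0..pi} x * (a x * sin x) \<partial>lborel) * (\<integral>y. indicator {0..2*pi} y * b y \<partial>lborel)"
  proof (rule integral_pair_mult)
    have "set_integrable lborel {0..pi} (\<lambda>x. a x * sin x)"
      by (rule borel_integrable_atLeastAtMost') (intro continuous_intros a)
    then show "integrable lborel (\<lambda>x. indicator {0..pi} x * (a x * sin x))"
      by (simp add: set_integrable_def)
    have "set_integrable lborel {0..2*pi} b"
      by (rule borel_integrable_atLeastAtMost'[OF b])
    then show "integrable lborel (\<lambda>x. indicator {0..2*pi} x * b x)"
      by (simp add: set_integrable_def)
  qed (rule lborel.sigma_finite_measure_axioms)+
  finally show ?thesis by (simp add: set_lebesgue_integral_def)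
qed

text \<open>The phase \<open>c\<close> lets one formula cover cosines and, with c = \<pi> / 2,
  sines.\<close>

lemma integral_cos_period: "(LBINT \<phi>:{0..2*pi}. cos (of_int n * \<phi> - c)) = (if n = 0 then 2 * pi * cos c else 0)"
proof (cases "n = 0")
  case False
  have "(LBINT \<phi>:{0..2*pi}. cos (of_int n * \<phi> - c)) = sin (of_int n * (2 * pi) - c) / of_int n - sin (of_int n * 0 - c) / of_int n"
    unfolding set_lebesgue_integral_def using False
    by (intro integral_FTC_Icc)
       (auto intro!: derivative_eq_intros continuous_intros simp flip: has_real_derivative_iff_has_vector_derivative)
  also have "sin (of_int n * (2 * pi) - c) = sin (- c)"
    using sin_int_2pin[of n] cos_int_2pin[of n] by (simp add: sin_diff mult.commute mult.left_commute)
  finally show ?thesis using False by simp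
qed (simp add: set_lebesgue_integral_def)

lemma trig_continuous [continuous_intros]: "continuous_on A (trig m)"
  unfolding trig_def by (cases "m \<ge> 0") (auto intro!: continuous_intros)

lemma integral_trig: "(LBINT \<phi>:{0..2*pi}. trig m \<phi>) = (if m = 0 then 2 * pi else 0)"
proof -
  have "trig m \<phi> = cos (of_int \<bar>m\<bar> * \<phi> - (if m \<ge> 0 then 0 else pi / 2))" for \<phi>
    by (auto simp: trig_def cos_diff)
  then show ?thesis by (simp only: integral_cos_period) simp
qed

text \<open>Cosines and sines are both cosines with phase \<tau>, so a single product-to-sum formula
  applies. For m = -k \<noteq> 0 the difference frequency is 0, but the phases differ by \<pi> / 2
  and the cosine of that is 0.\<close>

lemma integral_trig_mult:
  "(LBINT \<phi>:{0..2*pi}. trig m \<phi> * trig k \<phi>) = (if m = k then if m = 0 then 2 * pi else pi else 0)"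
proof -
  define \<tau> where "\<tau> m = (if m \<ge> 0 then 0 else pi / 2)" for m :: int
  have t: "trig m \<phi> = cos (of_int \<bar>m\<bar> * \<phi> - \<tau> m)" for \<phi> m
    by (auto simp: trig_def cos_diff \<tau>_def)
  have p: "trig m \<phi> * trig k \<phi> = cos (of_int (\<bar>m\<bar> - \<bar>k\<bar>) * \<phi> - (\<tau> m - \<tau> k)) / 2 + cos (of_int (\<bar>m\<bar> + \<bar>k\<bar>) * \<phi> - (\<tau> m + \<tau> k)) / 2" for \<phi>
    unfolding t cos_times_cos by (simp add: algebra_simps add_divide_distrib)
  have i: "set_integrable lborel {0..2*pi} (\<lambda>\<phi>. cos (of_int n * \<phi> - c) / 2)" for n :: int and c
    by (rule borel_integrable_atLeastAtMost') (intro continuous_intros, simp)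
  have h: "(LBINT \<phi>:{0..2*pi}. cos (of_int n * \<phi> - c) / 2) = (if n = 0 then pi * cos c else 0)" for n c
    using integral_cos_period[of n c] by simp
  have "(LBINT \<phi>:{0..2*pi}. trig m \<phi> * trig k \<phi>) =
     (if \<bar>m\<bar> - \<bar>k\<bar> = 0 then pi * cos (\<tau> m - \<tau> k) else 0) + (if \<bar>m\<bar> + \<bar>k\<bar> = 0 then pi * cos (\<tau> m + \<tau> k) else 0)"
    unfolding p set_integral_add(2)[OF i i] h ..
  then show ?thesis by (auto simp: \<tau>_def split: if_splits)
qed

lemma assoc_legendre_continuous [continuous_intros]:
  "continuous_on A (\<lambda>\<theta>. assoc_legendre l m (cos \<theta>))"
  unfolding assoc_legendre_def by (intro continuous_intros)

text \<open>For m \<noteq> 0 the longitude integral vanishes, for m = 0 that of the Legendre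
  polynomial, as \<open>l \<ge> 1\<close>.\<close>

theorem integral_sph_harmonic:
  assumes "m \<in> orders l" "l \<ge> 1"
  shows "integral\<^sup>L S2_measure (sph_harmonic l m) = 0"
proof -
  have "integral\<^sup>L S2_measure (sph_harmonic l m) =
    (LBINT \<theta>:{0..pi}. (sph_const l m * assoc_legendre l (nat \<bar>m\<bar>) (cos \<theta>)) * sin \<theta>) * (LBINT \<phi>:{0..2*pi}. trig m \<phi>)"
    by (rule S2_integral_separable[OF sph_harmonic_measurable[OF assms(1)]])
       (auto intro!: continuous_intros simp: sph_harmonic_sph_point[OF assms(1)])
  also have "\<dots> = 0"
  proof (cases "m = 0")
    case True
    have "(LBINT \<theta>:{0..pi}. (sph_const l m * assoc_legendre l (nat \<bar>m\<bar>) (cos \<theta>)) * sin \<theta>) = sph_const l m * cos_integral (legendre l)"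
      by (simp add: True assoc_legendre_def cos_integral_def mult.assoc)
    then show ?thesis using cos_integral_legendre[OF assms(2)] by simp
  qed (simp add: integral_trig)
  finally show ?thesis .
qed

text \<open>Within one degree, distinct orders are separated by the longitude; equal orders reach
  the colatitude integral, which \<open>cos_integral_legendre_deriv_sq\<close> evaluates.\<close>

theorem integral_sph_harmonic_mult:
  assumes "m \<in> orders l" "k \<in> orders l"
  shows "(\<integral>x. sph_harmonic l m x * sph_harmonic l k x \<partial>S2_measure) = (if m = k then 1 else 0)"
proof -
  let ?A = "\<lambda>m \<theta>. sph_const l m * assoc_legendre l (nat \<bar>m\<bar>) (cos \<theta>)"
  have "(\<integral>x. sph_harmonic l m x * sph_harmonic l k x \<partial>S2_measure) =
    (LBINT \<theta>:{0..pi}. (?A m \<theta> * ?A k \<theta>) * sin \<theta>) * (LBINT \<phi>:{0..2*pi}. trig m \<phi> * trig k \<phi>)"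
    by (rule S2_integral_separable)
       (auto intro!: continuous_intros borel_measurable_times sph_harmonic_measurable assms
         simp: sph_harmonic_sph_point[OF assms(1)] sph_harmonic_sph_point[OF assms(2)])
  also have "\<dots> = (if m = k then 1 else 0)"
  proof (cases "m = k")
    case True
    have "(LBINT \<theta>:{0..pi}. (?A m \<theta> * ?A m \<theta>) * sin \<theta>) = (sph_const l m)\<^sup>2 * cos_integral (one_minus_sq ^ nat \<bar>m\<bar> * (legendre_deriv l (nat \<bar>m\<bar>))\<^sup>2)"
    proof -
      have "(?A m \<theta> * ?A m \<theta>) * sin \<theta> = (sph_const l m)\<^sup>2 * (poly (one_minus_sq ^ nat \<bar>m\<bar> * (legendre_deriv l (nat \<bar>m\<bar>))\<^sup>2) (cos \<theta>) * sin \<theta>)" for \<theta>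
        using assoc_legendre_sq[of "cos \<theta>" l "nat \<bar>m\<bar>"] by (simp add: power2_eq_square)
      then show ?thesis unfolding cos_integral_def by (simp only: set_integral_mult_right)
    qed
    also have "\<dots> = (2 * real l + 1) / (4 * pi) * (if m = 0 then 1 else 2) * (legendre_const l (nat \<bar>m\<bar>) * cos_integral (one_minus_sq ^ nat \<bar>m\<bar> * (legendre_deriv l (nat \<bar>m\<bar>))\<^sup>2))"
      by (simp add: sph_const_sq)
    also have "\<dots> = (2 * real l + 1) / (4 * pi) * (if m = 0 then 1 else 2) * (2 / (2 * real l + 1))"
      using assms(1) by (subst cos_integral_legendre_deriv_sq) auto
    also have "\<dots> = (if m = 0 then 1 else 2) / (2 * pi)"
    proof -
      have "2 * real l + 1 \<noteq> 0" by linarith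
      then show ?thesis by (simp only: times_divide_eq_left times_divide_eq_right nonzero_mult_divide_mult_cancel_left) (auto simp: divide_simps)
    qed
    finally show ?thesis using True by (simp add: integral_trig_mult)
  qed (simp add: integral_trig_mult)
  finally show ?thesis .
qed

section \<open>The quantitative central limit theorem\<close>

text \<open>A test function with \<open>M\<^sub>2 = 1\<close>, which bounds the supremum of \<open>B3\<close> from below.\<close>

definition half_square :: "('i::zero \<Rightarrow> real) \<Rightarrow> real" where
  "half_square x = (x 0)\<^sup>2 / 2"

lemma partials_half_square:
  "partials is (half_square :: ('i::zero \<Rightarrow> real) \<Rightarrow> real) =
    (\<lambda>x. if is = [] then (x 0)\<^sup>2 / 2 else if is = [0] then x 0 else if is = [0, 0] then 1 else 0)"
proof (induction "is")
  case Nil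
  show ?case by (rule ext) (simp add: half_square_def)
next
  case (Cons i "is")
  show ?case
  proof (rule ext)
    fix x :: "'i \<Rightarrow> real"
    have d1: "deriv (\<lambda>s::real. s\<^sup>2 / 2) a = a" for a
      by (rule DERIV_imp_deriv) (auto intro!: derivative_eq_intros)
    have d2: "deriv (\<lambda>s::real. s) a = 1" for a
      by (rule DERIV_imp_deriv) (auto intro!: derivative_eq_intros)
    have d0: "deriv (\<lambda>s::real. c::real) a = 0" for c a by simp
    consider "is = []" | "is = [0]" | "is \<noteq> []" "is \<noteq> [0]" by blast
    then show "partials (i # is) half_square x =
      (if i # is = [] then (x 0)\<^sup>2 / 2 else if i # is = [0] then x 0 else if i # is = [0, 0] then 1 else 0)"
    proof cases
      case 1
      show ?thesis unfolding partials.simps Cons.IH using 1 d1 d0 by (cases "i = 0") simp_all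
    next
      case 2
      show ?thesis unfolding partials.simps Cons.IH using 2 d2 d0 by (cases "i = 0") simp_all
    next
      case 3
      then show ?thesis unfolding partials.simps Cons.IH using d0 by simp
    qed
  qed
qed

lemma continuous_on_component: "continuous_on A (\<lambda>x :: 'i \<Rightarrow> real. x i)"
  by (rule continuous_on_product_coordinates[THEN continuous_on_subset]) simp

lemma D_form_half_square:
  fixes I :: "'i::zero set"
  assumes I: "finite I" "0 \<in> I"
  shows "D_form I 1 half_square x u = x 0 * u 0 0" "D_form I 2 half_square x u = u 0 0 * u 1 0"
    "D_form I 3 half_square x u = 0"
proof -
  have f: "finite {is. set is \<subseteq> I \<and> length is = n}" for n by (rule finite_lists_length_eq[OF I(1)])
  have "D_form I 1 half_square x u = (\<Sum>is\<in>{is. set is \<subseteq> I \<and> length is = 1}. if is = [0] then x 0 * u 0 0 else 0)"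
    unfolding D_form_def partials_half_square by (intro sum.cong refl) auto
  then show "D_form I 1 half_square x u = x 0 * u 0 0" using f[of 1] I by simp
  have "D_form I 2 half_square x u = (\<Sum>is\<in>{is. set is \<subseteq> I \<and> length is = 2}. if is = [0, 0] then u 0 0 * u 1 0 else 0)"
    unfolding D_form_def partials_half_square by (intro sum.cong refl) (auto simp: numeral_2_eq_2)
  then show "D_form I 2 half_square x u = u 0 0 * u 1 0" using f[of 2] I by simp
  show "D_form I 3 half_square x u = 0"
    unfolding D_form_def partials_half_square by (intro sum.neutral) auto
qed

lemma component_le_L2_set: "finite I \<Longrightarrow> i \<in> I \<Longrightarrow> \<bar>x i\<bar> \<le> L2_set x I"
  using member_le_L2_set[of I i "\<lambda>i. \<bar>x i\<bar>"] by (simp add: L2_set_def)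

lemma half_square_test_class:
  fixes I :: "'i::zero set"
  assumes I: "finite I" "0 \<in> I"
  shows "half_square \<in> test_class I"
proof -
  have "half_square \<in> C_class 3 I"
    unfolding C_class_def
  proof (intro CollectI conjI allI impI ballI)
    fix "is" :: "'i list"
    show "continuous_on (vecs I) (partials is half_square)"
      unfolding partials_half_square
      by (cases "is = []"; cases "is = [0]"; cases "is = [0, 0]")
         (auto intro!: continuous_intros continuous_on_component)
    fix i and x :: "'i \<Rightarrow> real"
    show "(\<lambda>s. partials is half_square (x(i := s))) field_differentiable at (x i)"
      unfolding partials_half_square
      by (cases "is = []"; cases "is = [0]"; cases "is = [0, 0]"; cases "i = 0")
         (auto intro!: derivative_intros)
  qed
  moreover have "D_sup_norm I 2 half_square \<le> 1"
    unfolding D_sup_norm_def op_norm_def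
  proof (intro SUP_least)
    fix x :: "'i \<Rightarrow> real" and u :: "nat \<Rightarrow> 'i \<Rightarrow> real"
    assume u: "u \<in> {u. \<forall>k<2. u k \<in> vecs I \<and> L2_set (u k) I = 1}"
    have "\<bar>u 0 0\<bar> \<le> 1" "\<bar>u 1 0\<bar> \<le> 1"
      using component_le_L2_set[OF I, of "u 0"] component_le_L2_set[OF I, of "u 1"] u by auto
    then have "\<bar>u 0 0 * u 1 0\<bar> \<le> 1 * 1" unfolding abs_mult by (intro mult_mono) auto
    then show "ennreal \<bar>D_form I 2 half_square x u\<bar> \<le> 1"
      unfolding D_form_half_square[OF I] by simp
  qed
  moreover have "D_sup_norm I 3 half_square \<le> 1"
    unfolding D_sup_norm_def op_norm_def D_form_half_square[OF I] by (intro SUP_least) simp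
  ultimately show ?thesis by (simp add: test_class_def)
qed

text \<open>Between the origin and the unit vector \<open>e\<close>, at distance 1, the gradient
  changes by \<open>e\<close>; testing against \<open>e\<close> itself gives the quotient 1.\<close>

lemma M_const_half_square:
  fixes I :: "'i::zero set"
  assumes I: "finite I" "0 \<in> I"
  shows "1 \<le> M_const I 2 half_square"
proof -
  define e where "e = (\<lambda>i\<in>I. if i = 0 then 1 else 0 :: real)"
  define z where "z = (\<lambda>i\<in>I. 0 :: real)"
  have ez: "e \<in> vecs I" "z \<in> vecs I" "e \<noteq> z" "e 0 = 1" "z 0 = 0"
    using I by (auto simp: e_def z_def dest: fun_cong[of _ _ 0])
  have n: "L2_set e I = 1" "L2_set (\<lambda>i. e i - z i) I = 1"
  proof -
    have "(\<Sum>i\<in>I. (e i)\<^sup>2) = (\<Sum>i\<in>I. if i = 0 then 1 else 0)" by (intro sum.cong) (auto simp: e_def)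
    then show "L2_set e I = 1" using I by (simp add: L2_set_def)
    moreover have "L2_set (\<lambda>i. e i - z i) I = L2_set e I" by (rule L2_set_cong) (auto simp: z_def)
    ultimately show "L2_set (\<lambda>i. e i - z i) I = 1" by simp
  qed
  have "1 = ennreal \<bar>D_form I 1 half_square e (\<lambda>_. e) - D_form I 1 half_square z (\<lambda>_. e)\<bar>"
    unfolding D_form_half_square[OF I] by (simp add: ez)
  also have "\<dots> \<le> op_norm I 1 (\<lambda>u. D_form I 1 half_square e u - D_form I 1 half_square z u)"
    unfolding op_norm_def by (rule SUP_upper2[of "\<lambda>_. e"]) (use ez n in auto)
  also have "\<dots> = op_norm I (2 - 1) (\<lambda>u. D_form I (2 - 1) half_square e u - D_form I (2 - 1) half_square z u)
      / ennreal (L2_set (\<lambda>i. e i - z i) I)"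
    by (simp add: n divide_ennreal_def)
  also have "\<dots> \<le> M_const I 2 half_square"
    unfolding M_const_def by (rule SUP_upper2[of "(e, z)"]) (use ez in auto)
  finally show ?thesis .
qed

text \<open>Only the term with the Lipschitz constant of the gradient is kept. Its growth like sqrt
  l compensates the 1 / l under the root of the final bound.\<close>

lemma SUP_B3_ge: "ennreal (sqrt (2 * (2 * real l + 1)) / 4) \<le> (SUP g\<in>test_class (orders l). B3 l g)"
proof (rule SUP_upper2)
  show "half_square \<in> test_class (orders l)" by (rule half_square_test_class) auto
  have "ennreal (sqrt (2 * (2 * real l + 1)) / 4) * 1 \<le> ennreal (sqrt (2 * (2 * real l + 1)) / 4) * M_const (orders l) 2 half_square"
    by (intro mult_left_mono M_const_half_square) auto
  then show "ennreal (sqrt (2 * (2 * real l + 1)) / 4) \<le> B3 l half_square"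
    unfolding B3_def by (auto intro: order_trans)
qed

text \<open>The right-hand side is free of \<open>l\<close> because the jump length is. Degree 0 is
  excluded since the constant harmonic has a nonzero integral.\<close>

lemma harmonic_gauss_bound:
  fixes N :: "'w \<Rightarrow> (real ^ 3) measure"
  assumes P: "prob_space P" and \<nu>: "0 < \<nu>"
    and N: "poisson_random_measure P (scale_measure (ennreal \<nu>) S2_measure) N"
    and pts: "charged_points P S2 N K \<xi>"
    and Q: "prob_space Q"
    and Z: "centred_gaussian_vector Q (orders l) (\<lambda>i j. if i = j then 4 * pi / (2 * real l + 1) else 0) Z"
    and l: "1 \<le> l"
  shows "d3 (orders l) P (coeff_vector \<nu> K \<xi> l) Q Z \<le> ennreal ((2 * pi + sqrt pi) / sqrt \<nu>)"
  unfolding d3_def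
proof (rule SUP_least)
  fix h assume h: "h \<in> test_class (orders l)"
  define \<mu> where "\<mu> = density S2_measure (\<lambda>_. ennreal \<nu>)"
  have s\<mu>: "space \<mu> = S2" "sets \<mu> = sets S2_measure" by (simp_all add: \<mu>_def space_S2_measure)
  have tot: "emeasure \<mu> (space \<mu>) = ennreal (4 * pi * \<nu>)"
  proof -
    have "emeasure \<mu> (space \<mu>) = ennreal \<nu> * emeasure S2_measure (space S2_measure)"
      by (simp add: \<mu>_def emeasure_density nn_integral_cmult_indicator)
    also have "\<dots> = ennreal (4 * pi * \<nu>)"
      using \<nu> by (simp add: space_S2_measure S2_measure_total ennreal_mult[symmetric] mult.commute)
    finally show ?thesis .
  qed
  have "finite_measure \<mu>" by (rule finite_measureI) (simp add: tot)
  then interpret charged_poisson P \<mu> N K \<xi>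
    using P N pts unfolding charged_poisson_def s\<mu>(1) by (simp add: \<mu>_def scale_measure_eq_density)
  have m: "measure \<mu> (space \<mu>) = 4 * pi * \<nu>" using tot \<nu> by (simp add: measure_def)
  define c where "c = sqrt (4 * pi / ((2 * real l + 1) * \<nu>))"
  have c2: "c\<^sup>2 = 4 * pi / ((2 * real l + 1) * \<nu>)" unfolding c_def using \<nu> by (intro real_sqrt_pow2) auto
  define f where "f z i = c * sph_harmonic l i z" for z i
  \<comment> \<open>The jump length: the addition theorem gives the squared norm
    \<open>c\<^sup>2 * ((2 * real l + 1) / (4 * pi))\<close>, which is
    \<open>1 / \<nu>\<close>.\<close>
  define r where "r = 1 / sqrt \<nu>"
  have r: "0 < r" "r\<^sup>2 = 1 / \<nu>" using \<nu> by (simp_all add: r_def power_divide)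
  have Y: "sph_harmonic l i \<in> borel_measurable S2_measure" if "i \<in> orders l" for i
    by (rule sph_harmonic_measurable[OF that])
  have pos: "2 * real l + 1 > 0" by simp
  have i\<mu>: "integral\<^sup>L \<mu> g = \<nu> * integral\<^sup>L S2_measure g" if "g \<in> borel_measurable S2_measure" for g :: "real ^ 3 \<Rightarrow> real"
    unfolding \<mu>_def using integral_const_density[of \<nu> g S2_measure] \<nu> that by simp
  have "\<bar>(\<integral>\<omega>. h (\<lambda>i\<in>orders l. total (\<lambda>z. f z i) \<omega>) \<partial>P) - (\<integral>\<omega>. h (Z \<omega>) \<partial>Q)\<bar>
    \<le> (measure \<mu> (space \<mu>) * r ^ 3 + sqrt (measure \<mu> (space \<mu>)) * r\<^sup>2) / 2"
  proof (rule poisson_gauss_bound[OF _ _ _ r(1) _ _ _ Q Z h])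
    show "0 < measure \<mu> (space \<mu>)" using \<nu> by (simp add: m)
    show "(\<lambda>z. f z i) \<in> borel_measurable \<mu>" if "i \<in> orders l" for i
      unfolding f_def measurable_cong_sets[OF s\<mu>(2) refl] using Y[OF that] by simp
    show "(\<Sum>i\<in>orders l. (f z i)\<^sup>2) = r\<^sup>2" for z
    proof -
      have "4 * pi / (D * \<nu>) * (D / (4 * pi)) = 1 / \<nu>" if "D > 0" for D :: real
        using that by simp
      from this[OF pos] show ?thesis
        unfolding f_def power_mult_distrib sum_distrib_left[symmetric] sum_sph_harmonic_sq c2 r(2) .
    qed
    show "(\<integral>z. f z i \<partial>\<mu>) = 0" if "i \<in> orders l" for i
      unfolding f_def using Y[OF that] integral_sph_harmonic[OF that l] by (subst i\<mu>) simp_all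
    show "(\<integral>z. f z i * f z j \<partial>\<mu>) = (if i = j then 4 * pi / (2 * real l + 1) else 0)"
      if ij: "i \<in> orders l" "j \<in> orders l" for i j
    proof -
      have "(\<integral>z. f z i * f z j \<partial>\<mu>) = (\<integral>z. c\<^sup>2 * (sph_harmonic l i z * sph_harmonic l j z) \<partial>\<mu>)"
        by (simp add: f_def power2_eq_square mult.assoc mult.left_commute)
      also have "\<dots> = \<nu> * (c\<^sup>2 * (if i = j then 1 else 0))"
        using Y[OF ij(1)] Y[OF ij(2)] by (subst i\<mu>) (simp_all add: integral_sph_harmonic_mult[OF ij])
      finally show ?thesis using \<nu> by (simp add: c2)
    qed
  qed simp
  \<comment> \<open>With total mass 4 \<pi> \<nu> the first term contributes 2 \<pi> / sqrt \<nu>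
    and the second sqrt \<pi> / sqrt \<nu>.\<close>
  also have "(measure \<mu> (space \<mu>) * r ^ 3 + sqrt (measure \<mu> (space \<mu>)) * r\<^sup>2) / 2 = (2 * pi + sqrt pi) / sqrt \<nu>"
  proof -
    have "4 * pi * \<nu> * r ^ 3 = 4 * pi * (\<nu> * r\<^sup>2) * r" by (simp add: power3_eq_cube power2_eq_square)
    also have "\<dots> = 4 * pi / sqrt \<nu>" using \<nu> r by (simp add: r_def)
    finally have 1: "4 * pi * \<nu> * r ^ 3 = 4 * pi / sqrt \<nu>" .
    have "sqrt (4 * pi * \<nu>) * r\<^sup>2 = 2 * sqrt pi * (sqrt \<nu> / \<nu>)" by (simp add: real_sqrt_mult r)
    also have "sqrt \<nu> / \<nu> = 1 / sqrt \<nu>" using \<nu> by (simp add: field_simps)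
    finally have 2: "sqrt (4 * pi * \<nu>) * r\<^sup>2 = 2 * sqrt pi / sqrt \<nu>" by simp
    show ?thesis unfolding m 1 2 by (simp add: add_divide_distrib)
  qed
  finally have b: "\<bar>(\<integral>\<omega>. h (\<lambda>i\<in>orders l. total (\<lambda>z. f z i) \<omega>) \<partial>P) - (\<integral>\<omega>. h (Z \<omega>) \<partial>Q)\<bar> \<le> (2 * pi + sqrt pi) / sqrt \<nu>" .
  have "coeff_vector \<nu> K \<xi> l \<omega> = (\<lambda>i\<in>orders l. total (\<lambda>z. f z i) \<omega>)" for \<omega>
    by (simp add: coeff_vector_def harmonic_coeff_def total_def f_def c_def sum_distrib_left)
  with b show "ennreal \<bar>(\<integral>\<omega>. h (coeff_vector \<nu> K \<xi> l \<omega>) \<partial>P) - (\<integral>\<omega>. h (Z \<omega>) \<partial>Q)\<bar> \<le> ennreal ((2 * pi + sqrt pi) / sqrt \<nu>)"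
    by (intro ennreal_leI) simp
qed

text \<open>The threshold makes ln l at least the square of the constant on the left. After
  squaring, the remaining factors on the right combine to (2 l + 1) / l times
  \<open>sqrt (4 * pi) * 1.539\<close>, which is at least 1.\<close>

lemma rate_dominates:
  assumes l: "real l \<ge> exp ((2 * pi + sqrt pi)\<^sup>2)" and \<nu>: "0 < \<nu>"
  shows "(2 * pi + sqrt pi) / sqrt \<nu>
    \<le> sqrt (2 * (2 * real l + 1)) / 4 * sqrt (8 * sqrt (4 * pi) * (1.539 * ln (real l) / (real l * \<nu>)))"
proof -
  define C where "C = 2 * pi + sqrt pi"
  have C: "0 \<le> C" by (simp add: C_def)
  have l0: "0 < real l" using l exp_gt_zero order_less_le_trans by blast
  have ln: "C\<^sup>2 \<le> ln (real l)" using l l0 by (simp add: C_def ln_ge_iff)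
  have s: "1 \<le> sqrt (4 * pi)" using pi_ge_two by simp
  have "C\<^sup>2 / \<nu> \<le> ln (real l) / \<nu>" using ln \<nu> by (simp add: divide_right_mono)
  also have "\<dots> \<le> (2 * (2 * real l + 1)) / 16 * (8 * sqrt (4 * pi) * (1.539 * ln (real l) / (real l * \<nu>)))"
  proof -
    define a where "a = ln (real l) / \<nu>"
    have a: "0 \<le> a" using ln \<nu> order_trans[OF zero_le_power2[of C] ln] by (simp add: a_def)
    define X where "X = (2 * real l + 1) / real l * (sqrt (4 * pi) * 1.539)"
    have eq: "(2 * (2 * real l + 1)) / 16 * (8 * sqrt (4 * pi) * (1.539 * ln (real l) / (real l * \<nu>))) = a * X"
      using l0 \<nu> by (simp add: a_def X_def field_simps)
    have "1 * 1 \<le> X" unfolding X_def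
    proof (rule mult_mono)
      show "1 \<le> (2 * real l + 1) / real l" using l0 by (simp add: field_simps)
      have "sqrt (4 * pi) * 1 \<le> sqrt (4 * pi) * 1.539" by (rule mult_left_mono) auto
      then have "sqrt (4 * pi) \<le> sqrt (4 * pi) * 1.539" by (simp only: mult_1_right)
      with s show "1 \<le> sqrt (4 * pi) * 1.539" by (rule order_trans)
    qed (use l0 in auto)
    then have "a * 1 \<le> a * X" using a by (intro mult_left_mono) auto
    then show ?thesis unfolding eq by (simp only: a_def mult_1_right)
  qed
  finally have "sqrt (C\<^sup>2 / \<nu>) \<le> sqrt ((2 * (2 * real l + 1)) / 16 * (8 * sqrt (4 * pi) * (1.539 * ln (real l) / (real l * \<nu>))))"
    by (rule real_sqrt_le_mono)
  moreover have "sqrt (C\<^sup>2 / \<nu>) = C / sqrt \<nu>" using C by (simp add: real_sqrt_divide)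
  moreover have "sqrt ((2 * (2 * real l + 1)) / 16 * x) = sqrt (2 * (2 * real l + 1)) / 4 * sqrt x" for x
    by (simp only: real_sqrt_mult real_sqrt_divide) simp
  ultimately show ?thesis by (simp only: C_def)
qed

theorem theorem2p5:
  fixes P :: "'w measure" and \<nu> :: "real \<Rightarrow> real"
    and N :: "real \<Rightarrow> 'w \<Rightarrow> (real ^ 3) measure"
    and K :: "real \<Rightarrow> 'w \<Rightarrow> nat" and \<xi> :: "real \<Rightarrow> nat \<Rightarrow> 'w \<Rightarrow> real ^ 3"
    and Q :: "'z measure" and Z :: "nat \<Rightarrow> 'z \<Rightarrow> int \<Rightarrow> real"
  assumes "prob_space P"
    and "\<And>t. t > 0 \<Longrightarrow> \<nu> t > 0"
    and "filterlim \<nu> at_top at_top"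
    and "\<And>t. t > 0 \<Longrightarrow> poisson_random_measure P (scale_measure (ennreal (\<nu> t)) S2_measure) (N t)"
    and "\<And>t. t > 0 \<Longrightarrow> charged_points P S2 (N t) (K t) (\<xi> t)"
    and "prob_space Q"
    and "\<And>l. centred_gaussian_vector Q (orders l)
               (\<lambda>i j. if i = j then 4 * pi / (2 * real l + 1) else 0) (Z l)"
  shows "\<exists>r :: nat \<times> real \<Rightarrow> real.
           r \<in> O[joint_limit \<nu>](\<lambda>(l, t). 1 / (real l * \<nu> t)) \<and>
           (\<forall>\<^sub>F (l, t) in joint_limit \<nu>.
              d3 (orders l) P (coeff_vector (\<nu> t) (K t) (\<xi> t) l) Q (Z l)
                \<le> (SUP g\<in>test_class (orders l). B3 l g) *
                   ennreal (sqrt (8 * sqrt (4 * pi) * (1.539 * ln (real l) / (real l * \<nu> t)) + r (l, t))))"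
proof (intro exI conjI)
  show "(\<lambda>_. 0) \<in> O[joint_limit \<nu>](\<lambda>(l, t). 1 / (real l * \<nu> t))" by simp
  \<comment> \<open>Only \<open>l\<close> has a threshold. The bound holds at every
    \<open>t > 0\<close>, so any threshold for the rate serves in
    \<open>eventually_joint_limit\<close>.\<close>
  define l0 where "l0 = nat \<lceil>exp ((2 * pi + sqrt pi)\<^sup>2)\<rceil>"
  have bound: "d3 (orders l) P (coeff_vector (\<nu> t) (K t) (\<xi> t) l) Q (Z l)
                \<le> (SUP g\<in>test_class (orders l). B3 l g) *
                   ennreal (sqrt (8 * sqrt (4 * pi) * (1.539 * ln (real l) / (real l * \<nu> t)) + 0))"
    if l: "l0 \<le> l" and t: "0 < t" for l t
  proof -
    have le: "exp ((2 * pi + sqrt pi)\<^sup>2) \<le> real l" using l unfolding l0_def by linarith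
    have "1 \<le> real l" using le one_le_exp_iff[of "(2 * pi + sqrt pi)\<^sup>2"] by (meson order_trans zero_le_power2)
    then have l1: "1 \<le> l" by simp
    let ?S = "sqrt (2 * (2 * real l + 1)) / 4"
    let ?R = "sqrt (8 * sqrt (4 * pi) * (1.539 * ln (real l) / (real l * \<nu> t)))"
    have R: "0 \<le> ?R" using assms(2)[OF t] l1 by simp
    have "d3 (orders l) P (coeff_vector (\<nu> t) (K t) (\<xi> t) l) Q (Z l) \<le> ennreal ((2 * pi + sqrt pi) / sqrt (\<nu> t))"
      by (rule harmonic_gauss_bound[OF assms(1) assms(2)[OF t] assms(4)[OF t] assms(5)[OF t] assms(6,7) l1])
    also have "\<dots> \<le> ennreal (?S * ?R)" by (rule ennreal_leI[OF rate_dominates[OF le assms(2)[OF t]]])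
    also have "\<dots> = ennreal ?S * ennreal ?R" using R by (intro ennreal_mult) auto
    also have "\<dots> \<le> (SUP g\<in>test_class (orders l). B3 l g) * ennreal ?R"
      by (intro mult_right_mono SUP_B3_ge) auto
    finally show ?thesis by simp
  qed
  show "\<forall>\<^sub>F (l, t) in joint_limit \<nu>.
              d3 (orders l) P (coeff_vector (\<nu> t) (K t) (\<xi> t) l) Q (Z l)
                \<le> (SUP g\<in>test_class (orders l). B3 l g) *
                   ennreal (sqrt (8 * sqrt (4 * pi) * (1.539 * ln (real l) / (real l * \<nu> t)) + (\<lambda>_. 0) (l, t)))"
    unfolding eventually_joint_limit case_prod_conv using bound by blast
qed

end
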